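(* Assume Hypotheses (H) on the data $(\Omega,\Gamma^D,\Gamma^N,N_0,P_0,N^D,P^D,\Psi^D,m,M)$ (see context). Let $\mathcal M=(\mathcal T,\mathcal E,\mathcal P)$ be an admissible mesh of $\Omega$ satisfying the regularity constraint: there exists $\xi>0$ such that $\mathrm d(x_K,\sigma)\ge \xi\,\mathrm{diam}(K)$ for all $K\in\mathcal T$ and all $\sigma\in\mathcal E_K$. Let $\Delta t>0$ and $\lambda\ge 0$. If $\lambda=0$, assume further that $P_0-N_0=0$ and $P^D-N^D=0$. Then there exists a solution $(N_K^n,P_K^n,\Psi_K^n)_{K\in\mathcal T}\in(\mathbb R^{\theta})^3$, $n\ge 0$ (with $\theta=\mathrm{Card}(\mathcal T)$), to the scheme $(\mathcal S_\lambda)$. Moreover, the approximate densities satisfy the $L^\infty$ estimate $$m\le N_K^n\le M,\qquad m\le P_K^n\le M,\qquad \forall K\in\mathcal T,\ \forall n\ge 0.$$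
   Context: **Hypotheses (H).** $\Omega$ is an open bounded subset of $\mathbb R^d$ ($d\ge1$), $\partial\Omega=\Gamma^D\cup\Gamma^N$ with $\Gamma^D\cap\Gamma^N=\emptyset$ and $\mathrm m(\Gamma^D)>0$. The boundary data $N^D,P^D,\Psi^D$ are traces of functions defined on all of $\Omega$, denoted the same way. Moreover $N_0,P_0\in L^\infty(\Omega)$, $N^D,P^D\in L^\infty(\Omega)\cap H^1(\Omega)$, $\Psi^D\in H^1(\Omega)$, and $m>0$, $M>0$ are constants such that $m\le N_0,P_0,N^D,P^D\le M$ a.e. on $\Omega$. **Admissible mesh.** $\mathcal M=(\mathcal T,\mathcal E,\mathcal P)$ where $\mathcal T$ is a finite family of pairwise disjoint open polygonal (polyhedral) convex subsets of $\Omega$ (control volumes), $\mathcal E$ is a finite family of edges (faces), i.e. subsets of $\overline\Omega$ contained in hyperplanes with positive $(d-1)$-dimensional measure, and $\mathcal P=(x_K)_{K\in\mathcal T}$ is a family of points, such that: the closure of the union of the control volumes is $\overline\Omega$; for each $K$ there is $\mathcal E_K\subset\mathcal E$ with $\partial K=\bigcup_{\sigma\in\mathcal E_K}\overline\sigma$, and $\mathcal E=\bigcup_K\mathcal E_K$; for $K\ne L$, either $\overline K\cap\overline L$ has zero $(d-1)$-measure or $\overline K\cap\overline L=\overline\sigma$ for some $\sigma\in\mathcal E$, then denoted $\sigma=K|L$; $x_K\in\overline K$, and if $\sigma=K|L$ then $x_K\neq x_L$ and the line through $x_K,x_L$ is orthogonal to $\sigma$; if $\sigma\in\mathcal E_K$,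 $\sigma\subset\partial\Omega$ and $x_K\notin\sigma$, the line through $x_K$ orthogonal to $\sigma$ meets $\sigma$. Edges are split as $\mathcal E=\mathcal E_{int}\cup\mathcal E_{ext}$ (interior edges $K|L$; edges in $\partial\Omega$), and $\mathcal E_{ext}=\mathcal E_{ext}^D\cup\mathcal E_{ext}^N$ (edges included in $\Gamma^D$, resp. $\Gamma^N$); likewise $\mathcal E_K=\mathcal E_{K,int}\cup\mathcal E_{K,ext}^D\cup\mathcal E_{K,ext}^N$. Set $\mathrm d_\sigma=\mathrm d(x_K,x_L)$ if $\sigma=K|L$, $\mathrm d_\sigma=\mathrm d(x_K,\sigma)$ if $\sigma\in\mathcal E_{ext}\cap\mathcal E_K$, and $\tau_\sigma=\mathrm m(\sigma)/\mathrm d_\sigma$, where $\mathrm m$ denotes Lebesgue measure in dimension $d$ or $d-1$ as appropriate. **Discrete vectors.** For $u_{\mathcal M}=((u_K)_{K\in\mathcal T},(u_\sigma)_{\sigma\in\mathcal E_{ext}^D})$, $K\in\mathcal T$, $\sigma\in\mathcal E_K$: $u_{K,\sigma}=u_L$ if $\sigma=K|L$, $u_{K,\sigma}=u_\sigma$ if $\sigma\in\mathcal E_{K,ext}^D$, $u_{K,\sigma}=u_K$ if $\sigma\in\mathcal E_{K,ext}^N$; $Du_{K,\sigma}=u_{K,\sigma}-u_K$. **Scheme $(\mathcal S_\lambda)$.** $B(0)=1$, $B(x)=x/(e^x-1)$ for $x\ne0$. Initial values: $(N_K^0,P_K^0)=\frac1{\mathrm m(K)}\int_K(N_0,P_0)\,dx$.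 Boundary values, for $\sigma\in\mathcal E_{ext}^D$ and all $n\ge0$: $(N_\sigma^n,P_\sigma^n,\Psi_\sigma^n)=(N_\sigma^D,P_\sigma^D,\Psi_\sigma^D)=\frac1{\mathrm m(\sigma)}\int_\sigma(N^D,P^D,\Psi^D)\,d\gamma$. The equations, for all $K\in\mathcal T$, $n\ge0$, are $$\mathrm m(K)\frac{N_K^{n+1}-N_K^n}{\Delta t}+\sum_{\sigma\in\mathcal E_K}\mathcal F_{K,\sigma}^{n+1}=0,\qquad \mathrm m(K)\frac{P_K^{n+1}-P_K^n}{\Delta t}+\sum_{\sigma\in\mathcal E_K}\mathcal G_{K,\sigma}^{n+1}=0,$$ $$-\lambda^2\sum_{\sigma\in\mathcal E_K}\tau_\sigma D\Psi_{K,\sigma}^n=\mathrm m(K)(P_K^n-N_K^n),$$ with the Scharfetter-Gummel fluxes $$\mathcal F_{K,\sigma}^{n+1}=\tau_\sigma\big(B(-D\Psi_{K,\sigma}^{n+1})N_K^{n+1}-B(D\Psi_{K,\sigma}^{n+1})N_{K,\sigma}^{n+1}\big),$$ $$\mathcal G_{K,\sigma}^{n+1}=\tau_\sigma\big(B(D\Psi_{K,\sigma}^{n+1})P_K^{n+1}-B(-D\Psi_{K,\sigma}^{n+1})P_{K,\sigma}^{n+1}\big).$$ For $\lambda=0$ (with $P_0=N_0$, $P^D=N^D$) the same system with $\lambda=0$ is equivalently: for all $K\in\mathcal T$, $n\ge0$, $$\mathrm m(K)\frac{N_K^{n+1}-N_K^n}{\Delta t}-\sum_{\sigma\in\mathcal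 E_K}\tau_\sigma\frac{B(D\Psi_{K,\sigma}^{n+1})+B(-D\Psi_{K,\sigma}^{n+1})}{2}DN_{K,\sigma}^{n+1}=0,$$ $$-\sum_{\sigma\in\mathcal E_K}\tau_\sigma D\Psi_{K,\sigma}^{n+1}(N_K^{n+1}+N_{K,\sigma}^{n+1})=0,\qquad P_K^n-N_K^n=0$$ (in this case $\Psi^0_K$ is not constrained).
   Formalization: For λ>0 it is additionally assumed that Γ^D has positive measure on the boundary of each connected component of Ω (automatic if Ω is connected); otherwise the discrete Poisson equation on a pure Neumann component can be unsolvable. *)

theory Defs
  imports "HOL-Analysis.Analysis"
begin

subsection \<open>Measure in dimension d - 1\<close>

definition hyperplanes :: "'a::euclidean_space set set" where
  "hyperplanes = {H. affine H \<and> aff_dim H = int DIM('a) - 1}"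

text \<open>Lebesgue measure on a hyperplane \<open>H\<close>, by Cavalieri's principle: the measure of \<open>A \<subseteq> H\<close>
  is the d-dimensional volume of the right cylinder of height 1 over \<open>A\<close>. For d = 1 it is the
  Dirac measure at the point \<open>H\<close>.\<close>

definition hyperplane_lebesgue :: "'a::euclidean_space set \<Rightarrow> 'a measure" where
  "hyperplane_lebesgue H =
     distr (restrict_space lborel {x. infdist x H \<le> 1 / 2}) borel (closest_point H)"

text \<open>The sum over all hyperplanes extends these measures to sets that are not contained in a single
  hyperplane. Two distinct hyperplanes meet in a null set of either one, so on a Borel subset of a
  hyperplane \<open>H\<close> the sum has the value of \<open>hyperplane_lebesgue H\<close>, and on a countable union of
  hyperplanes it is the usual surface measure (the (d - 1)-dimensional Hausdorff measure). This
  suffices here: the boundary of a set with an admissible mesh lies in finitely many hyperplanes.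
  A curved surface would get measure 0.\<close>

definition surface_measure :: "'a::euclidean_space measure" where
  "surface_measure = completion (measure_of UNIV (sets borel)
     (\<lambda>A. \<integral>\<^sup>+H. emeasure (hyperplane_lebesgue H) A \<partial>count_space hyperplanes))"


subsection \<open>Function spaces and traces\<close>

fun Ck :: "nat \<Rightarrow> ('a::euclidean_space \<Rightarrow> real) \<Rightarrow> bool" where
  "Ck 0 f \<longleftrightarrow> continuous_on UNIV f"
| "Ck (Suc k) f \<longleftrightarrow> (\<forall>x. f differentiable (at x)) \<and>
     (\<forall>i\<in>Basis. Ck k (\<lambda>x. frechet_derivative f (at x) i))"

definition smooth :: "('a::euclidean_space \<Rightarrow> real) \<Rightarrow> bool" where
  "smooth f \<longleftrightarrow> (\<forall>k. Ck k f)"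

definition grad :: "('a::euclidean_space \<Rightarrow> real) \<Rightarrow> 'a \<Rightarrow> 'a" where
  "grad f x = (\<Sum>i\<in>Basis. frechet_derivative f (at x) i *\<^sub>R i)"

definition test_function :: "'a::euclidean_space set \<Rightarrow> ('a \<Rightarrow> real) \<Rightarrow> bool" where
  "test_function \<Omega> \<phi> \<longleftrightarrow> smooth \<phi> \<and> (\<exists>S. compact S \<and> S \<subseteq> \<Omega> \<and> (\<forall>x. x \<notin> S \<longrightarrow> \<phi> x = 0))"

definition in_Linfty :: "'a::euclidean_space set \<Rightarrow> ('a \<Rightarrow> real) \<Rightarrow> bool" where
  "in_Linfty \<Omega> u \<longleftrightarrow> u \<in> borel_measurable (lebesgue_on \<Omega>) \<and>
     (\<exists>C. AE x in lebesgue_on \<Omega>. \<bar>u x\<bar> \<le> C)"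

definition in_L2 :: "'a measure \<Rightarrow> ('a \<Rightarrow> 'b::euclidean_space) \<Rightarrow> bool" where
  "in_L2 \<mu> u \<longleftrightarrow> u \<in> borel_measurable \<mu> \<and> integrable \<mu> (\<lambda>x. (norm (u x))\<^sup>2)"

definition weak_gradient ::
    "'a::euclidean_space set \<Rightarrow> ('a \<Rightarrow> real) \<Rightarrow> ('a \<Rightarrow> 'a) \<Rightarrow> bool" where
  "weak_gradient \<Omega> u G \<longleftrightarrow> (\<forall>\<phi>. test_function \<Omega> \<phi> \<longrightarrow> (\<forall>i\<in>Basis.
     (LINT x|lebesgue_on \<Omega>. u x * frechet_derivative \<phi> (at x) i)
       = - (LINT x|lebesgue_on \<Omega>. (G x \<bullet> i) * \<phi> x)))"

definition H1_with_gradient ::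
    "'a::euclidean_space set \<Rightarrow> ('a \<Rightarrow> real) \<Rightarrow> ('a \<Rightarrow> 'a) \<Rightarrow> bool" where
  "H1_with_gradient \<Omega> u G \<longleftrightarrow>
     in_L2 (lebesgue_on \<Omega>) u \<and> in_L2 (lebesgue_on \<Omega>) G \<and> weak_gradient \<Omega> u G"

definition in_H1 :: "'a::euclidean_space set \<Rightarrow> ('a \<Rightarrow> real) \<Rightarrow> bool" where
  "in_H1 \<Omega> u \<longleftrightarrow> (\<exists>G. H1_with_gradient \<Omega> u G)"

definition L2_converges ::
    "'a measure \<Rightarrow> (nat \<Rightarrow> 'a \<Rightarrow> 'b::euclidean_space) \<Rightarrow> ('a \<Rightarrow> 'b) \<Rightarrow> bool" where
  "L2_converges \<mu> v u \<longleftrightarrow> (\<lambda>k. \<integral>\<^sup>+x. ennreal ((norm (v k x - u x))\<^sup>2) \<partial>\<mu>) \<longlonglongrightarrow> 0"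

text \<open>\<open>g\<close> is the trace on \<open>\<Gamma> \<subseteq> \<partial>\<Omega>\<close> of \<open>u \<in> H\<^sup>1(\<Omega>)\<close>. The trace operator is the continuous extension
  to \<open>H\<^sup>1(\<Omega>)\<close> of the restriction to the boundary of functions smooth up to the boundary.\<close>

definition is_trace ::
    "'a::euclidean_space set \<Rightarrow> 'a set \<Rightarrow> ('a \<Rightarrow> real) \<Rightarrow> ('a \<Rightarrow> real) \<Rightarrow> bool" where
  "is_trace \<Omega> \<Gamma> u g \<longleftrightarrow> in_L2 (restrict_space surface_measure \<Gamma>) g \<and>
     (\<exists>G \<phi>. H1_with_gradient \<Omega> u G \<and> (\<forall>k::nat. smooth (\<phi> k)) \<and>
        L2_converges (lebesgue_on \<Omega>) \<phi> u \<and>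
        L2_converges (lebesgue_on \<Omega>) (\<lambda>k. grad (\<phi> k)) G \<and>
        L2_converges (restrict_space surface_measure \<Gamma>) \<phi> g)"


subsection \<open>Data\<close>

text \<open>As on paper, one symbol stands for a function on \<open>\<Omega>\<close> and for its trace: the values of \<open>ND\<close>,
  \<open>PD\<close>, \<open>PsiD\<close> on the open set \<open>\<Omega>\<close> are those of the \<open>H\<^sup>1\<close> function, their values on
  \<open>\<Gamma>D \<subseteq> \<partial>\<Omega>\<close> are the boundary data.\<close>

definition hypotheses_H ::
    "'a::euclidean_space set \<Rightarrow> 'a set \<Rightarrow> 'a set \<Rightarrow> ('a \<Rightarrow> real) \<Rightarrow> ('a \<Rightarrow> real) \<Rightarrow>
     ('a \<Rightarrow> real) \<Rightarrow> ('a \<Rightarrow> real) \<Rightarrow> ('a \<Rightarrow> real) \<Rightarrow> real \<Rightarrow> real \<Rightarrow> bool" where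
  "hypotheses_H \<Omega> \<Gamma>D \<Gamma>N N0 P0 ND PD PsiD m M \<longleftrightarrow>
     open \<Omega> \<and> bounded \<Omega> \<and>
     frontier \<Omega> = \<Gamma>D \<union> \<Gamma>N \<and> \<Gamma>D \<inter> \<Gamma>N = {} \<and> emeasure surface_measure \<Gamma>D > 0 \<and>
     in_Linfty \<Omega> N0 \<and> in_Linfty \<Omega> P0 \<and>
     in_Linfty \<Omega> ND \<and> in_H1 \<Omega> ND \<and> is_trace \<Omega> \<Gamma>D ND ND \<and>
     in_Linfty \<Omega> PD \<and> in_H1 \<Omega> PD \<and> is_trace \<Omega> \<Gamma>D PD PD \<and>
     in_H1 \<Omega> PsiD \<and> is_trace \<Omega> \<Gamma>D PsiD PsiD \<and>
     m > 0 \<and> M > 0 \<and>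
     (AE x in lebesgue_on \<Omega>. m \<le> N0 x \<and> N0 x \<le> M \<and> m \<le> P0 x \<and> P0 x \<le> M \<and>
        m \<le> ND x \<and> ND x \<le> M \<and> m \<le> PD x \<and> PD x \<le> M)"

text \<open>For connected \<open>\<Omega>\<close> this is the same as \<open>m(\<Gamma>D) > 0\<close>. It is needed when \<open>\<lambda> > 0\<close>: on a connected
  component with pure Neumann conditions, summing the discrete Poisson equation over the component
  shows that it has no solution unless the mean of \<open>P - N\<close> over this component vanishes.\<close>

definition dirichlet_on_components :: "'a::euclidean_space set \<Rightarrow> 'a set \<Rightarrow> bool" where
  "dirichlet_on_components \<Omega> \<Gamma>D \<longleftrightarrow>
     (\<forall>C\<in>components \<Omega>. emeasure surface_measure (\<Gamma>D \<inter> frontier C) > 0)"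


subsection \<open>Admissible meshes\<close>

record 'a mesh =
  cells :: "'a set set"
  edges :: "'a set set"
  edges_of :: "'a set \<Rightarrow> 'a set set"
  center :: "'a set \<Rightarrow> 'a"

text \<open>\<open>interface \<T> K L \<sigma>\<close> means \<open>\<sigma> = K|L\<close>.\<close>

definition interface :: "'a::euclidean_space mesh \<Rightarrow> 'a set \<Rightarrow> 'a set \<Rightarrow> 'a set \<Rightarrow> bool" where
  "interface \<T> K L \<sigma> \<longleftrightarrow> K \<in> cells \<T> \<and> L \<in> cells \<T> \<and> K \<noteq> L \<and>
     \<sigma> \<in> edges_of \<T> K \<and> \<sigma> \<in> edges_of \<T> L \<and> closure K \<inter> closure L = closure \<sigma>"

definition int_edges :: "'a::euclidean_space mesh \<Rightarrow> 'a set set" where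
  "int_edges \<T> = {\<sigma> \<in> edges \<T>. \<exists>K L. interface \<T> K L \<sigma>}"

definition ext_edges :: "'a::euclidean_space set \<Rightarrow> 'a mesh \<Rightarrow> 'a set set" where
  "ext_edges \<Omega> \<T> = {\<sigma> \<in> edges \<T>. \<sigma> \<subseteq> frontier \<Omega>}"

text \<open>Edges may or may not contain points of their relative boundary; as for polygonal faces, this
  boundary has to be a null set. That interior edges lie inside \<open>\<Omega>\<close>, and in particular are not
  exterior ones, is expressed by \<open>\<sigma> \<inter> \<partial>\<Omega>\<close> being a null set, because a non-open edge may have
  end points on \<open>\<partial>\<Omega>\<close>. Since an edge spans its hyperplane, orthogonality to \<open>\<sigma>\<close> is orthogonality
  to all differences of points of \<open>\<sigma>\<close>.\<close>

definition admissible_mesh ::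
    "'a::euclidean_space set \<Rightarrow> 'a set \<Rightarrow> 'a set \<Rightarrow> 'a mesh \<Rightarrow> bool" where
  "admissible_mesh \<Omega> \<Gamma>D \<Gamma>N \<T> \<longleftrightarrow>
     finite (cells \<T>) \<and> disjoint (cells \<T>) \<and>
     (\<forall>K\<in>cells \<T>. K \<noteq> {} \<and> open K \<and> convex K \<and> polytope (closure K) \<and> K \<subseteq> \<Omega>) \<and>
     closure (\<Union>(cells \<T>)) = closure \<Omega> \<and>
     finite (edges \<T>) \<and>
     (\<forall>\<sigma>\<in>edges \<T>. \<sigma> \<subseteq> closure \<Omega> \<and> (\<exists>H\<in>hyperplanes. \<sigma> \<subseteq> H) \<and>
        emeasure surface_measure \<sigma> > 0 \<and> closure \<sigma> - \<sigma> \<in> null_sets surface_measure) \<and>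
     edges \<T> = (\<Union>K\<in>cells \<T>. edges_of \<T> K) \<and>
     (\<forall>K\<in>cells \<T>. frontier K = (\<Union>\<sigma>\<in>edges_of \<T> K. closure \<sigma>)) \<and>
     (\<forall>K\<in>cells \<T>. \<forall>L\<in>cells \<T>. K \<noteq> L \<longrightarrow>
        emeasure surface_measure (closure K \<inter> closure L) = 0 \<or> (\<exists>!\<sigma>. interface \<T> K L \<sigma>)) \<and>
     (\<forall>K\<in>cells \<T>. center \<T> K \<in> closure K) \<and>
     (\<forall>K L \<sigma>. interface \<T> K L \<sigma> \<longrightarrow> center \<T> K \<noteq> center \<T> L \<and>
        (\<forall>y\<in>\<sigma>. \<forall>z\<in>\<sigma>. (center \<T> L - center \<T> K) \<bullet> (y - z) = 0)) \<and>
     (\<forall>K\<in>cells \<T>. \<forall>\<sigma>\<in>edges_of \<T> K. \<sigma> \<subseteq> frontier \<Omega> \<and> center \<T> K \<notin> \<sigma> \<longrightarrow>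
        (\<exists>p\<in>\<sigma>. \<forall>y\<in>\<sigma>. \<forall>z\<in>\<sigma>. (p - center \<T> K) \<bullet> (y - z) = 0)) \<and>
     edges \<T> = int_edges \<T> \<union> ext_edges \<Omega> \<T> \<and>
     (\<forall>\<sigma>\<in>int_edges \<T>. \<sigma> \<inter> frontier \<Omega> \<in> null_sets surface_measure) \<and>
     (\<forall>\<sigma>\<in>ext_edges \<Omega> \<T>. \<sigma> \<subseteq> \<Gamma>D \<or> \<sigma> \<subseteq> \<Gamma>N)"

definition regular_mesh :: "'a::euclidean_space mesh \<Rightarrow> bool" where
  "regular_mesh \<T> \<longleftrightarrow> (\<exists>\<xi>>0. \<forall>K\<in>cells \<T>. \<forall>\<sigma>\<in>edges_of \<T> K.
     infdist (center \<T> K) \<sigma> \<ge> \<xi> * diameter K)"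

text \<open>The cell on the other side of an interior edge \<open>\<sigma>\<close> of \<open>K\<close>; at most two of the pairwise disjoint
  convex cells can have \<open>\<sigma>\<close> on their boundary.\<close>

definition neighbour :: "'a::euclidean_space mesh \<Rightarrow> 'a set \<Rightarrow> 'a set \<Rightarrow> 'a set" where
  "neighbour \<T> K \<sigma> = (THE L. interface \<T> K L \<sigma>)"

text \<open>The distance \<open>d\<^sub>\<sigma>\<close> for \<open>\<sigma> \<in> \<E>\<^sub>K\<close>; for an interior edge it is the same from both sides.\<close>

definition edge_dist :: "'a::euclidean_space mesh \<Rightarrow> 'a set \<Rightarrow> 'a set \<Rightarrow> real" where
  "edge_dist \<T> K \<sigma> =
     (if \<sigma> \<in> int_edges \<T> then dist (center \<T> K) (center \<T> (neighbour \<T> K \<sigma>))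
      else infdist (center \<T> K) \<sigma>)"

definition transmissibility :: "'a::euclidean_space mesh \<Rightarrow> 'a set \<Rightarrow> 'a set \<Rightarrow> real" where
  "transmissibility \<T> K \<sigma> = measure surface_measure \<sigma> / edge_dist \<T> K \<sigma>"


subsection \<open>The scheme\<close>

definition bernoulli_fun :: "real \<Rightarrow> real" where
  "bernoulli_fun x = (if x = 0 then 1 else x / (exp x - 1))"

definition cell_mean :: "('a::euclidean_space \<Rightarrow> real) \<Rightarrow> 'a set \<Rightarrow> real" where
  "cell_mean f K = set_lebesgue_integral lebesgue K f / measure lebesgue K"

definition edge_mean :: "('a::euclidean_space \<Rightarrow> real) \<Rightarrow> 'a set \<Rightarrow> real" where
  "edge_mean f \<sigma> = set_lebesgue_integral surface_measure \<sigma> f / measure surface_measure \<sigma>"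

text \<open>\<open>u\<^sub>K\<^sub>,\<^sub>\<sigma>\<close> for a discrete vector with cell values \<open>u\<close> and values \<open>uD\<close> on the Dirichlet edges;
  the last case is that of Neumann edges.\<close>

definition edge_value :: "'a::euclidean_space set \<Rightarrow> 'a set \<Rightarrow> 'a mesh \<Rightarrow> ('a set \<Rightarrow> real) \<Rightarrow>
    ('a set \<Rightarrow> real) \<Rightarrow> 'a set \<Rightarrow> 'a set \<Rightarrow> real" where
  "edge_value \<Omega> \<Gamma>D \<T> uD u K \<sigma> =
     (if \<sigma> \<in> int_edges \<T> then u (neighbour \<T> K \<sigma>)
      else if \<sigma> \<in> ext_edges \<Omega> \<T> \<and> \<sigma> \<subseteq> \<Gamma>D then uD \<sigma>
      else u K)"

definition edge_diff :: "'a::euclidean_space set \<Rightarrow> 'a set \<Rightarrow> 'a mesh \<Rightarrow> ('a set \<Rightarrow> real) \<Rightarrow>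
    ('a set \<Rightarrow> real) \<Rightarrow> 'a set \<Rightarrow> 'a set \<Rightarrow> real" where
  "edge_diff \<Omega> \<Gamma>D \<T> uD u K \<sigma> = edge_value \<Omega> \<Gamma>D \<T> uD u K \<sigma> - u K"

text \<open>The flux \<open>\<F>\<^sub>K\<^sub>,\<^sub>\<sigma>\<close> of \<open>u\<close> for the potential differences \<open>d = D\<Psi>\<^sub>K\<^sub>,\<^sub>\<sigma>\<close>; \<open>\<G>\<^sub>K\<^sub>,\<^sub>\<sigma>\<close> is obtained for \<open>- d\<close>.\<close>

definition sg_flux :: "'a::euclidean_space set \<Rightarrow> 'a set \<Rightarrow> 'a mesh \<Rightarrow> ('a set \<Rightarrow> real) \<Rightarrow>
    ('a set \<Rightarrow> real) \<Rightarrow> real \<Rightarrow> 'a set \<Rightarrow> 'a set \<Rightarrow> real" where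
  "sg_flux \<Omega> \<Gamma>D \<T> uD u d K \<sigma> = transmissibility \<T> K \<sigma> *
     (bernoulli_fun (- d) * u K - bernoulli_fun d * edge_value \<Omega> \<Gamma>D \<T> uD u K \<sigma>)"

definition scheme_solution :: "'a::euclidean_space set \<Rightarrow> 'a set \<Rightarrow> 'a mesh \<Rightarrow> real \<Rightarrow> real \<Rightarrow>
    ('a \<Rightarrow> real) \<Rightarrow> ('a \<Rightarrow> real) \<Rightarrow> ('a \<Rightarrow> real) \<Rightarrow> ('a \<Rightarrow> real) \<Rightarrow> ('a \<Rightarrow> real) \<Rightarrow>
    (nat \<Rightarrow> 'a set \<Rightarrow> real) \<Rightarrow> (nat \<Rightarrow> 'a set \<Rightarrow> real) \<Rightarrow> (nat \<Rightarrow> 'a set \<Rightarrow> real) \<Rightarrow> bool" where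
  "scheme_solution \<Omega> \<Gamma>D \<T> lam dt N0 P0 ND PD PsiD N P Psi \<longleftrightarrow>
    (\<forall>K\<in>cells \<T>. N 0 K = cell_mean N0 K \<and> P 0 K = cell_mean P0 K) \<and>
    (\<forall>n. \<forall>K\<in>cells \<T>.
      measure lebesgue K * (N (Suc n) K - N n K) / dt
        + (\<Sum>\<sigma>\<in>edges_of \<T> K. sg_flux \<Omega> \<Gamma>D \<T> (edge_mean ND) (N (Suc n))
             (edge_diff \<Omega> \<Gamma>D \<T> (edge_mean PsiD) (Psi (Suc n)) K \<sigma>) K \<sigma>) = 0 \<and>
      measure lebesgue K * (P (Suc n) K - P n K) / dt
        + (\<Sum>\<sigma>\<in>edges_of \<T> K. sg_flux \<Omega> \<Gamma>D \<T> (edge_mean PD) (P (Suc n))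
             (- edge_diff \<Omega> \<Gamma>D \<T> (edge_mean PsiD) (Psi (Suc n)) K \<sigma>) K \<sigma>) = 0 \<and>
      - lam\<^sup>2 * (\<Sum>\<sigma>\<in>edges_of \<T> K. transmissibility \<T> K \<sigma> *
             edge_diff \<Omega> \<Gamma>D \<T> (edge_mean PsiD) (Psi n) K \<sigma>)
        = measure lebesgue K * (P n K - N n K))"

end

theory Submission
  imports Defs
begin

text \<open>After inserting the Poisson equation, the transport equations become
  \<open>m(K) (N\<^sub>K - N\<^sup>0\<^sub>K) / \<Delta>t = \<Sum> \<tau> B(D\<Psi>) DN + N\<^sub>K m(K) (P\<^sub>K - N\<^sub>K) / \<lambda>\<^sup>2\<close>, and symmetrically for \<open>P\<close>, where \<open>N\<^sup>0\<close> is the previous value,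
  because \<open>B(-x) = B(x) + x\<close>. The discrete maximum principle, applied where the maximum or
  minimum of \<open>N\<close> and \<open>P\<close> together is attained, gives the bounds for every nonnegative solution, and
  nonnegativity follows by adding the conservation equations over the cells with a negative value.

  One time step is solvable by the Poincare-Miranda theorem on a box: the maximum principle
  provides the signs of the residuals on the faces \<open>N\<^sub>K, P\<^sub>K \<in> {m, M}\<close>, and on the faces
  \<open>\<Psi>\<^sub>K = \<plusminus>R\<^sub>K\<close> they come from a strict supersolution \<open>R\<close> of the discrete Laplacian. It exists because
  every cell is connected to a Dirichlet edge: an open connected set is not disconnected by finitely
  many convex sets of codimension 2. For \<open>\<lambda> = 0\<close> a constant \<open>R\<close> suffices.

  That the traces take values in \<open>[m, M]\<close> on the Dirichlet edges is seen by comparing smooth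
  approximations on an edge with their values in a layer of width \<open>h\<close> inside the adjacent cell. The
  error is \<open>O(h)\<close> times the squared norm of the gradient.\<close>


subsection \<open>The Poincare-Miranda theorem\<close>

text \<open>The bounds are claimed for every solution, so no sign of the densities may be
  presupposed. In the reaction form the term \<open>N (P - N)\<close> has the right sign at an
  extremum only where the density is nonnegative; this has to be settled beforehand in the
  conservative form, where interior fluxes cancel. For existence, Poincare-Miranda treats all
  unknowns of a time step at once: no linearised problem has to be solvable and no truncation has to
  be removed afterwards, because the sign of each residual on its face holds for all values of the
  other unknowns in the box. For \<lambda> > 0 the potential residual must beat the charge
  \<open>m(K) (P - N)\<close>, hence a barrier that is strict in every cell; for \<lambda> = 0 its
  equation is homogeneous and weak signs suffice. Geometry enters only through symmetric adjacency
  of the cells, their connection to the Dirichlet boundary, and the bounds for the boundary means.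
  The last are not immediate: edges are Lebesgue null sets, so almost everywhere bounds on \<Omega>
  reach them only through the gradient control contained in the trace.\<close>

lemma common_convergent_subseq:
  fixes X :: "nat \<Rightarrow> 'j \<Rightarrow> real"
  assumes "finite J" "\<And>k j. j \<in> J \<Longrightarrow> lo j \<le> X k j \<and> X k j \<le> hi j"
  shows "\<exists>r l. strict_mono (r :: nat \<Rightarrow> nat) \<and> (\<forall>j\<in>J. (\<lambda>k. X (r k) j) \<longlonglongrightarrow> l j)"
  using assms
proof (induction J rule: finite_induct)
  case empty
  show ?case by (intro exI[of _ id]) (auto simp: strict_mono_def)
next
  case (insert i J)
  then obtain r l where r: "strict_mono r" "\<forall>j\<in>J. (\<lambda>k. X (r k) j) \<longlonglongrightarrow> l j"
    by (metis insertCI)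
  have "compact {lo i..hi i}" by simp
  moreover have "\<forall>k. X (r k) i \<in> {lo i..hi i}" using insert.prems by auto
  ultimately obtain a q where q: "strict_mono (q :: nat \<Rightarrow> nat)" "((\<lambda>k. X (r k) i) \<circ> q) \<longlonglongrightarrow> a"
    unfolding compact_def by meson
  have "(\<lambda>k. X ((r \<circ> q) k) j) \<longlonglongrightarrow> (l(i := a)) j" if "j \<in> insert i J" for j
    using that q r(2) insert.hyps LIMSEQ_subseq_LIMSEQ[OF _ q(1), of "\<lambda>k. X (r k) j" "l j"]
    by (auto simp: o_def)
  then show ?case using strict_mono_o[OF r(1) q(1)] by blast
qed

text \<open>Kuhn's combinatorial lemma is applied to the grid of width 1/p, with the sign of
  \<open>F x i\<close> as the label of x in direction i. It yields a grid cube on which every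
  component takes both signs; as p tends to infinity these cubes shrink to a point where all
  components vanish. Points are functions on indices below \<open>n\<close>, since the dimension
  will depend on the mesh.\<close>

lemma poincare_miranda_unit_cube:
  fixes F :: "(nat \<Rightarrow> real) \<Rightarrow> nat \<Rightarrow> real"
  assumes cont: "\<And>X x i. i < n \<Longrightarrow> \<forall>k. \<forall>j<n. 0 \<le> X k j \<and> X k j \<le> 1 \<Longrightarrow> \<forall>j<n. 0 \<le> x j \<and> x j \<le> 1 \<Longrightarrow>
      \<forall>j<n. (\<lambda>k. X k j) \<longlonglongrightarrow> x j \<Longrightarrow> (\<lambda>k. F (X k) i) \<longlonglongrightarrow> F x i"
    and low: "\<And>x i. i < n \<Longrightarrow> \<forall>j<n. 0 \<le> x j \<and> x j \<le> 1 \<Longrightarrow> x i = 0 \<Longrightarrow> F x i \<le> 0"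
    and high: "\<And>x i. i < n \<Longrightarrow> \<forall>j<n. 0 \<le> x j \<and> x j \<le> 1 \<Longrightarrow> x i = 1 \<Longrightarrow> F x i \<ge> 0"
  obtains x where "\<forall>j<n. 0 \<le> x j \<and> x j \<le> 1" "\<forall>i<n. F x i = 0"
proof -
  define sc where "sc = (\<lambda>(p::nat) (q::nat\<Rightarrow>nat) j. real (q j) / real p)"
  \<comment> \<open>On the two faces the label is forced, as Kuhn's lemma requires. The sign
    conditions \<open>low\<close> and \<open>high\<close> make the forced labels agree with the weak
    sign of F.\<close>
  define lab where "lab = (\<lambda>p q i. if q i = 0 then 0 else if q i = p then 1
      else if F (sc p q) i < 0 then 0 else (1::nat))"
  have kuhn: "\<exists>q. (\<forall>i<n. q i < p) \<and> (\<forall>i<n. \<exists>r s. (\<forall>j<n. q j \<le> r j \<and> r j \<le> q j + 1) \<and>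
      (\<forall>j<n. q j \<le> s j \<and> s j \<le> q j + 1) \<and> lab p r i \<noteq> lab p s i)" if "0 < p" for p
  proof -
    have "\<forall>x. (\<forall>i<n. x i \<le> p) \<longrightarrow> (\<forall>i<n. lab p x i = 0 \<or> lab p x i = 1)"
      "\<forall>x. (\<forall>i<n. x i \<le> p) \<longrightarrow> (\<forall>i<n. x i = 0 \<longrightarrow> lab p x i = 0)"
      "\<forall>x. (\<forall>i<n. x i \<le> p) \<longrightarrow> (\<forall>i<n. x i = p \<longrightarrow> lab p x i = 1)"
      using that by (auto simp: lab_def)
    from kuhn_lemma[OF that this] show ?thesis by metis
  qed
  then have "\<exists>q. (\<forall>i<n. q i < p) \<and> (\<forall>i<n. \<exists>r s. (\<forall>j<n. q j \<le> r j \<and> r j \<le> q j + 1) \<and>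
      (\<forall>j<n. q j \<le> s j \<and> s j \<le> q j + 1) \<and> F (sc p r) i \<le> 0 \<and> F (sc p s) i \<ge> 0)" if "0 < p" for p
  proof -
    obtain q where q: "\<forall>i<n. q i < p" "\<forall>i<n. \<exists>r s. (\<forall>j<n. q j \<le> r j \<and> r j \<le> q j + 1) \<and>
      (\<forall>j<n. q j \<le> s j \<and> s j \<le> q j + 1) \<and> lab p r i \<noteq> lab p s i"
      using kuhn[OF \<open>0 < p\<close>] by blast
    have sgn: "(lab p r i = 0 \<longrightarrow> F (sc p r) i \<le> 0) \<and> (lab p r i = 1 \<longrightarrow> F (sc p r) i \<ge> 0)"
      if "\<forall>j<n. q j \<le> r j \<and> r j \<le> q j + 1" "i < n" for r i
    proof -
      have "\<forall>j<n. r j \<le> p" using that(1) q(1) by (metis Suc_eq_plus1 Suc_leI le_trans)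
      then have "\<forall>j<n. 0 \<le> sc p r j \<and> sc p r j \<le> 1"
        using \<open>0 < p\<close> by (auto simp: sc_def)
      then show ?thesis
        using low[of i "sc p r"] high[of i "sc p r"] \<open>i < n\<close> \<open>0 < p\<close>
        by (auto simp: lab_def sc_def not_less)
    qed
    have lab01: "lab p r i = 0 \<or> lab p r i = 1" for r i by (auto simp: lab_def)
    have "\<exists>r s. (\<forall>j<n. q j \<le> r j \<and> r j \<le> q j + 1) \<and>
      (\<forall>j<n. q j \<le> s j \<and> s j \<le> q j + 1) \<and> F (sc p r) i \<le> 0 \<and> F (sc p s) i \<ge> 0" if "i < n" for i
    proof -
      from q(2)[rule_format, OF that] obtain r s where rs: "\<forall>j<n. q j \<le> r j \<and> r j \<le> q j + 1" "\<forall>j<n. q j \<le> s j \<and> s j \<le> q j + 1"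
         "lab p r i \<noteq> lab p s i" by (elim exE conjE)
      then consider "lab p r i = 0" "lab p s i = 1" | "lab p s i = 0" "lab p r i = 1"
        using lab01[of r i] lab01[of s i] by auto
      then show ?thesis
      proof cases
        case 1
        then show ?thesis using sgn[OF rs(1) that] sgn[OF rs(2) that] rs by (intro exI[of _ r] exI[of _ s]) simp
      next
        case 2
        then show ?thesis using sgn[OF rs(1) that] sgn[OF rs(2) that] rs by (intro exI[of _ s] exI[of _ r]) simp
      qed
    qed
    then show ?thesis using q(1) by blast
  qed
  from this[OF zero_less_Suc] obtain q where
    q: "\<And>k i. i < n \<Longrightarrow> q k i < Suc k" and
    ex: "\<And>k i. i < n \<Longrightarrow> \<exists>r s. (\<forall>j<n. q k j \<le> r j \<and> r j \<le> q k j + 1) \<and>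
      (\<forall>j<n. q k j \<le> s j \<and> s j \<le> q k j + 1) \<and> F (sc (Suc k) r) i \<le> 0 \<and> F (sc (Suc k) s) i \<ge> 0"
    by metis
  define Q where "Q = (\<lambda>k i r s. (\<forall>j<n. q k j \<le> r j \<and> r j \<le> q k j + 1) \<and>
      (\<forall>j<n. q k j \<le> s j \<and> s j \<le> q k j + 1) \<and> F (sc (Suc k) r) i \<le> 0 \<and> F (sc (Suc k) s) i \<ge> 0)"
  have "\<And>k i. i < n \<Longrightarrow> \<exists>r s. Q k i r s" using ex unfolding Q_def by blast
  moreover define r where "r = (\<lambda>k i. SOME r. \<exists>s. Q k i r s)"
  moreover define s where "s = (\<lambda>k i. SOME s. Q k i (r k i) s)"
  ultimately have Q: "\<And>k i. i < n \<Longrightarrow> Q k i (r k i) (s k i)" by (metis (mono_tags) someI_ex)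
  have r: "\<And>k i j. i < n \<Longrightarrow> j < n \<Longrightarrow> q k j \<le> r k i j \<and> r k i j \<le> q k j + 1"
    and s: "\<And>k i j. i < n \<Longrightarrow> j < n \<Longrightarrow> q k j \<le> s k i j \<and> s k i j \<le> q k j + 1"
    and Fr: "\<And>k i. i < n \<Longrightarrow> F (sc (Suc k) (r k i)) i \<le> 0"
    and Fs: "\<And>k i. i < n \<Longrightarrow> F (sc (Suc k) (s k i)) i \<ge> 0"
    using Q unfolding Q_def by auto
  have q01: "0 \<le> sc (Suc k) (q k) j \<and> sc (Suc k) (q k) j \<le> 1" if "j < n" for k j
  proof -
    have "real (q k j) \<le> real (Suc k)" using q[OF that, of k] by (intro of_nat_mono) simp
    then show ?thesis by (simp add: sc_def del: of_nat_Suc)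
  qed
  have "\<exists>u l. strict_mono (u :: nat \<Rightarrow> nat) \<and> (\<forall>j\<in>{..<n}. (\<lambda>k. sc (Suc (u k)) (q (u k)) j) \<longlonglongrightarrow> l j)"
    by (rule common_convergent_subseq[where lo = "\<lambda>_. 0" and hi = "\<lambda>_. 1"])
       (use q01 in auto)
  then obtain u x where u: "strict_mono (u :: nat \<Rightarrow> nat)"
    and lim: "\<And>j. j < n \<Longrightarrow> (\<lambda>k. sc (Suc (u k)) (q (u k)) j) \<longlonglongrightarrow> x j" by auto
  have inv: "(\<lambda>k. 1 / real (Suc (u k))) \<longlonglongrightarrow> 0"
    using LIMSEQ_subseq_LIMSEQ[OF LIMSEQ_inverse_real_of_nat u] by (simp add: o_def inverse_eq_divide)
  \<comment> \<open>All vertices of the cube at \<open>q\<close> differ from it by at most one grid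
    width, so every choice of vertices has the same limit \<open>x\<close>.\<close>
  have lim': "(\<lambda>k. sc (Suc (u k)) (y (u k)) j) \<longlonglongrightarrow> x j"
    if y: "\<And>k. q k j \<le> y k j \<and> y k j \<le> q k j + 1" and "j < n" for y j
  proof (rule real_tendsto_sandwich[OF _ _ lim[OF \<open>j < n\<close>]])
    show "\<forall>\<^sub>F k in sequentially. sc (Suc (u k)) (q (u k)) j \<le> sc (Suc (u k)) (y (u k)) j"
      using y by (auto simp: sc_def divide_right_mono)
    show "\<forall>\<^sub>F k in sequentially. sc (Suc (u k)) (y (u k)) j \<le> sc (Suc (u k)) (q (u k)) j + 1 / real (Suc (u k))"
    proof (rule always_eventually, rule allI)
      fix k
      have "real (y (u k) j) \<le> real (q (u k) j) + 1" using y[of "u k"] by linarith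
      then show "sc (Suc (u k)) (y (u k)) j \<le> sc (Suc (u k)) (q (u k)) j + 1 / real (Suc (u k))"
        unfolding sc_def add_divide_distrib[symmetric] by (rule divide_right_mono) simp
    qed
    show "(\<lambda>k. sc (Suc (u k)) (q (u k)) j + 1 / real (Suc (u k))) \<longlonglongrightarrow> x j"
      using tendsto_add[OF lim[OF \<open>j < n\<close>] inv] by simp
  qed
  have x01: "\<forall>j<n. 0 \<le> x j \<and> x j \<le> 1"
  proof (intro allI impI conjI)
    fix j assume "j < n"
    show "0 \<le> x j" by (rule LIMSEQ_le_const[OF lim[OF \<open>j < n\<close>]]) (auto simp: sc_def)
    show "x j \<le> 1" by (rule LIMSEQ_le_const2[OF lim[OF \<open>j < n\<close>]])
       (use q01[OF \<open>j < n\<close>] in auto)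
  qed
  have conv: "(\<lambda>k. F (sc (Suc (u k)) (y (u k))) i) \<longlonglongrightarrow> F x i"
    if "i < n" and y: "\<And>k j. j < n \<Longrightarrow> q k j \<le> y k j \<and> y k j \<le> q k j + 1" for i y
  proof (rule cont[OF \<open>i < n\<close> _ x01])
    show "\<forall>k. \<forall>j<n. 0 \<le> sc (Suc (u k)) (y (u k)) j \<and> sc (Suc (u k)) (y (u k)) j \<le> 1"
    proof (intro allI impI)
      fix k j assume "j < n"
      have "y (u k) j \<le> Suc (u k)" using y[OF \<open>j < n\<close>, of "u k"] q[OF \<open>j < n\<close>, of "u k"] by linarith
      then have "real (y (u k) j) \<le> real (Suc (u k))" by (rule of_nat_mono)
      then show "0 \<le> sc (Suc (u k)) (y (u k)) j \<and> sc (Suc (u k)) (y (u k)) j \<le> 1"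
        by (simp add: sc_def del: of_nat_Suc)
    qed
    show "\<forall>j<n. (\<lambda>k. sc (Suc (u k)) (y (u k)) j) \<longlonglongrightarrow> x j" using lim' y by blast
  qed
  have "F x i = 0" if "i < n" for i
  proof (rule antisym)
    show "F x i \<le> 0" by (rule LIMSEQ_le_const2[OF conv[OF that, of "\<lambda>k. r k i"]]) (use r Fr that in auto)
    show "0 \<le> F x i" by (rule LIMSEQ_le_const[OF conv[OF that, of "\<lambda>k. s k i"]]) (use s Fs that in auto)
  qed
  then show thesis using that x01 by blast
qed

text \<open>The box is the image of the unit cube under the coordinatewise affine map
  \<open>T\<close>. Nothing is inverted, so an interval may degenerate to a point, as it does for
  the densities when m = M.\<close>

theorem poincare_miranda:
  fixes F :: "('j \<Rightarrow> real) \<Rightarrow> 'j \<Rightarrow> real"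
  assumes fin: "finite J" and le: "\<And>j. j \<in> J \<Longrightarrow> lo j \<le> hi j"
    and cont: "\<And>X x i. i \<in> J \<Longrightarrow> \<forall>j\<in>J. (\<lambda>k. X k j) \<longlonglongrightarrow> x j \<Longrightarrow> (\<lambda>k. F (X k) i) \<longlonglongrightarrow> F x i"
    and low: "\<And>x i. i \<in> J \<Longrightarrow> \<forall>j\<in>J. lo j \<le> x j \<and> x j \<le> hi j \<Longrightarrow> x i = lo i \<Longrightarrow> F x i \<le> 0"
    and high: "\<And>x i. i \<in> J \<Longrightarrow> \<forall>j\<in>J. lo j \<le> x j \<and> x j \<le> hi j \<Longrightarrow> x i = hi i \<Longrightarrow> F x i \<ge> 0"
  obtains x where "\<forall>j\<in>J. lo j \<le> x j \<and> x j \<le> hi j" "\<forall>i\<in>J. F x i = 0"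
proof -
  obtain e where e: "bij_betw e {..<card J} J"
    using ex_bij_betw_nat_finite[OF fin] by (auto simp: lessThan_atLeast0)
  define e' where "e' = inv_into {..<card J} e"
  have e': "e' j < card J" "e (e' j) = j" if "j \<in> J" for j
    using that e bij_betw_inv_into_right[OF e that] inv_into_into[of j e "{..<card J}"]
    by (auto simp: e'_def bij_betw_def)
  have ee: "e i \<in> J" "e' (e i) = i" if "i < card J" for i
    using that e by (auto simp: e'_def bij_betw_def)
  define T where "T = (\<lambda>y j. lo j + y (e' j) * (hi j - lo j))"
  have box: "lo j \<le> T y j \<and> T y j \<le> hi j"
    if "\<forall>i<card J. 0 \<le> y i \<and> y i \<le> (1::real)" "j \<in> J" for y j
    using that e'[OF that(2)] le[OF that(2)] mult_right_mono[of "y (e' j)" 1 "hi j - lo j"]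
    by (auto simp: T_def)
  obtain y where y: "\<forall>i<card J. 0 \<le> y i \<and> y i \<le> 1" "\<forall>i<card J. F (T y) (e i) = 0"
  proof (rule poincare_miranda_unit_cube[of "card J" "\<lambda>y i. F (T y) (e i)"])
    fix X :: "nat \<Rightarrow> nat \<Rightarrow> real" and x i assume i: "i < card J" and lim: "\<forall>j<card J. (\<lambda>k. X k j) \<longlonglongrightarrow> x j"
    show "(\<lambda>k. F (T (X k)) (e i)) \<longlonglongrightarrow> F (T x) (e i)"
      by (rule cont[OF ee(1)[OF i]]) (use lim e' in \<open>auto simp: T_def intro!: tendsto_intros\<close>)
  next
    fix x i assume i: "i < card J" and x: "\<forall>j<card J. 0 \<le> x j \<and> x j \<le> (1::real)"
    show "F (T x) (e i) \<le> 0" if "x i = 0"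
      by (rule low[OF ee(1)[OF i]]) (use box x i that ee in \<open>auto simp: T_def\<close>)
    show "0 \<le> F (T x) (e i)" if "x i = 1"
      by (rule high[OF ee(1)[OF i]]) (use box x i that ee in \<open>auto simp: T_def\<close>)
  qed
  show thesis using that[of "T y"] box y e' by metis
qed


subsection \<open>Finite networks\<close>

lemma bernoulli_fun_pos: "bernoulli_fun x > 0"
proof (cases "x = 0")
  case False
  then show ?thesis by (cases "x > 0") (auto simp: bernoulli_fun_def zero_less_divide_iff)
qed (simp add: bernoulli_fun_def)

lemma bernoulli_fun_minus: "bernoulli_fun (- x) = bernoulli_fun x + x"
proof (cases "x = 0")
  case False
  then have "exp x - 1 \<noteq> 0" "exp (- x) - 1 \<noteq> 0" by auto
  moreover have "exp (- x) = 1 / exp x" by (simp add: exp_minus inverse_eq_divide)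
  ultimately have "- x / (exp (- x) - 1) = x / (exp x - 1) + x" by (simp add: field_simps)
  with False show ?thesis by (simp add: bernoulli_fun_def)
qed (simp add: bernoulli_fun_def)

lemma isCont_bernoulli_fun: "isCont bernoulli_fun x"
proof (cases "x = 0")
  case True
  \<comment> \<open>The reciprocal of the Bernoulli function is the difference quotient of
    \<open>exp\<close> at 0.\<close>
  have "((\<lambda>h. (exp (0 + h) - exp 0) / h) \<longlongrightarrow> (1::real)) (at 0)"
    using DERIV_exp[of "0::real"] unfolding DERIV_def by simp
  then have "((\<lambda>h. inverse ((exp h - 1) / h)) \<longlongrightarrow> inverse (1::real)) (at 0)"
    by (intro tendsto_inverse) auto
  then have "(bernoulli_fun \<longlongrightarrow> 1) (at 0)"
    
    using Lim_transform_eventually[of _ "inverse 1" "at 0" bernoulli_fun]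
    by (simp add: bernoulli_fun_def eventually_at_filter)
  then show ?thesis using True by (simp add: isCont_def bernoulli_fun_def)
next
  case False
  have "isCont (\<lambda>x. x / (exp x - 1)) x" using False by (intro continuous_intros) auto
  moreover have "\<forall>\<^sub>F y in nhds x. y / (exp y - 1) = bernoulli_fun y"
    using t1_space_nhds[OF False] by eventually_elim (simp add: bernoulli_fun_def)
  ultimately show ?thesis by (simp add: isCont_cong)
qed

lemmas tendsto_bernoulli_fun [tendsto_intros] = isCont_tendsto_compose[OF isCont_bernoulli_fun]

section \<open>Fluxes on an abstract network\<close>

text \<open>This is all that the algebra of the scheme sees of a mesh: a finite graph with weights,
  where \<open>nb_nb\<close> and \<open>tau_sym\<close> make the two fluxes through an interior edge
  opposite. Edges outside \<open>I\<close> and \<open>D\<close> are Neumann edges, and an edge in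
  both sets counts as interior. Weights are only nonnegative here; positivity is asked for along
  paths, in \<open>reach\<close>.\<close>

locale network =
  fixes C :: "'k set" and E :: "'k \<Rightarrow> 'e set" and I D :: "'e set" and nb :: "'k \<Rightarrow> 'e \<Rightarrow> 'k"
    and \<tau> :: "'k \<Rightarrow> 'e \<Rightarrow> real" and vol :: "'k \<Rightarrow> real"
  assumes finite_C: "finite C"
    and finite_E: "K \<in> C \<Longrightarrow> finite (E K)"
    and tau_nonneg: "K \<in> C \<Longrightarrow> \<sigma> \<in> E K \<Longrightarrow> 0 \<le> \<tau> K \<sigma>"
    and vol_pos: "K \<in> C \<Longrightarrow> 0 < vol K"
    and nb_in: "K \<in> C \<Longrightarrow> \<sigma> \<in> E K \<Longrightarrow> \<sigma> \<in> I \<Longrightarrow> nb K \<sigma> \<in> C"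
    and nb_edge: "K \<in> C \<Longrightarrow> \<sigma> \<in> E K \<Longrightarrow> \<sigma> \<in> I \<Longrightarrow> \<sigma> \<in> E (nb K \<sigma>)"
    and nb_nb: "K \<in> C \<Longrightarrow> \<sigma> \<in> E K \<Longrightarrow> \<sigma> \<in> I \<Longrightarrow> nb (nb K \<sigma>) \<sigma> = K"
    and tau_sym: "K \<in> C \<Longrightarrow> \<sigma> \<in> E K \<Longrightarrow> \<sigma> \<in> I \<Longrightarrow> \<tau> (nb K \<sigma>) \<sigma> = \<tau> K \<sigma>"
begin

definition ev :: "('e \<Rightarrow> real) \<Rightarrow> ('k \<Rightarrow> real) \<Rightarrow> 'k \<Rightarrow> 'e \<Rightarrow> real" where
  "ev uD u K \<sigma> = (if \<sigma> \<in> I then u (nb K \<sigma>) else if \<sigma> \<in> D then uD \<sigma> else u K)"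

definition dif :: "('e \<Rightarrow> real) \<Rightarrow> ('k \<Rightarrow> real) \<Rightarrow> 'k \<Rightarrow> 'e \<Rightarrow> real" where
  "dif uD u K \<sigma> = ev uD u K \<sigma> - u K"

definition flux :: "('e \<Rightarrow> real) \<Rightarrow> ('k \<Rightarrow> real) \<Rightarrow> real \<Rightarrow> 'k \<Rightarrow> 'e \<Rightarrow> real" where
  "flux uD u d K \<sigma> = \<tau> K \<sigma> * (bernoulli_fun (- d) * u K - bernoulli_fun d * ev uD u K \<sigma>)"

text \<open>The drift part contains only the cell's own value, so its sum over the edges is
  \<open>u K\<close> times the discrete Laplacian of the potential, for which the Poisson equation
  can be substituted. What remains is diffusion with positive coefficients.\<close>

lemma flux_eq: "flux uD u d K \<sigma> = \<tau> K \<sigma> * d * u K - \<tau> K \<sigma> * bernoulli_fun d * dif uD u K \<sigma>"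
  by (simp add: flux_def dif_def bernoulli_fun_minus algebra_simps)

lemma ev_le:
  assumes "K \<in> C" "\<sigma> \<in> E K" "\<And>L. L \<in> C \<Longrightarrow> u L \<le> c" "\<And>\<sigma>. \<sigma> \<in> E K \<Longrightarrow> \<sigma> \<notin> I \<Longrightarrow> \<sigma> \<in> D \<Longrightarrow> uD \<sigma> \<le> c"
  shows "ev uD u K \<sigma> \<le> c"
  using assms nb_in[OF assms(1,2)] by (auto simp: ev_def)

lemma ev_ge:
  assumes "K \<in> C" "\<sigma> \<in> E K" "\<And>L. L \<in> C \<Longrightarrow> c \<le> u L" "\<And>\<sigma>. \<sigma> \<in> E K \<Longrightarrow> \<sigma> \<notin> I \<Longrightarrow> \<sigma> \<in> D \<Longrightarrow> c \<le> uD \<sigma>"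
  shows "c \<le> ev uD u K \<sigma>"
  using assms nb_in[OF assms(1,2)] by (auto simp: ev_def)

lemma tendsto_ev:
  assumes "K \<in> C" "\<sigma> \<in> E K" "\<And>L. L \<in> C \<Longrightarrow> (\<lambda>k. U k L) \<longlonglongrightarrow> u L"
  shows "(\<lambda>k. ev uD (U k) K \<sigma>) \<longlonglongrightarrow> ev uD u K \<sigma>"
  using assms nb_in[OF assms(1,2)] by (auto simp: ev_def)

lemma tendsto_dif:
  assumes "K \<in> C" "\<sigma> \<in> E K" "\<And>L. L \<in> C \<Longrightarrow> (\<lambda>k. U k L) \<longlonglongrightarrow> u L"
  shows "(\<lambda>k. dif uD (U k) K \<sigma>) \<longlonglongrightarrow> dif uD u K \<sigma>"
  unfolding dif_def by (intro tendsto_diff tendsto_ev assms)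

lemma dif_antisym:
  assumes "K \<in> C" "\<sigma> \<in> E K" "\<sigma> \<in> I"
  shows "dif uD u (nb K \<sigma>) \<sigma> = - dif uD u K \<sigma>"
  using assms by (simp add: dif_def ev_def nb_nb)

lemma dif_neumann: "\<sigma> \<notin> I \<Longrightarrow> \<sigma> \<notin> D \<Longrightarrow> dif uD u K \<sigma> = 0"
  by (simp add: dif_def ev_def)

text \<open>Summed over the cells where \<open>u < 0\<close>, the fluxes between two such cells cancel and the others
  point inwards.\<close>

lemma implicit_step_nonneg:
  assumes eq: "\<And>K. K \<in> C \<Longrightarrow> vol K * (u K - u0 K) / dt + (\<Sum>\<sigma>\<in>E K. flux uD u (d K \<sigma>) K \<sigma>) = 0"
    and dt: "dt > 0" and u0: "\<And>K. K \<in> C \<Longrightarrow> 0 \<le> u0 K"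
    and uD: "\<And>K \<sigma>. K \<in> C \<Longrightarrow> \<sigma> \<in> E K \<Longrightarrow> \<sigma> \<notin> I \<Longrightarrow> \<sigma> \<in> D \<Longrightarrow> 0 \<le> uD \<sigma>"
    and antisym: "\<And>K \<sigma>. K \<in> C \<Longrightarrow> \<sigma> \<in> E K \<Longrightarrow> \<sigma> \<in> I \<Longrightarrow> d (nb K \<sigma>) \<sigma> = - d K \<sigma>"
    and neumann: "\<And>K \<sigma>. \<sigma> \<notin> I \<Longrightarrow> \<sigma> \<notin> D \<Longrightarrow> d K \<sigma> = 0"
    and K: "K \<in> C"
  shows "0 \<le> u K"
proof (rule ccontr)
  assume "\<not> 0 \<le> u K"
  define S where "S = {K \<in> C. u K < 0}"
  have S: "finite S" "S \<subseteq> C" "K \<in> S" using \<open>\<not> 0 \<le> u K\<close> K finite_C by (auto simp: S_def)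
  define f where "f = (\<lambda>(K, \<sigma>). flux uD u (d K \<sigma>) K \<sigma>)"
  define A where "A = {(K, \<sigma>). K \<in> S \<and> \<sigma> \<in> E K \<and> \<sigma> \<in> I \<and> nb K \<sigma> \<in> S}"
  have finS: "finite (Sigma S E)" using S finite_E by blast
  have AS: "A \<subseteq> Sigma S E" by (auto simp: A_def)
  \<comment> \<open>Crossing the edge, \<open>(K, \<sigma>)\<close> to
    \<open>(nb K \<sigma>, \<sigma>)\<close>, is an involution of \<open>A\<close> that reverses the
    sign of the flux, because \<open>d\<close> is antisymmetric across interior edges.\<close>
  have "sum f A = (\<Sum>p\<in>A. - f p)"
    by (rule sum.reindex_bij_witness[where i = "\<lambda>(K, \<sigma>). (nb K \<sigma>, \<sigma>)" and j = "\<lambda>(K, \<sigma>). (nb K \<sigma>, \<sigma>)"])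
      (use S in \<open>auto simp: A_def f_def nb_nb nb_edge flux_def antisym tau_sym ev_def subset_iff algebra_simps\<close>)
  then have sumA: "sum f A = 0" by (simp add: sum_negf)
  have "f (L, \<sigma>) \<le> 0" if "(L, \<sigma>) \<in> Sigma S E - A" for L \<sigma>
  proof -
    have L: "L \<in> C" "\<sigma> \<in> E L" "u L < 0" "\<not> (\<sigma> \<in> I \<and> nb L \<sigma> \<in> S)"
      using that by (auto simp: A_def S_def)
    \<comment> \<open>On a Neumann edge the edge value is \<open>u L\<close> itself and thus
      negative, so the sign argument fails there; but \<open>d\<close> and \<open>dif\<close> both
      vanish and so does the flux.\<close>
    have "0 \<le> ev uD u L \<sigma> \<or> \<sigma> \<notin> I \<and> \<sigma> \<notin> D"
      using L uD nb_in[of L \<sigma>] by (auto simp: ev_def S_def not_less)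
    then show ?thesis
    proof
      assume "0 \<le> ev uD u L \<sigma>"
      then have "bernoulli_fun (- d L \<sigma>) * u L - bernoulli_fun (d L \<sigma>) * ev uD u L \<sigma> \<le> 0"
        using bernoulli_fun_pos[of "d L \<sigma>"] bernoulli_fun_pos[of "- d L \<sigma>"] L
        by (smt (verit) mult_nonneg_nonneg mult_pos_neg)
      then show ?thesis using tau_nonneg[OF L(1,2)] by (auto simp: f_def flux_def mult_le_0_iff)
    qed (auto simp: f_def flux_eq neumann dif_neumann)
  qed
  then have "sum f (Sigma S E - A) \<le> 0" by (intro sum_nonpos) auto
  then have "sum f (Sigma S E) \<le> 0" using sum.subset_diff[OF AS finS, of f] sumA by simp
  then have fl: "(\<Sum>K\<in>S. \<Sum>\<sigma>\<in>E K. flux uD u (d K \<sigma>) K \<sigma>) \<le> 0"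
    using S finite_E by (subst sum.Sigma) (auto simp: f_def)
  have "(\<Sum>K\<in>S. vol K * (u K - u0 K) / dt) < 0"
  proof -
    have "vol K * (u K - u0 K) / dt < 0" if "K \<in> S" for K
      using that u0[of K] vol_pos[of K] dt by (auto simp: S_def divide_less_0_iff mult_less_0_iff)
    then have "(\<Sum>K\<in>S. vol K * (u K - u0 K) / dt) < (\<Sum>K\<in>S. 0)" using S by (intro sum_strict_mono) auto
    then show ?thesis by simp
  qed
  moreover have "(\<Sum>K\<in>S. vol K * (u K - u0 K) / dt + (\<Sum>\<sigma>\<in>E K. flux uD u (d K \<sigma>) K \<sigma>)) = 0"
    by (rule sum.neutral) (use eq subsetD[OF S(2)] in blast)
  ultimately show False using fl unfolding sum.distrib by linarith
qed

section \<open>Discrete maximum principles\<close>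

text \<open>At a joint maximum neither diffusion nor reaction can increase \<open>u K\<close>, so
  \<open>u K\<close> is at most its previous value. Assuming \<open>u K > M\<close> for
  contradiction places the Dirichlet values below \<open>u K\<close> as well; \<open>nonneg\<close>
  fixes the sign of the reaction factor.\<close>

lemma reaction_diffusion_max:
  assumes equ: "vol K * (u K - u0 K) / dt = (\<Sum>\<sigma>\<in>E K. a \<sigma> * dif uD u K \<sigma>) + \<kappa> * u K * vol K * (v K - u K)"
    and a: "\<And>\<sigma>. \<sigma> \<in> E K \<Longrightarrow> 0 \<le> a \<sigma>" and dt: "dt > 0" and \<kappa>: "\<kappa> \<ge> 0" and K: "K \<in> C"
    and u0: "u0 K \<le> M" and uD: "\<And>\<sigma>. \<sigma> \<in> E K \<Longrightarrow> \<sigma> \<notin> I \<Longrightarrow> \<sigma> \<in> D \<Longrightarrow> uD \<sigma> \<le> M"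
    and max: "\<And>L. L \<in> C \<Longrightarrow> u L \<le> u K" "v K \<le> u K" and nonneg: "0 \<le> u K"
  shows "u K \<le> M"
proof (rule ccontr)
  assume "\<not> u K \<le> M"
  have "a \<sigma> * dif uD u K \<sigma> \<le> 0" if "\<sigma> \<in> E K" for \<sigma>
  proof -
    have "ev uD u K \<sigma> \<le> u K"
      by (rule ev_le[OF K that max(1)]) (use uD \<open>\<not> u K \<le> M\<close> in force)+
    then show ?thesis using a[OF that] by (simp add: dif_def mult_le_0_iff)
  qed
  then have "(\<Sum>\<sigma>\<in>E K. a \<sigma> * dif uD u K \<sigma>) \<le> 0" by (rule sum_nonpos)
  moreover have "\<kappa> * u K * vol K * (v K - u K) \<le> 0"
    using \<kappa> nonneg vol_pos[OF K] max(2) by (intro mult_nonneg_nonpos) auto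
  ultimately have "vol K * (u K - u0 K) / dt \<le> 0" using equ by linarith
  then have "u K \<le> u0 K" using dt vol_pos[OF K] by (auto simp: divide_le_0_iff mult_le_0_iff)
  then show False using u0 \<open>\<not> u K \<le> M\<close> by simp
qed

lemma reaction_diffusion_min:
  assumes equ: "vol K * (u K - u0 K) / dt = (\<Sum>\<sigma>\<in>E K. a \<sigma> * dif uD u K \<sigma>) + \<kappa> * u K * vol K * (v K - u K)"
    and a: "\<And>\<sigma>. \<sigma> \<in> E K \<Longrightarrow> 0 \<le> a \<sigma>" and dt: "dt > 0" and \<kappa>: "\<kappa> \<ge> 0" and K: "K \<in> C"
    and u0: "m \<le> u0 K" and uD: "\<And>\<sigma>. \<sigma> \<in> E K \<Longrightarrow> \<sigma> \<notin> I \<Longrightarrow> \<sigma> \<in> D \<Longrightarrow> m \<le> uD \<sigma>"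
    and min: "\<And>L. L \<in> C \<Longrightarrow> u K \<le> u L" "u K \<le> v K" and nonneg: "0 \<le> u K"
  shows "m \<le> u K"
proof (rule ccontr)
  assume "\<not> m \<le> u K"
  have "a \<sigma> * dif uD u K \<sigma> \<ge> 0" if "\<sigma> \<in> E K" for \<sigma>
  proof -
    have "u K \<le> ev uD u K \<sigma>"
      by (rule ev_ge[OF K that min(1)]) (use uD \<open>\<not> m \<le> u K\<close> in force)+
    then show ?thesis using a[OF that] by (simp add: dif_def)
  qed
  then have "(\<Sum>\<sigma>\<in>E K. a \<sigma> * dif uD u K \<sigma>) \<ge> 0" by (rule sum_nonneg)
  moreover have "\<kappa> * u K * vol K * (v K - u K) \<ge> 0"
    using \<kappa> nonneg vol_pos[OF K] min(2) by (intro mult_nonneg_nonneg) auto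
  ultimately have "vol K * (u K - u0 K) / dt \<ge> 0" using equ by linarith
  then have "u0 K \<le> u K" using dt vol_pos[OF K] by (auto simp: zero_le_divide_iff zero_le_mult_iff)
  then show False using u0 \<open>\<not> m \<le> u K\<close> by simp
qed

text \<open>The reaction term of \<open>u\<close> has the sign of \<open>v - u\<close>, which a
  maximum of \<open>u\<close> alone does not control. Hence the extremum is taken over both
  functions and all cells, and the argument is applied to the function that attains it. With
  \<kappa> = 0 pure diffusion is covered too.\<close>

lemma reaction_diffusion_bounds:
  assumes equ: "\<And>K. K \<in> C \<Longrightarrow> vol K * (u K - u0 K) / dt =
        (\<Sum>\<sigma>\<in>E K. a K \<sigma> * dif uD u K \<sigma>) + \<kappa> * u K * vol K * (v K - u K)"
    and eqv: "\<And>K. K \<in> C \<Longrightarrow> vol K * (v K - v0 K) / dt =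
        (\<Sum>\<sigma>\<in>E K. b K \<sigma> * dif vD v K \<sigma>) + \<kappa> * v K * vol K * (u K - v K)"
    and a: "\<And>K \<sigma>. K \<in> C \<Longrightarrow> \<sigma> \<in> E K \<Longrightarrow> 0 \<le> a K \<sigma>"
    and b: "\<And>K \<sigma>. K \<in> C \<Longrightarrow> \<sigma> \<in> E K \<Longrightarrow> 0 \<le> b K \<sigma>" and dt: "dt > 0" and \<kappa>: "\<kappa> \<ge> 0"
    and u0: "\<And>K. K \<in> C \<Longrightarrow> m \<le> u0 K \<and> u0 K \<le> M"
    and v0: "\<And>K. K \<in> C \<Longrightarrow> m \<le> v0 K \<and> v0 K \<le> M"
    and uD: "\<And>K \<sigma>. K \<in> C \<Longrightarrow> \<sigma> \<in> E K \<Longrightarrow> \<sigma> \<notin> I \<Longrightarrow> \<sigma> \<in> D \<Longrightarrow> m \<le> uD \<sigma> \<and> uD \<sigma> \<le> M"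
    and vD: "\<And>K \<sigma>. K \<in> C \<Longrightarrow> \<sigma> \<in> E K \<Longrightarrow> \<sigma> \<notin> I \<Longrightarrow> \<sigma> \<in> D \<Longrightarrow> m \<le> vD \<sigma> \<and> vD \<sigma> \<le> M"
    and nonneg: "\<And>K. K \<in> C \<Longrightarrow> 0 \<le> u K" "\<And>K. K \<in> C \<Longrightarrow> 0 \<le> v K"
    and K: "K \<in> C"
  shows "m \<le> u K \<and> u K \<le> M \<and> m \<le> v K \<and> v K \<le> M"
proof -
  have "C \<noteq> {}" using K by auto
  define h where "h = (\<lambda>K. max (u K) (v K))"
  define l where "l = (\<lambda>K. min (u K) (v K))"
  obtain X where X: "X \<in> C" "\<And>L. L \<in> C \<Longrightarrow> h L \<le> h X"
    using ex_is_arg_min_if_finite[OF finite_C \<open>C \<noteq> {}\<close>, of "\<lambda>L. - h L"] by (auto simp: is_arg_min_linorder)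
  obtain Y where Y: "Y \<in> C" "\<And>L. L \<in> C \<Longrightarrow> l Y \<le> l L"
    using ex_is_arg_min_if_finite[OF finite_C \<open>C \<noteq> {}\<close>, of l] by (auto simp: is_arg_min_linorder)
  have X': "u L \<le> h X" "v L \<le> h X" and Y': "l Y \<le> u L" "l Y \<le> v L" if "L \<in> C" for L
    using X(2)[OF that] Y(2)[OF that] by (auto simp: h_def l_def)
  have "h X \<le> M"
  proof (cases "v X \<le> u X")
    case True
    have "u X \<le> M"
      by (rule reaction_diffusion_max[where K = X and u = u and v = v and uD = uD and ?u0.0 = u0 and \<kappa> = \<kappa> and a = "a X", OF equ[OF X(1)] a[OF X(1)] dt \<kappa> X(1)])
         (use X(1) X'[unfolded h_def] u0 uD nonneg True in auto)
    then show ?thesis using True by (simp add: h_def)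
  next
    case False
    have "v X \<le> M"
      by (rule reaction_diffusion_max[where K = X and u = v and v = u and uD = vD and ?u0.0 = v0 and \<kappa> = \<kappa> and a = "b X", OF eqv[OF X(1)] b[OF X(1)] dt \<kappa> X(1)])
         (use X(1) X'[unfolded h_def] v0 vD nonneg False in auto)
    then show ?thesis using False by (simp add: h_def)
  qed
  moreover have "m \<le> l Y"
  proof (cases "u Y \<le> v Y")
    case True
    have "m \<le> u Y"
      by (rule reaction_diffusion_min[where K = Y and u = u and v = v and uD = uD and ?u0.0 = u0 and \<kappa> = \<kappa> and a = "a Y", OF equ[OF Y(1)] a[OF Y(1)] dt \<kappa> Y(1)])
         (use Y(1) Y'[unfolded l_def] u0 uD nonneg True in auto)
    then show ?thesis using True by (simp add: l_def)
  next
    case False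
    have "m \<le> v Y"
      by (rule reaction_diffusion_min[where K = Y and u = v and v = u and uD = vD and ?u0.0 = v0 and \<kappa> = \<kappa> and a = "b Y", OF eqv[OF Y(1)] b[OF Y(1)] dt \<kappa> Y(1)])
         (use Y(1) Y'[unfolded l_def] v0 vD nonneg False in auto)
    then show ?thesis using False by (simp add: l_def)
  qed
  ultimately show ?thesis using X(2)[OF K] Y(2)[OF K] unfolding h_def l_def by linarith
qed


section \<open>Barriers for the discrete Laplacian\<close>

text \<open>A path of exactly \<open>n\<close> interior edges followed by a Dirichlet edge, all of
  positive weight. The exact length keeps the recursion simple; the graph distance is the least such
  \<open>n\<close>.\<close>

fun reach :: "nat \<Rightarrow> 'k \<Rightarrow> bool" where
  "reach 0 K \<longleftrightarrow> (\<exists>\<sigma>\<in>E K. \<sigma> \<notin> I \<and> \<sigma> \<in> D \<and> \<tau> K \<sigma> > 0)"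
| "reach (Suc n) K \<longleftrightarrow> (\<exists>\<sigma>\<in>E K. \<sigma> \<in> I \<and> \<tau> K \<sigma> > 0 \<and> reach n (nb K \<sigma>))"

text \<open>The supersolution has increments \<open>q\<^sup>k\<close> in the graph distance \<open>k\<close> to the Dirichlet edges; for small
  \<open>q\<close> the drop towards a closer neighbour outweighs all rises.\<close>

lemma strict_supersolution:
  assumes reach: "\<And>K. K \<in> C \<Longrightarrow> \<exists>n. reach n K"
  obtains R \<delta> where "\<delta> > 0" "\<And>K. R K \<ge> 1"
    "\<And>K. K \<in> C \<Longrightarrow> (\<Sum>\<sigma>\<in>E K. \<tau> K \<sigma> * dif (\<lambda>_. 1) R K \<sigma>) \<le> - \<delta>"
proof -
  define P where "P = Sigma C E"
  have finP: "finite P" unfolding P_def using finite_C finite_E by (rule finite_SigmaI)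
  \<comment> \<open>The smallest positive weight; the inserted 1 keeps the set nonempty.\<close>
  define t0 where "t0 = Min (insert 1 ((\<lambda>(K, \<sigma>). \<tau> K \<sigma>) ` {(K, \<sigma>) \<in> P. \<tau> K \<sigma> > 0}))"
  have fin': "finite ((\<lambda>(K, \<sigma>). \<tau> K \<sigma>) ` {(K, \<sigma>) \<in> P. \<tau> K \<sigma> > 0})"
    using finP by (intro finite_imageI finite_subset[OF _ finP]) auto
  have t0: "t0 > 0" unfolding t0_def using fin' by (subst Min_gr_iff) auto
  have t0_le: "t0 \<le> \<tau> K \<sigma>" if "K \<in> C" "\<sigma> \<in> E K" "\<tau> K \<sigma> > 0" for K \<sigma>
    unfolding t0_def using fin' that by (intro Min_le) (auto simp: P_def image_iff)
  define T where "T = (\<Sum>K\<in>C. \<Sum>\<sigma>\<in>E K. \<tau> K \<sigma>)"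
  have T_ge: "(\<Sum>\<sigma>\<in>E K. \<tau> K \<sigma>) \<le> T" if "K \<in> C" for K
    unfolding T_def using that finite_C tau_nonneg
    by (intro member_le_sum[where f = "\<lambda>K. \<Sum>\<sigma>\<in>E K. \<tau> K \<sigma>"]) (auto intro: sum_nonneg)
  have T0: "0 \<le> T" unfolding T_def using tau_nonneg by (intro sum_nonneg) auto
  \<comment> \<open>All rises at a cell of distance k together weigh at most
    \<open>T * q ^ Suc k\<close>. This choice makes it at most half of \<open>t0 * q ^ k\<close>,
    the weight of the guaranteed drop.\<close>
  define q where "q = t0 / (2 * (T + 1))"
  have q: "q > 0" "T * q \<le> t0 / 2" using t0 T0 by (auto simp: q_def field_simps)
  \<comment> \<open>The value at distance 0 is 2, against the Dirichlet value 1 of the comparison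
    function, so the drop at distance k is \<open>q ^ k\<close> for k = 0 as well.\<close>
  define r where "r = (\<lambda>k. 1 + (\<Sum>j\<le>k. q ^ j))"
  have r_Suc: "r (Suc k) = r k + q ^ Suc k" for k by (simp add: r_def)
  have "r k \<le> r (Suc k)" for k unfolding r_Suc using q(1) by simp
  then have r_mono: "r i \<le> r j" if "i \<le> j" for i j
    using that by (rule lift_Suc_mono_le)
  define d where "d = (\<lambda>K. LEAST n. reach n K)"
  define R where "R = (\<lambda>K. r (d K))"
  have reach_d: "reach (d K) K" if "K \<in> C" for K using reach[OF that] unfolding d_def by (metis LeastI)
  have d_le: "d K \<le> n" if "reach n K" for n K using that unfolding d_def by (rule Least_le)
  have R1: "R K \<ge> 1" for K using q by (auto simp: R_def r_def intro!: sum_nonneg)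
  \<comment> \<open>A neighbour is at most one step farther from the Dirichlet edges, since the
    shared edge can be traversed backwards with the same weight. On all other edges the difference
    is not positive.\<close>
  have up: "\<tau> K \<sigma> * dif (\<lambda>_. 1) R K \<sigma> \<le> \<tau> K \<sigma> * q ^ Suc (d K)" if "K \<in> C" "\<sigma> \<in> E K" for K \<sigma>
  proof (cases "\<tau> K \<sigma> > 0")
    case True
    have "dif (\<lambda>_. 1) R K \<sigma> \<le> q ^ Suc (d K)"
    proof (cases "\<sigma> \<in> I")
      case i: True
      have "reach (Suc (d K)) (nb K \<sigma>)"
        using reach_d that i True by (auto simp: nb_nb nb_edge tau_sym intro!: bexI[of _ \<sigma>])
      then have "r (d (nb K \<sigma>)) \<le> r (Suc (d K))" by (intro r_mono d_le)
      then show ?thesis using i by (simp add: dif_def ev_def R_def r_Suc)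
    qed (use R1[of K] q in \<open>auto simp: dif_def ev_def intro: order_trans[of _ 0]\<close>)
    then show ?thesis using True by (intro mult_left_mono) auto
  qed (use tau_nonneg[OF that] in auto)
  have "(\<Sum>\<sigma>\<in>E K. \<tau> K \<sigma> * dif (\<lambda>_. 1) R K \<sigma>) \<le> - (q ^ d K * (t0 / 2))" if "K \<in> C" for K
  proof -
    have "\<exists>s\<in>E K. \<tau> K s > 0 \<and> dif (\<lambda>_. 1) R K s \<le> - (q ^ d K)"
    proof (cases "d K")
      case 0
      then obtain s where "s \<in> E K" "s \<notin> I" "s \<in> D" "\<tau> K s > 0" using reach_d[OF \<open>K \<in> C\<close>] by auto
      then show ?thesis using 0 by (intro bexI[of _ s]) (auto simp: dif_def ev_def R_def r_def)
    next
      case (Suc n)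
      then obtain s where s: "s \<in> E K" "s \<in> I" "reach n (nb K s)" "\<tau> K s > 0" using reach_d[OF \<open>K \<in> C\<close>] by auto
      have "r (d (nb K s)) \<le> r n" using s by (intro r_mono d_le)
      then show ?thesis using s Suc by (intro bexI[of _ s]) (auto simp: dif_def ev_def R_def r_Suc)
    qed
    then obtain s where s: "s \<in> E K" "\<tau> K s > 0" "dif (\<lambda>_. 1) R K s \<le> - (q ^ d K)" by blast
    have "\<tau> K s * dif (\<lambda>_. 1) R K s \<le> \<tau> K s * (- (q ^ d K))" using s by (intro mult_left_mono) auto
    also have "\<dots> \<le> - (t0 * q ^ d K)" using t0_le[OF that s(1,2)] q by (simp add: mult_right_mono)
    finally have 1: "\<tau> K s * dif (\<lambda>_. 1) R K s \<le> - (t0 * q ^ d K)" .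
    have "(\<Sum>\<sigma>\<in>E K - {s}. \<tau> K \<sigma> * dif (\<lambda>_. 1) R K \<sigma>) \<le> (\<Sum>\<sigma>\<in>E K - {s}. \<tau> K \<sigma> * q ^ Suc (d K))"
      using up that by (intro sum_mono) auto
    also have "\<dots> \<le> (\<Sum>\<sigma>\<in>E K. \<tau> K \<sigma> * q ^ Suc (d K))"
      using finite_E[OF that] tau_nonneg[OF that] q by (intro sum_mono2) auto
    also have "\<dots> = (\<Sum>\<sigma>\<in>E K. \<tau> K \<sigma>) * q ^ Suc (d K)" by (simp add: sum_distrib_right)
    also have "\<dots> \<le> T * q ^ Suc (d K)" using T_ge[OF that] q by (intro mult_right_mono) auto
    also have "\<dots> = (T * q) * q ^ d K" by simp
    also have "\<dots> \<le> t0 / 2 * q ^ d K" using q by (intro mult_right_mono) auto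
    finally show ?thesis using 1 sum.remove[OF finite_E[OF that] s(1), of "\<lambda>\<sigma>. \<tau> K \<sigma> * dif (\<lambda>_. 1) R K \<sigma>"]
      by (simp add: algebra_simps)
  qed
  note bound = this
  define \<delta> where "\<delta> = Min (insert 1 ((\<lambda>K. q ^ d K * (t0 / 2)) ` C))"
  have "\<delta> > 0" unfolding \<delta>_def using finite_C q t0 by (subst Min_gr_iff) auto
  moreover have "(\<Sum>\<sigma>\<in>E K. \<tau> K \<sigma> * dif (\<lambda>_. 1) R K \<sigma>) \<le> - \<delta>" if "K \<in> C" for K
  proof -
    have "\<delta> \<le> q ^ d K * (t0 / 2)" unfolding \<delta>_def using finite_C that by (intro Min_le) auto
    then show ?thesis using bound[OF that] by linarith
  qed
  ultimately show thesis using that R1 by blast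
qed

text \<open>Comparison with the barrier \<open>A * R\<close>: where \<psi> touches it from below,
  every difference of \<psi> is at most the corresponding difference of the barrier, whose weighted
  sum is at most -c. Here \<open>c\<close> will be a bound for the source, uniform on the box, so
  that the face signs survive adding it.\<close>

lemma potential_box:
  assumes reach: "\<And>K. K \<in> C \<Longrightarrow> \<exists>n. reach n K"
  obtains R where "\<And>K. R K \<ge> (0::real)"
    "\<And>\<psi> K. K \<in> C \<Longrightarrow> \<forall>L\<in>C. \<bar>\<psi> L\<bar> \<le> R L \<Longrightarrow> \<psi> K = R K \<Longrightarrow> (\<Sum>\<sigma>\<in>E K. \<tau> K \<sigma> * dif \<psi>D \<psi> K \<sigma>) \<le> - c"
    "\<And>\<psi> K. K \<in> C \<Longrightarrow> \<forall>L\<in>C. \<bar>\<psi> L\<bar> \<le> R L \<Longrightarrow> \<psi> K = - R K \<Longrightarrow> (\<Sum>\<sigma>\<in>E K. \<tau> K \<sigma> * dif \<psi>D \<psi> K \<sigma>) \<ge> c"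
proof -
  obtain R \<delta> where R: "\<delta> > 0" "\<And>K. R K \<ge> 1"
    "\<And>K. K \<in> C \<Longrightarrow> (\<Sum>\<sigma>\<in>E K. \<tau> K \<sigma> * dif (\<lambda>_. 1) R K \<sigma>) \<le> - \<delta>"
    by (rule strict_supersolution[OF reach]) (assumption | rule that)+
  define F where "F = (\<Union>K\<in>C. E K)"
  have "finite F" using finite_C finite_E by (auto simp: F_def)
  \<comment> \<open>The first summand turns the strictness \<delta> of the supersolution into
    \<open>c\<close>; the second lifts the Dirichlet value 1 of the supersolution above all boundary
    data.\<close>
  define A where "A = \<bar>c\<bar> / \<delta> + (\<Sum>\<sigma>\<in>F. \<bar>\<psi>D \<sigma>\<bar>)"
  have A0: "A \<ge> 0" unfolding A_def using R(1) by (auto intro!: add_nonneg_nonneg sum_nonneg)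
  have A1: "\<bar>\<psi>D \<sigma>\<bar> \<le> A" if "K \<in> C" "\<sigma> \<in> E K" for K \<sigma>
  proof -
    have "\<bar>\<psi>D \<sigma>\<bar> \<le> (\<Sum>\<sigma>\<in>F. \<bar>\<psi>D \<sigma>\<bar>)"
      using that \<open>finite F\<close> by (intro member_le_sum[where f = "\<lambda>\<sigma>. \<bar>\<psi>D \<sigma>\<bar>"]) (auto simp: F_def)
    also have "\<dots> \<le> A" using R(1) by (simp add: A_def)
    finally show ?thesis .
  qed
  have A2: "A * \<delta> \<ge> c"
  proof -
    have "\<bar>c\<bar> / \<delta> \<le> A" unfolding A_def by (simp add: sum_nonneg)
    then show ?thesis using R(1) by (simp add: pos_divide_le_eq)
  qed
  have scaled: "A * (\<Sum>\<sigma>\<in>E K. \<tau> K \<sigma> * dif (\<lambda>_. 1) R K \<sigma>) \<le> - c" if "K \<in> C" for K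
    using mult_left_mono[OF R(3)[OF that] A0] A2 by simp
  have le: "\<tau> K \<sigma> * dif \<psi>D \<psi> K \<sigma> \<le> A * (\<tau> K \<sigma> * dif (\<lambda>_. 1) R K \<sigma>)"
    if "K \<in> C" "\<forall>L\<in>C. \<psi> L \<le> A * R L" "\<psi> K = A * R K" "\<And>\<sigma>. \<sigma> \<in> E K \<Longrightarrow> \<psi>D \<sigma> \<le> A" "\<sigma> \<in> E K" for K \<sigma> \<psi> \<psi>D
  proof -
    have "dif \<psi>D \<psi> K \<sigma> \<le> A * dif (\<lambda>_. 1) R K \<sigma>"
      using that nb_in[of K \<sigma>] by (auto simp: dif_def ev_def algebra_simps)
    from mult_left_mono[OF this tau_nonneg[OF that(1,5)]] show ?thesis by (simp add: mult.left_commute)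
  qed
  \<comment> \<open>Reflection of \<psi> and its boundary data reduces the lower faces to the upper
    ones.\<close>
  have neg: "dif \<psi>D \<psi> K \<sigma> = - dif (\<lambda>\<sigma>. - \<psi>D \<sigma>) (\<lambda>K. - \<psi> K) K \<sigma>" for \<psi>D \<psi> K \<sigma>
    by (simp add: dif_def ev_def)
  show thesis
  proof (rule that[of "\<lambda>K. A * R K"])
    show "A * R K \<ge> 0" for K using A0 R(2)[of K] by simp
    fix \<psi> K assume K: "K \<in> C" and b: "\<forall>L\<in>C. \<bar>\<psi> L\<bar> \<le> A * R L"
    show "(\<Sum>\<sigma>\<in>E K. \<tau> K \<sigma> * dif \<psi>D \<psi> K \<sigma>) \<le> - c" if "\<psi> K = A * R K"
    proof -
      have "(\<Sum>\<sigma>\<in>E K. \<tau> K \<sigma> * dif \<psi>D \<psi> K \<sigma>) \<le> (\<Sum>\<sigma>\<in>E K. A * (\<tau> K \<sigma> * dif (\<lambda>_. 1) R K \<sigma>))"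
        using b A1[OF K] that by (intro sum_mono le[OF K]) (auto simp: abs_le_iff)
      then show ?thesis using scaled[OF K] by (simp add: sum_distrib_left)
    qed
    show "(\<Sum>\<sigma>\<in>E K. \<tau> K \<sigma> * dif \<psi>D \<psi> K \<sigma>) \<ge> c" if "\<psi> K = - (A * R K)"
    proof -
      have "(\<Sum>\<sigma>\<in>E K. \<tau> K \<sigma> * dif (\<lambda>\<sigma>. - \<psi>D \<sigma>) (\<lambda>K. - \<psi> K) K \<sigma>) \<le> (\<Sum>\<sigma>\<in>E K. A * (\<tau> K \<sigma> * dif (\<lambda>_. 1) R K \<sigma>))"
        using b A1[OF K] that by (intro sum_mono le[OF K]) (auto simp: abs_le_iff)
      then show ?thesis using scaled[OF K] by (simp add: sum_distrib_left neg[of \<psi>D] sum_negf)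
    qed
  qed
qed

section \<open>One implicit time step: bounds and solvability\<close>

lemma sum_flux:
  "(\<Sum>\<sigma>\<in>E K. flux uD u (d \<sigma>) K \<sigma>) =
     (\<Sum>\<sigma>\<in>E K. \<tau> K \<sigma> * d \<sigma>) * u K - (\<Sum>\<sigma>\<in>E K. \<tau> K \<sigma> * bernoulli_fun (d \<sigma>) * dif uD u K \<sigma>)"
  by (simp add: flux_eq sum_subtractf sum_distrib_right)

text \<open>Splitting into a part odd in \<open>d\<close> and a part even in \<open>d\<close>. If
  both densities coincide, adding their fluxes for \<open>d\<close> and \<open>- d\<close> leaves
  only diffusion, and subtracting them leaves only the equation for the potential.\<close>

lemma flux_symmetric:
  "flux uD u d K \<sigma> = \<tau> K \<sigma> * d * (u K + ev uD u K \<sigma>) / 2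
     - \<tau> K \<sigma> * ((bernoulli_fun d + bernoulli_fun (- d)) / 2) * dif uD u K \<sigma>"
  unfolding flux_def dif_def bernoulli_fun_minus by (simp add: field_simps)

text \<open>Here \<epsilon> stands for the square of \<lambda>. For \<epsilon> > 0 both equations
  take the reaction form with rate 1/\<epsilon>. For \<epsilon> = 0 the Poisson equation says p = n,
  and the sum of the two equations is a diffusion equation for n, treated as the case \<kappa> = 0
  with \<open>u\<close> and \<open>v\<close> both equal to n.\<close>

lemma drift_diffusion_step_bounds:
  assumes eqn: "\<And>K. K \<in> C \<Longrightarrow> vol K * (n K - n0 K) / dt + (\<Sum>\<sigma>\<in>E K. flux nD n (dif \<psi>D \<psi> K \<sigma>) K \<sigma>) = 0"
    and eqp: "\<And>K. K \<in> C \<Longrightarrow> vol K * (p K - p0 K) / dt + (\<Sum>\<sigma>\<in>E K. flux pD p (- dif \<psi>D \<psi> K \<sigma>) K \<sigma>) = 0"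
    and poisson: "\<And>K. K \<in> C \<Longrightarrow> - \<epsilon> * (\<Sum>\<sigma>\<in>E K. \<tau> K \<sigma> * dif \<psi>D \<psi> K \<sigma>) = vol K * (p K - n K)"
    and dt: "dt > 0" and \<epsilon>: "\<epsilon> \<ge> 0" and m: "m \<ge> 0"
    and n0: "\<And>K. K \<in> C \<Longrightarrow> m \<le> n0 K \<and> n0 K \<le> M"
    and p0: "\<And>K. K \<in> C \<Longrightarrow> m \<le> p0 K \<and> p0 K \<le> M"
    and nD: "\<And>K \<sigma>. K \<in> C \<Longrightarrow> \<sigma> \<in> E K \<Longrightarrow> \<sigma> \<notin> I \<Longrightarrow> \<sigma> \<in> D \<Longrightarrow> m \<le> nD \<sigma> \<and> nD \<sigma> \<le> M"
    and pD: "\<And>K \<sigma>. K \<in> C \<Longrightarrow> \<sigma> \<in> E K \<Longrightarrow> \<sigma> \<notin> I \<Longrightarrow> \<sigma> \<in> D \<Longrightarrow> m \<le> pD \<sigma> \<and> pD \<sigma> \<le> M"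
    and quasineutral: "\<And>K. \<epsilon> = 0 \<Longrightarrow> K \<in> C \<Longrightarrow> p0 K = n0 K"
      "\<And>K \<sigma>. \<epsilon> = 0 \<Longrightarrow> K \<in> C \<Longrightarrow> \<sigma> \<in> E K \<Longrightarrow> \<sigma> \<notin> I \<Longrightarrow> \<sigma> \<in> D \<Longrightarrow> pD \<sigma> = nD \<sigma>"
    and K: "K \<in> C"
  shows "m \<le> n K \<and> n K \<le> M \<and> m \<le> p K \<and> p K \<le> M"
proof -
  have nn: "0 \<le> n L" if "L \<in> C" for L
    by (rule implicit_step_nonneg[OF eqn dt])
       (use n0 nD m that in \<open>force simp: dif_antisym dif_neumann\<close>)+
  have pn: "0 \<le> p L" if "L \<in> C" for L
    by (rule implicit_step_nonneg[OF eqp dt])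
       (use p0 pD m that in \<open>force simp: dif_antisym dif_neumann\<close>)+
  have B: "0 \<le> \<tau> L \<sigma> * bernoulli_fun x" if "L \<in> C" "\<sigma> \<in> E L" for L \<sigma> x
    using tau_nonneg[OF that] bernoulli_fun_pos[of x] by simp
  show ?thesis
  proof (cases "\<epsilon> = 0")
    case False
    have S: "(\<Sum>\<sigma>\<in>E L. \<tau> L \<sigma> * dif \<psi>D \<psi> L \<sigma>) = - (1 / \<epsilon>) * vol L * (p L - n L)" if "L \<in> C" for L
      using poisson[OF that] False by (simp add: field_simps)
    show ?thesis
    proof (rule reaction_diffusion_bounds[where \<kappa> = "1 / \<epsilon>" and uD = nD and vD = pD and u = n and v = p
          and a = "\<lambda>L \<sigma>. \<tau> L \<sigma> * bernoulli_fun (dif \<psi>D \<psi> L \<sigma>)" and ?u0.0 = n0 and ?v0.0 = p0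
          and b = "\<lambda>L \<sigma>. \<tau> L \<sigma> * bernoulli_fun (- dif \<psi>D \<psi> L \<sigma>)"])
      fix L assume L: "L \<in> C"
      have eq1: "vol L * (n L - n0 L) / dt = (\<Sum>\<sigma>\<in>E L. \<tau> L \<sigma> * bernoulli_fun (dif \<psi>D \<psi> L \<sigma>) * dif nD n L \<sigma>)
          - (- (1 / \<epsilon>) * vol L * (p L - n L)) * n L"
        using eqn[OF L] unfolding sum_flux S[OF L] by linarith
      show "vol L * (n L - n0 L) / dt = (\<Sum>\<sigma>\<in>E L. \<tau> L \<sigma> * bernoulli_fun (dif \<psi>D \<psi> L \<sigma>) * dif nD n L \<sigma>)
          + 1 / \<epsilon> * n L * vol L * (p L - n L)"
        unfolding eq1 by (simp add: algebra_simps diff_divide_distrib)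
      have S': "(\<Sum>\<sigma>\<in>E L. \<tau> L \<sigma> * - dif \<psi>D \<psi> L \<sigma>) = 1 / \<epsilon> * vol L * (p L - n L)"
        using S[OF L] by (simp add: sum_negf)
      have eq2: "vol L * (p L - p0 L) / dt = (\<Sum>\<sigma>\<in>E L. \<tau> L \<sigma> * bernoulli_fun (- dif \<psi>D \<psi> L \<sigma>) * dif pD p L \<sigma>)
          - (1 / \<epsilon> * vol L * (p L - n L)) * p L"
        using eqp[OF L] unfolding sum_flux S' by linarith
      show "vol L * (p L - p0 L) / dt = (\<Sum>\<sigma>\<in>E L. \<tau> L \<sigma> * bernoulli_fun (- dif \<psi>D \<psi> L \<sigma>) * dif pD p L \<sigma>)
          + 1 / \<epsilon> * p L * vol L * (n L - p L)"
        unfolding eq2 by (simp add: algebra_simps diff_divide_distrib)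
    qed (use \<epsilon> dt n0 p0 nD pD nn pn B K in auto)
  next
    case True
    have pn_eq: "p L = n L" if "L \<in> C" for L
      using poisson[OF that] True vol_pos[OF that] by simp
    have ev_eq: "ev pD p L \<sigma> = ev nD n L \<sigma>" if "L \<in> C" "\<sigma> \<in> E L" for L \<sigma>
      using that pn_eq nb_in[OF that] quasineutral(2)[OF True that] by (auto simp: ev_def)
    have flux_p: "flux pD p x L \<sigma> = flux nD n x L \<sigma>" if "L \<in> C" "\<sigma> \<in> E L" for L \<sigma> x
      using that by (simp add: flux_def ev_eq pn_eq)
    define a where "a = (\<lambda>L \<sigma>. \<tau> L \<sigma> * ((bernoulli_fun (dif \<psi>D \<psi> L \<sigma>) + bernoulli_fun (- dif \<psi>D \<psi> L \<sigma>)) / 2))"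
    have a: "0 \<le> a L \<sigma>" if "L \<in> C" "\<sigma> \<in> E L" for L \<sigma>
      unfolding a_def using tau_nonneg[OF that] bernoulli_fun_pos
      by (intro mult_nonneg_nonneg) (auto intro!: add_pos_pos less_imp_le)
    have eq: "vol L * (n L - n0 L) / dt = (\<Sum>\<sigma>\<in>E L. a L \<sigma> * dif nD n L \<sigma>)" if L: "L \<in> C" for L
    proof -
      \<comment> \<open>The odd parts cancel. The factor 2 is matched by the two identical
        accumulation terms.\<close>
      have "(\<Sum>\<sigma>\<in>E L. flux nD n (dif \<psi>D \<psi> L \<sigma>) L \<sigma>) + (\<Sum>\<sigma>\<in>E L. flux pD p (- dif \<psi>D \<psi> L \<sigma>) L \<sigma>)
          = (\<Sum>\<sigma>\<in>E L. - 2 * (a L \<sigma> * dif nD n L \<sigma>))"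
        unfolding sum.distrib[symmetric]
      proof (rule sum.cong)
        fix \<sigma> assume "\<sigma> \<in> E L"
        then show "flux nD n (dif \<psi>D \<psi> L \<sigma>) L \<sigma> + flux pD p (- dif \<psi>D \<psi> L \<sigma>) L \<sigma> = - 2 * (a L \<sigma> * dif nD n L \<sigma>)"
          unfolding flux_p[OF L \<open>\<sigma> \<in> E L\<close>] unfolding flux_symmetric a_def by (simp add: field_simps)
      qed simp
      then show ?thesis using eqn[OF L] eqp[OF L]
        unfolding pn_eq[OF L] quasineutral(1)[OF True L] sum_distrib_left[symmetric] by linarith
    qed
    have "m \<le> n K \<and> n K \<le> M \<and> m \<le> n K \<and> n K \<le> M"
      by (rule reaction_diffusion_bounds[where \<kappa> = 0 and uD = nD and vD = nD and u = n and v = n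
          and a = a and b = a and ?u0.0 = n0 and ?v0.0 = n0])
         (use eq a dt n0 nD nn K in auto)
    then show ?thesis using pn_eq[OF K] by simp
  qed
qed

text \<open>Needed for the potential at time 0; later potentials are found together with the
  densities of their step. Although the system is linear, the barrier box gives a solution
  directly.\<close>

lemma poisson_exists:
  assumes reach: "\<And>K. K \<in> C \<Longrightarrow> \<exists>n. reach n K" and \<epsilon>: "\<epsilon> > 0"
  obtains \<psi> where "\<And>K. K \<in> C \<Longrightarrow> - \<epsilon> * (\<Sum>\<sigma>\<in>E K. \<tau> K \<sigma> * dif \<psi>D \<psi> K \<sigma>) = f K"
proof -
  define c where "c = (\<Sum>K\<in>C. \<bar>f K\<bar>) / \<epsilon>"
  have c: "\<bar>f K\<bar> \<le> \<epsilon> * c" if "K \<in> C" for K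
    using member_le_sum[of K C "\<lambda>K. \<bar>f K\<bar>"] that finite_C \<epsilon> by (auto simp: c_def)
  obtain R where R: "\<And>K. R K \<ge> (0::real)"
    "\<And>\<psi> K. K \<in> C \<Longrightarrow> \<forall>L\<in>C. \<bar>\<psi> L\<bar> \<le> R L \<Longrightarrow> \<psi> K = R K \<Longrightarrow> (\<Sum>\<sigma>\<in>E K. \<tau> K \<sigma> * dif \<psi>D \<psi> K \<sigma>) \<le> - c"
    "\<And>\<psi> K. K \<in> C \<Longrightarrow> \<forall>L\<in>C. \<bar>\<psi> L\<bar> \<le> R L \<Longrightarrow> \<psi> K = - R K \<Longrightarrow> (\<Sum>\<sigma>\<in>E K. \<tau> K \<sigma> * dif \<psi>D \<psi> K \<sigma>) \<ge> c"
    by (rule potential_box[OF reach]) (assumption | rule that)+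
  obtain \<psi> where "\<forall>K\<in>C. - \<epsilon> * (\<Sum>\<sigma>\<in>E K. \<tau> K \<sigma> * dif \<psi>D \<psi> K \<sigma>) - f K = 0"
  proof (rule poincare_miranda[OF finite_C, where lo = "\<lambda>K. - R K" and hi = R and
        F = "\<lambda>\<psi> K. - \<epsilon> * (\<Sum>\<sigma>\<in>E K. \<tau> K \<sigma> * dif \<psi>D \<psi> K \<sigma>) - f K"])
    show "- R K \<le> R K" for K using R(1)[of K] by simp
  next
    fix X :: "nat \<Rightarrow> 'k \<Rightarrow> real" and x K
    assume "K \<in> C" "\<forall>j\<in>C. (\<lambda>k. X k j) \<longlonglongrightarrow> x j"
    then show "(\<lambda>k. - \<epsilon> * (\<Sum>\<sigma>\<in>E K. \<tau> K \<sigma> * dif \<psi>D (X k) K \<sigma>) - f K) \<longlonglongrightarrow>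
        - \<epsilon> * (\<Sum>\<sigma>\<in>E K. \<tau> K \<sigma> * dif \<psi>D x K \<sigma>) - f K"
      by (intro tendsto_intros tendsto_dif) auto
  next
    fix \<psi> K assume K: "K \<in> C" and box: "\<forall>j\<in>C. - R j \<le> \<psi> j \<and> \<psi> j \<le> R j"
    then have ab: "\<forall>L\<in>C. \<bar>\<psi> L\<bar> \<le> R L" by (auto simp: abs_le_iff)
    show "- \<epsilon> * (\<Sum>\<sigma>\<in>E K. \<tau> K \<sigma> * dif \<psi>D \<psi> K \<sigma>) - f K \<le> 0" if "\<psi> K = - R K"
      using mult_left_mono[OF R(3)[OF K ab that] less_imp_le[OF \<epsilon>]] c[OF K] by simp
    show "- \<epsilon> * (\<Sum>\<sigma>\<in>E K. \<tau> K \<sigma> * dif \<psi>D \<psi> K \<sigma>) - f K \<ge> 0" if "\<psi> K = R K"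
      using mult_left_mono[OF R(2)[OF K ab that] less_imp_le[OF \<epsilon>]] c[OF K] by simp
  qed
  then show thesis using that[of \<psi>] by simp
qed

text \<open>With the Poisson equation inserted (\<open>H\<close> in the proof), the residuals have a sign on the faces of the
  box for every potential; the zeros of the resulting system are those of the scheme.\<close>

lemma drift_diffusion_step_exists:
  assumes reach: "\<And>K. K \<in> C \<Longrightarrow> \<exists>n. reach n K"
    and dt: "dt > 0" and \<epsilon>: "\<epsilon> > 0" and m: "m \<ge> 0"
    and n0: "\<And>K. K \<in> C \<Longrightarrow> m \<le> n0 K \<and> n0 K \<le> M"
    and p0: "\<And>K. K \<in> C \<Longrightarrow> m \<le> p0 K \<and> p0 K \<le> M"
    and nD: "\<And>K \<sigma>. K \<in> C \<Longrightarrow> \<sigma> \<in> E K \<Longrightarrow> \<sigma> \<notin> I \<Longrightarrow> \<sigma> \<in> D \<Longrightarrow> m \<le> nD \<sigma> \<and> nD \<sigma> \<le> M"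
    and pD: "\<And>K \<sigma>. K \<in> C \<Longrightarrow> \<sigma> \<in> E K \<Longrightarrow> \<sigma> \<notin> I \<Longrightarrow> \<sigma> \<in> D \<Longrightarrow> m \<le> pD \<sigma> \<and> pD \<sigma> \<le> M"
  obtains n p \<psi> where
    "\<And>K. K \<in> C \<Longrightarrow> vol K * (n K - n0 K) / dt + (\<Sum>\<sigma>\<in>E K. flux nD n (dif \<psi>D \<psi> K \<sigma>) K \<sigma>) = 0"
    "\<And>K. K \<in> C \<Longrightarrow> vol K * (p K - p0 K) / dt + (\<Sum>\<sigma>\<in>E K. flux pD p (- dif \<psi>D \<psi> K \<sigma>) K \<sigma>) = 0"
    "\<And>K. K \<in> C \<Longrightarrow> - \<epsilon> * (\<Sum>\<sigma>\<in>E K. \<tau> K \<sigma> * dif \<psi>D \<psi> K \<sigma>) = vol K * (p K - n K)"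
proof -
  \<comment> \<open>For densities in [m, M] with m \<ge> 0 the charge of a cell is at most M times
    the total volume. Dividing by \<epsilon> turns this into a bound for the weighted sum of
    potential differences.\<close>
  define c where "c = M * (\<Sum>K\<in>C. vol K) / \<epsilon>"
  have mM: "m \<le> M" "M \<ge> 0" if "K \<in> C" for K using n0[OF that] m by auto
  have c: "\<bar>vol K * (y - x)\<bar> \<le> \<epsilon> * c" if "K \<in> C" "m \<le> x" "x \<le> M" "m \<le> y" "y \<le> M" for K x y
  proof -
    have "\<bar>vol K * (y - x)\<bar> \<le> vol K * M"
      unfolding abs_mult using vol_pos[OF that(1)] that m by (intro mult_mono) auto
    also have "\<dots> \<le> (\<Sum>K\<in>C. vol K) * M"
      using that(1) finite_C vol_pos mM[OF that(1)] by (intro mult_right_mono member_le_sum) (auto intro: less_imp_le)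
    finally show ?thesis using \<epsilon> by (simp add: c_def mult.commute)
  qed
  obtain R where R: "\<And>K. R K \<ge> (0::real)"
    "\<And>\<psi> K. K \<in> C \<Longrightarrow> \<forall>L\<in>C. \<bar>\<psi> L\<bar> \<le> R L \<Longrightarrow> \<psi> K = R K \<Longrightarrow> (\<Sum>\<sigma>\<in>E K. \<tau> K \<sigma> * dif \<psi>D \<psi> K \<sigma>) \<le> - c"
    "\<And>\<psi> K. K \<in> C \<Longrightarrow> \<forall>L\<in>C. \<bar>\<psi> L\<bar> \<le> R L \<Longrightarrow> \<psi> K = - R K \<Longrightarrow> (\<Sum>\<sigma>\<in>E K. \<tau> K \<sigma> * dif \<psi>D \<psi> K \<sigma>) \<ge> c"
    by (rule potential_box[OF reach]) (assumption | rule that)+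
  \<comment> \<open>Residual of the density \<open>u\<close> with the other density \<open>v\<close>
    in the reaction term. The electron equation uses \<open>d\<close>, the hole equation
    \<open>- d\<close> and exchanged roles.\<close>
  define H where "H = (\<lambda>d u u0 uD v K. vol K * (u K - u0 K) / dt
     - (\<Sum>\<sigma>\<in>E K. \<tau> K \<sigma> * bernoulli_fun (d K \<sigma>) * dif uD u K \<sigma>) - u K * (vol K * (v K - u K)) / \<epsilon>)"
  have H_high: "H d u u0 uD v K \<ge> 0" if "K \<in> C" "\<forall>L\<in>C. u L \<le> M" "v K \<le> M" "u K = M" "u0 K \<le> M"
    "\<And>\<sigma>. \<sigma> \<in> E K \<Longrightarrow> \<sigma> \<notin> I \<Longrightarrow> \<sigma> \<in> D \<Longrightarrow> uD \<sigma> \<le> M" for d u u0 uD v K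
  proof -
    have "\<tau> K \<sigma> * bernoulli_fun (d K \<sigma>) * dif uD u K \<sigma> \<le> 0" if "\<sigma> \<in> E K" for \<sigma>
    proof -
      have "ev uD u K \<sigma> \<le> M" by (rule ev_le) (use \<open>K \<in> C\<close> \<open>\<forall>L\<in>C. u L \<le> M\<close> that \<open>\<And>\<sigma>. _ \<Longrightarrow> _ \<Longrightarrow> _ \<Longrightarrow> uD \<sigma> \<le> M\<close> in auto)
      then show ?thesis using tau_nonneg[OF \<open>K \<in> C\<close> that] bernoulli_fun_pos[of "d K \<sigma>"] \<open>u K = M\<close>
        by (intro mult_nonneg_nonpos) (auto simp: dif_def)
    qed
    then have "(\<Sum>\<sigma>\<in>E K. \<tau> K \<sigma> * bernoulli_fun (d K \<sigma>) * dif uD u K \<sigma>) \<le> 0" by (rule sum_nonpos)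
    moreover have "u K * (vol K * (v K - u K)) / \<epsilon> \<le> 0"
      using that mM[OF that(1)] vol_pos[OF that(1)] \<epsilon>
      by (intro divide_nonpos_pos mult_nonneg_nonpos) auto
    moreover have "vol K * (u K - u0 K) / dt \<ge> 0" using that vol_pos[OF that(1)] dt by simp
    ultimately show ?thesis unfolding H_def by linarith
  qed
  have H_low: "H d u u0 uD v K \<le> 0" if "K \<in> C" "\<forall>L\<in>C. m \<le> u L" "m \<le> v K" "u K = m" "m \<le> u0 K"
    "\<And>\<sigma>. \<sigma> \<in> E K \<Longrightarrow> \<sigma> \<notin> I \<Longrightarrow> \<sigma> \<in> D \<Longrightarrow> m \<le> uD \<sigma>" for d u u0 uD v K
  proof -
    have "\<tau> K \<sigma> * bernoulli_fun (d K \<sigma>) * dif uD u K \<sigma> \<ge> 0" if "\<sigma> \<in> E K" for \<sigma>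
    proof -
      have "m \<le> ev uD u K \<sigma>" by (rule ev_ge) (use \<open>K \<in> C\<close> \<open>\<forall>L\<in>C. m \<le> u L\<close> that \<open>\<And>\<sigma>. _ \<Longrightarrow> _ \<Longrightarrow> _ \<Longrightarrow> m \<le> uD \<sigma>\<close> in auto)
      then show ?thesis using tau_nonneg[OF \<open>K \<in> C\<close> that] bernoulli_fun_pos[of "d K \<sigma>"] \<open>u K = m\<close>
        by (intro mult_nonneg_nonneg) (auto simp: dif_def)
    qed
    then have "(\<Sum>\<sigma>\<in>E K. \<tau> K \<sigma> * bernoulli_fun (d K \<sigma>) * dif uD u K \<sigma>) \<ge> 0" by (rule sum_nonneg)
    moreover have "u K * (vol K * (v K - u K)) / \<epsilon> \<ge> 0"
      using that m vol_pos[OF that(1)] \<epsilon> by (intro divide_nonneg_pos mult_nonneg_nonneg) auto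
    moreover have "vol K * (u K - u0 K) / dt \<le> 0"
      using that vol_pos[OF that(1)] dt by (intro divide_nonpos_pos mult_nonneg_nonpos) auto
    ultimately show ?thesis unfolding H_def by linarith
  qed
  have H_tendsto: "(\<lambda>k. H (d k) (U k) u0 uD (V k) K) \<longlonglongrightarrow> H e u u0 uD v K"
    if "K \<in> C" "\<And>\<sigma>. \<sigma> \<in> E K \<Longrightarrow> (\<lambda>k. d k K \<sigma>) \<longlonglongrightarrow> e K \<sigma>" "\<And>L. L \<in> C \<Longrightarrow> (\<lambda>k. U k L) \<longlonglongrightarrow> u L"
       "\<And>L. L \<in> C \<Longrightarrow> (\<lambda>k. V k L) \<longlonglongrightarrow> v L" for d e U u V v u0 uD K
    unfolding H_def using that dt \<epsilon> by (intro tendsto_intros tendsto_dif) auto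
  \<comment> \<open>Index 0 is the electron density, 1 the hole density, 2 the potential. The
    Poisson residual carries the minus sign of the Laplacian, so that it is nonnegative on the upper
    face.\<close>
  define F where "F = (\<lambda>(x :: nat \<times> 'k \<Rightarrow> real) (i :: nat, K :: 'k).
    if i = 0 then H (\<lambda>K \<sigma>.  dif \<psi>D (\<lambda>L. x (2, L)) K \<sigma>) (\<lambda>L. x (0, L)) n0 nD (\<lambda>L. x (1, L)) K
    else if i = 1 then H (\<lambda>K \<sigma>. - dif \<psi>D (\<lambda>L. x (2, L)) K \<sigma>) (\<lambda>L. x (1, L)) p0 pD (\<lambda>L. x (0, L)) K
    else - \<epsilon> * (\<Sum>\<sigma>\<in>E K. \<tau> K \<sigma> * dif \<psi>D (\<lambda>L. x (2, L)) K \<sigma>) - vol K * (x (1, K) - x (0, K)))"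
  obtain x where x: "\<forall>j\<in>{0,1,2::nat} \<times> C. F x j = 0"
  proof (rule poincare_miranda[where J = "{0,1,2::nat} \<times> C" and F = F
        and lo = "\<lambda>(i, K). if i = 2 then - R K else m" and hi = "\<lambda>(i, K). if i = 2 then R K else M"])
    show "finite ({0,1,2::nat} \<times> C)" using finite_C by simp
    show "(case j of (i, K) \<Rightarrow> if i = 2 then - R K else m) \<le> (case j of (i, K) \<Rightarrow> if i = 2 then R K else M)"
      if "j \<in> {0,1,2::nat} \<times> C" for j using that R(1) mM by (auto intro: order_trans[of _ 0])
  next
    fix X :: "nat \<Rightarrow> nat \<times> 'k \<Rightarrow> real" and x and j :: "nat \<times> 'k"
    assume j: "j \<in> {0,1,2::nat} \<times> C" and lim: "\<forall>j\<in>{0,1,2} \<times> C. (\<lambda>k. X k j) \<longlonglongrightarrow> x j"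
    obtain i K where [simp]: "j = (i, K)" by (cases j)
    have K: "K \<in> C" using j by auto
    consider "i = 0" | "i = 1" | "i = 2" using j by auto
    then show "(\<lambda>k. F (X k) j) \<longlonglongrightarrow> F x j"
    proof cases
      case 1
      show ?thesis unfolding F_def using 1 lim K by simp (rule H_tendsto, auto intro!: tendsto_intros tendsto_dif)
    next
      case 2
      show ?thesis unfolding F_def using 2 lim K by simp (rule H_tendsto, auto intro!: tendsto_intros tendsto_dif)
    next
      case 3
      then show ?thesis unfolding F_def using lim K by simp (intro tendsto_intros tendsto_dif, auto)
    qed
  next
    fix x :: "nat \<times> 'k \<Rightarrow> real" and j assume j: "j \<in> {0,1,2::nat} \<times> C"
      and box: "\<forall>j\<in>{0,1,2} \<times> C. (case j of (i, K) \<Rightarrow> if i = 2 then - R K else m) \<le> x j \<and>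
          x j \<le> (case j of (i, K) \<Rightarrow> if i = 2 then R K else M)"
    obtain i K where ij [simp]: "j = (i, K)" by (cases j)
    have K: "K \<in> C" using j by auto
    have b: "m \<le> x (0, L)" "x (0, L) \<le> M" "m \<le> x (1, L)" "x (1, L) \<le> M" "\<bar>x (2, L)\<bar> \<le> R L" if "L \<in> C" for L
      using that box[rule_format, of "(0, L)"] box[rule_format, of "(1, L)"] box[rule_format, of "(2, L)"]
      by (auto simp: abs_le_iff)
    consider "i = 0" | "i = 1" | "i = 2" using j by auto
    note i_cases = this
    show "F x j \<le> 0" if eq: "x j = (case j of (i, K) \<Rightarrow> if i = 2 then - R K else m)"
      using i_cases
    proof cases
      case 1
      show ?thesis unfolding F_def using 1 eq b K n0[OF K] nD[OF K] by simp (rule H_low, auto)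
    next
      case 2
      show ?thesis unfolding F_def using 2 eq b K p0[OF K] pD[OF K] by simp (rule H_low, auto)
    next
      case 3
      have "c \<le> (\<Sum>\<sigma>\<in>E K. \<tau> K \<sigma> * dif \<psi>D (\<lambda>L. x (2, L)) K \<sigma>)" using R(3)[OF K, of "\<lambda>L. x (2, L)"] b 3 eq by simp
      from mult_left_mono[OF this less_imp_le[OF \<epsilon>]] show ?thesis
        using 3 c[OF K b(1)[OF K] b(2)[OF K] b(3)[OF K] b(4)[OF K]] unfolding F_def abs_le_iff by simp
    qed
    show "F x j \<ge> 0" if eq: "x j = (case j of (i, K) \<Rightarrow> if i = 2 then R K else M)"
      using i_cases
    proof cases
      case 1
      show ?thesis unfolding F_def using 1 eq b K n0[OF K] nD[OF K] by simp (rule H_high, auto)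
    next
      case 2
      show ?thesis unfolding F_def using 2 eq b K p0[OF K] pD[OF K] by simp (rule H_high, auto)
    next
      case 3
      have "(\<Sum>\<sigma>\<in>E K. \<tau> K \<sigma> * dif \<psi>D (\<lambda>L. x (2, L)) K \<sigma>) \<le> - c" using R(2)[OF K, of "\<lambda>L. x (2, L)"] b 3 eq by simp
      from mult_left_mono[OF this less_imp_le[OF \<epsilon>]] show ?thesis
        using 3 c[OF K b(1)[OF K] b(2)[OF K] b(3)[OF K] b(4)[OF K]] unfolding F_def abs_le_iff by simp
    qed
  qed
  define n p \<psi> where "n = (\<lambda>L. x (0, L))" and "p = (\<lambda>L. x (1, L))" and "\<psi> = (\<lambda>L. x (2, L))"
  show thesis
  proof (rule that[of n \<psi> p])
    fix K assume K: "K \<in> C"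
    have S: "- \<epsilon> * (\<Sum>\<sigma>\<in>E K. \<tau> K \<sigma> * dif \<psi>D \<psi> K \<sigma>) = vol K * (p K - n K)"
      using x[rule_format, of "(2, K)"] K by (simp add: F_def n_def p_def \<psi>_def)
    then show "- \<epsilon> * (\<Sum>\<sigma>\<in>E K. \<tau> K \<sigma> * dif \<psi>D \<psi> K \<sigma>) = vol K * (p K - n K)" .
    have S': "(\<Sum>\<sigma>\<in>E K. \<tau> K \<sigma> * dif \<psi>D \<psi> K \<sigma>) = - (vol K * (p K - n K)) / \<epsilon>"
      using S \<epsilon> by (simp add: field_simps)
    have S'': "(\<Sum>\<sigma>\<in>E K. \<tau> K \<sigma> * - dif \<psi>D \<psi> K \<sigma>) = - (vol K * (n K - p K)) / \<epsilon>"
      using S' by (simp add: sum_negf diff_divide_distrib algebra_simps)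
    have "H (\<lambda>K \<sigma>. dif \<psi>D \<psi> K \<sigma>) n n0 nD p K = 0"
      using x[rule_format, of "(0, K)"] K by (simp add: F_def n_def p_def \<psi>_def)
    then show "vol K * (n K - n0 K) / dt + (\<Sum>\<sigma>\<in>E K. flux nD n (dif \<psi>D \<psi> K \<sigma>) K \<sigma>) = 0"
      unfolding sum_flux S' H_def by (simp add: algebra_simps diff_divide_distrib)
    have "H (\<lambda>K \<sigma>. - dif \<psi>D \<psi> K \<sigma>) p p0 pD n K = 0"
      using x[rule_format, of "(1, K)"] K by (simp add: F_def n_def p_def \<psi>_def)
    then show "vol K * (p K - p0 K) / dt + (\<Sum>\<sigma>\<in>E K. flux pD p (- dif \<psi>D \<psi> K \<sigma>) K \<sigma>) = 0"
      unfolding sum_flux S'' H_def by (simp add: algebra_simps diff_divide_distrib)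
  qed
qed

text \<open>The unknowns solve the even part, a diffusion equation for n whose coefficients depend
  on \<psi> but are always nonnegative, and the odd part, a homogeneous equation for \<psi> with
  weights \<open>n K + ev nD n K \<sigma>\<close>. These are nonnegative on the box, so the
  constants -A and A, enclosing the boundary potential, bound the box for \<psi>. The two
  conclusions are the conservation laws for electrons and holes with p = n.\<close>

lemma quasineutral_step_exists:
  assumes dt: "dt > 0" and m: "m \<ge> 0"
    and n0: "\<And>K. K \<in> C \<Longrightarrow> m \<le> n0 K \<and> n0 K \<le> M"
    and nD: "\<And>K \<sigma>. K \<in> C \<Longrightarrow> \<sigma> \<in> E K \<Longrightarrow> \<sigma> \<notin> I \<Longrightarrow> \<sigma> \<in> D \<Longrightarrow> m \<le> nD \<sigma> \<and> nD \<sigma> \<le> M"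
  obtains n \<psi> where
    "\<And>K. K \<in> C \<Longrightarrow> vol K * (n K - n0 K) / dt + (\<Sum>\<sigma>\<in>E K. flux nD n (dif \<psi>D \<psi> K \<sigma>) K \<sigma>) = 0"
    "\<And>K. K \<in> C \<Longrightarrow> vol K * (n K - n0 K) / dt + (\<Sum>\<sigma>\<in>E K. flux nD n (- dif \<psi>D \<psi> K \<sigma>) K \<sigma>) = 0"
proof -
  have mM: "m \<le> M" if "K \<in> C" for K using n0[OF that] by auto
  define a where "a = (\<lambda>\<psi> L \<sigma>. \<tau> L \<sigma> * ((bernoulli_fun (dif \<psi>D \<psi> L \<sigma>) + bernoulli_fun (- dif \<psi>D \<psi> L \<sigma>)) / 2))"
  have a: "0 \<le> a \<psi> L \<sigma>" if "L \<in> C" "\<sigma> \<in> E L" for L \<sigma> \<psi>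
    unfolding a_def using tau_nonneg[OF that] bernoulli_fun_pos
    by (intro mult_nonneg_nonneg) (auto intro!: add_pos_pos less_imp_le)
  define Z where "Z = (\<Union>K\<in>C. E K)"
  have "finite Z" using finite_C finite_E by (auto simp: Z_def)
  define A where "A = (\<Sum>\<sigma>\<in>Z. \<bar>\<psi>D \<sigma>\<bar>)"
  have A0: "A \<ge> 0" unfolding A_def by (intro sum_nonneg) auto
  have A1: "\<bar>\<psi>D \<sigma>\<bar> \<le> A" if "K \<in> C" "\<sigma> \<in> E K" for K \<sigma>
    unfolding A_def using that \<open>finite Z\<close>
    by (intro member_le_sum[where f = "\<lambda>\<sigma>. \<bar>\<psi>D \<sigma>\<bar>"]) (auto simp: Z_def)
  define G where "G = (\<lambda>n \<psi> K. vol K * (n K - n0 K) / dt - (\<Sum>\<sigma>\<in>E K. a \<psi> K \<sigma> * dif nD n K \<sigma>))"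
  define H where "H = (\<lambda>n \<psi> K. - (\<Sum>\<sigma>\<in>E K. \<tau> K \<sigma> * dif \<psi>D \<psi> K \<sigma> * (n K + ev nD n K \<sigma>)))"
  define F where "F = (\<lambda>(x :: bool \<times> 'k \<Rightarrow> real) (i :: bool, K :: 'k).
    (if i then G else H) (\<lambda>L. x (True, L)) (\<lambda>L. x (False, L)) K)"
  obtain x where x: "\<forall>j\<in>UNIV \<times> C. F x j = 0"
  proof (rule poincare_miranda[where J = "UNIV \<times> C" and F = F
        and lo = "\<lambda>(i, K). if i then m else - A" and hi = "\<lambda>(i, K). if i then M else A"])
    show "finite (UNIV \<times> C :: (bool \<times> 'k) set)" using finite_C by simp
    show "(case j of (i, K) \<Rightarrow> if i then m else - A) \<le> (case j of (i, K) \<Rightarrow> if i then M else A)"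
      if "j \<in> UNIV \<times> C" for j :: "bool \<times> 'k" using that A0 mM by auto
  next
    fix X :: "nat \<Rightarrow> bool \<times> 'k \<Rightarrow> real" and x and j :: "bool \<times> 'k"
    assume j: "j \<in> UNIV \<times> C" and lim: "\<forall>j\<in>UNIV \<times> C. (\<lambda>k. X k j) \<longlonglongrightarrow> x j"
    obtain i K where [simp]: "j = (i, K)" by (cases j)
    show "(\<lambda>k. F (X k) j) \<longlonglongrightarrow> F x j"
      using j lim dt by (cases i) (auto simp: F_def G_def H_def a_def intro!: tendsto_intros tendsto_dif tendsto_ev)
  next
    fix x and j :: "bool \<times> 'k" assume j: "j \<in> UNIV \<times> C"
      and box: "\<forall>j\<in>UNIV \<times> C. (case j of (i, K) \<Rightarrow> if i then m else - A) \<le> x j \<and>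
          x j \<le> (case j of (i, K) \<Rightarrow> if i then M else A)"
    obtain i K where ij [simp]: "j = (i, K)" by (cases j)
    have K: "K \<in> C" using j by auto
    have b: "m \<le> x (True, L)" "x (True, L) \<le> M" "- A \<le> x (False, L)" "x (False, L) \<le> A" if "L \<in> C" for L
      using that box[rule_format, of "(True, L)"] box[rule_format, of "(False, L)"] by auto
    have evn: "m \<le> ev nD (\<lambda>L. x (True, L)) K \<sigma>" "ev nD (\<lambda>L. x (True, L)) K \<sigma> \<le> M" if "\<sigma> \<in> E K" for \<sigma>
      by (rule ev_ge ev_le; use b K that nD[OF K] in auto)+
    have ev\<psi>: "- A \<le> ev \<psi>D (\<lambda>L. x (False, L)) K \<sigma>" "ev \<psi>D (\<lambda>L. x (False, L)) K \<sigma> \<le> A" if "\<sigma> \<in> E K" for \<sigma>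
      by (rule ev_ge ev_le; use b K that A1[OF K] in \<open>auto simp: abs_le_iff minus_le_iff\<close>)+
    have npos: "0 \<le> x (True, K) + ev nD (\<lambda>L. x (True, L)) K \<sigma>" if "\<sigma> \<in> E K" for \<sigma>
      using b(1)[OF K] evn(1)[OF that] m by linarith
    show "F x j \<le> 0" if eq: "x j = (case j of (i, K) \<Rightarrow> if i then m else - A)"
    proof (cases i)
      case True
      have "0 \<le> (\<Sum>\<sigma>\<in>E K. a (\<lambda>L. x (False, L)) K \<sigma> * dif nD (\<lambda>L. x (True, L)) K \<sigma>)"
        using a[OF K] evn eq True by (intro sum_nonneg mult_nonneg_nonneg) (auto simp: dif_def)
      moreover have "vol K * (x (True, K) - n0 K) / dt \<le> 0"
        using eq True n0[OF K] vol_pos[OF K] dt by (intro divide_nonpos_pos mult_nonneg_nonpos) auto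
      ultimately show ?thesis using True by (simp add: F_def G_def)
    next
      case False
      have dn: "dif \<psi>D (\<lambda>L. x (False, L)) K \<sigma> \<ge> 0" if "\<sigma> \<in> E K" for \<sigma>
        using ev\<psi>(1)[OF that] eq False by (simp add: dif_def)
      have "0 \<le> (\<Sum>\<sigma>\<in>E K. \<tau> K \<sigma> * dif \<psi>D (\<lambda>L. x (False, L)) K \<sigma> * (x (True, K) + ev nD (\<lambda>L. x (True, L)) K \<sigma>))"
        using tau_nonneg[OF K] dn npos by (intro sum_nonneg mult_nonneg_nonneg) auto
      then show ?thesis using False by (simp add: F_def H_def)
    qed
    show "F x j \<ge> 0" if eq: "x j = (case j of (i, K) \<Rightarrow> if i then M else A)"
    proof (cases i)
      case True
      have "(\<Sum>\<sigma>\<in>E K. a (\<lambda>L. x (False, L)) K \<sigma> * dif nD (\<lambda>L. x (True, L)) K \<sigma>) \<le> 0"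
        using a[OF K] evn eq True by (intro sum_nonpos mult_nonneg_nonpos) (auto simp: dif_def)
      moreover have "vol K * (x (True, K) - n0 K) / dt \<ge> 0"
        using eq True n0[OF K] vol_pos[OF K] dt by (intro divide_nonneg_pos mult_nonneg_nonneg) auto
      ultimately show ?thesis using True by (simp add: F_def G_def)
    next
      case False
      have dn: "dif \<psi>D (\<lambda>L. x (False, L)) K \<sigma> \<le> 0" if "\<sigma> \<in> E K" for \<sigma>
        using ev\<psi>(2)[OF that] eq False by (simp add: dif_def)
      have "(\<Sum>\<sigma>\<in>E K. \<tau> K \<sigma> * dif \<psi>D (\<lambda>L. x (False, L)) K \<sigma> * (x (True, K) + ev nD (\<lambda>L. x (True, L)) K \<sigma>)) \<le> 0"
        using tau_nonneg[OF K] dn npos by (intro sum_nonpos mult_nonpos_nonneg mult_nonneg_nonpos) auto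
      then show ?thesis using False by (simp add: F_def H_def)
    qed
  qed
  define n \<psi> where "n = (\<lambda>L. x (True, L))" and "\<psi> = (\<lambda>L. x (False, L))"
  have G: "G n \<psi> K = 0" and H: "H n \<psi> K = 0" if "K \<in> C" for K
    using x[rule_format, of "(True, K)"] x[rule_format, of "(False, K)"] that by (auto simp: F_def n_def \<psi>_def)
  have Hm: "(\<Sum>\<sigma>\<in>E K. \<tau> K \<sigma> * (s * dif \<psi>D \<psi> K \<sigma>) * (n K + ev nD n K \<sigma>) / 2) = 0" if "K \<in> C" for s K
  proof -
    have "(\<Sum>\<sigma>\<in>E K. \<tau> K \<sigma> * (s * dif \<psi>D \<psi> K \<sigma>) * (n K + ev nD n K \<sigma>) / 2) = - (s / 2) * H n \<psi> K"
      unfolding H_def by (simp add: sum_distrib_left sum_negf mult_ac)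
    then show ?thesis using H[OF that] by simp
  qed
  \<comment> \<open>Changing the sign s leaves the even part unchanged and multiplies the vanishing
    odd part by -1, so both equations follow at once.\<close>
  have flux_sum: "vol K * (n K - n0 K) / dt + (\<Sum>\<sigma>\<in>E K. flux nD n (s * dif \<psi>D \<psi> K \<sigma>) K \<sigma>) = 0"
    if "K \<in> C" "s = 1 \<or> s = - 1" for s K
  proof -
    have "\<tau> K \<sigma> * ((bernoulli_fun (s * dif \<psi>D \<psi> K \<sigma>) + bernoulli_fun (- (s * dif \<psi>D \<psi> K \<sigma>))) / 2) = a \<psi> K \<sigma>" for \<sigma>
      using that(2) by (auto simp: a_def)
    then show ?thesis using G[OF that(1)] unfolding flux_symmetric sum_subtractf Hm[OF that(1)] G_def by simp
  qed
  show thesis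
    by (rule that[of n \<psi>]) (use flux_sum[of _ 1] flux_sum[of _ "- 1"] in auto)
qed

end


subsection \<open>Surface measure\<close>

lemma hyperplanes_cases:
  fixes H :: "'a::euclidean_space set"
  assumes "H \<in> hyperplanes"
  obtains \<nu> c where "norm \<nu> = 1" "H = {x. \<nu> \<bullet> x = c}"
proof -
  have "affine H" "aff_dim H = int DIM('a) - 1" using assms by (auto simp: hyperplanes_def)
  then obtain a b where ab: "a \<noteq> 0" "affine hull H = {x. a \<bullet> x = b}"
    using aff_dim_eq_hyperplane[of H] by auto
  moreover have "affine hull H = H" using \<open>affine H\<close> by simp
  ultimately have ab: "a \<noteq> 0" "H = {x. a \<bullet> x = b}" by metis+
  have "(sgn a \<bullet> x = b / norm a) \<longleftrightarrow> (a \<bullet> x = b)" for x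
    using ab(1) by (auto simp: sgn_div_norm divide_simps)
  then show thesis using that[of "sgn a" "b / norm a"] ab by (simp add: norm_sgn)
qed

lemma closest_point_hyperplane:
  fixes \<nu> :: "'a::euclidean_space"
  assumes "norm \<nu> = 1"
  shows "closest_point {x. \<nu> \<bullet> x = c} x = x - (\<nu> \<bullet> x - c) *\<^sub>R \<nu>" (is "_ = ?p")
proof (rule sym, rule closest_point_unique)
  show "\<forall>z\<in>{x. \<nu> \<bullet> x = c}. dist x ?p \<le> dist x z"
  proof
    fix z assume "z \<in> {x. \<nu> \<bullet> x = c}"
    then have "\<nu> \<bullet> x - c = \<nu> \<bullet> (x - z)" by (simp add: inner_diff_right)
    then have "\<bar>\<nu> \<bullet> x - c\<bar> \<le> norm (x - z)" using Cauchy_Schwarz_ineq2[of \<nu> "x - z"] assms by simp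
    then show "dist x ?p \<le> dist x z" using assms by (simp add: dist_norm)
  qed
  show "?p \<in> {x. \<nu> \<bullet> x = c}" using assms by (simp add: inner_diff_right dot_square_norm)
qed (auto simp: convex_hyperplane closed_hyperplane)

lemma infdist_hyperplane:
  fixes \<nu> :: "'a::euclidean_space"
  assumes "norm \<nu> = 1"
  shows "infdist x {x. \<nu> \<bullet> x = c} = \<bar>\<nu> \<bullet> x - c\<bar>"
proof -
  have "x - (\<nu> \<bullet> x - c) *\<^sub>R \<nu> \<in> {x. \<nu> \<bullet> x = c}"
    using assms by (simp add: inner_diff_right dot_square_norm)
  then have "{x. \<nu> \<bullet> x = c} \<noteq> {}" by blast
  then have "infdist x {x. \<nu> \<bullet> x = c} = dist x (closest_point {x. \<nu> \<bullet> x = c} x)"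
    using setdist_closest_point[OF closed_hyperplane, of \<nu> c x] by (simp add: infdist_eq_setdist)
  then show ?thesis using assms by (simp add: closest_point_hyperplane dist_norm)
qed

lemma sets_hyperplane_lebesgue [simp, measurable_cong]: "sets (hyperplane_lebesgue H) = sets borel"
  by (simp add: hyperplane_lebesgue_def)

lemma space_hyperplane_lebesgue [simp]: "space (hyperplane_lebesgue H) = UNIV"
  by (simp add: hyperplane_lebesgue_def)

lemma nn_integral_hyperplane_lebesgue:
  fixes \<nu> :: "'a::euclidean_space"
  assumes \<nu>: "norm \<nu> = 1" and [measurable]: "f \<in> borel_measurable borel"
  shows "(\<integral>\<^sup>+y. f y \<partial>hyperplane_lebesgue {x. \<nu> \<bullet> x = c}) =
     (\<integral>\<^sup>+x. indicator {x. \<bar>\<nu> \<bullet> x - c\<bar> \<le> 1 / 2} x * f (x - (\<nu> \<bullet> x - c) *\<^sub>R \<nu>) \<partial>lborel)"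
proof -
  have [measurable]: "{x :: 'a. \<bar>\<nu> \<bullet> x - c\<bar> \<le> 1 / 2} \<in> sets borel" by measurable
  have "hyperplane_lebesgue {x. \<nu> \<bullet> x = c} =
      distr (restrict_space lborel {x. \<bar>\<nu> \<bullet> x - c\<bar> \<le> 1 / 2}) borel (\<lambda>x. x - (\<nu> \<bullet> x - c) *\<^sub>R \<nu>)"
    unfolding hyperplane_lebesgue_def infdist_hyperplane[OF \<nu>]
    by (intro arg_cong[where f = "distr _ _"] ext closest_point_hyperplane[OF \<nu>])
  then have "(\<integral>\<^sup>+y. f y \<partial>hyperplane_lebesgue {x. \<nu> \<bullet> x = c}) =
      (\<integral>\<^sup>+x. f (x - (\<nu> \<bullet> x - c) *\<^sub>R \<nu>) \<partial>restrict_space lborel {x. \<bar>\<nu> \<bullet> x - c\<bar> \<le> 1 / 2})"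
    by (simp add: nn_integral_distr measurable_restrict_space1)
  also have "\<dots> = (\<integral>\<^sup>+x. f (x - (\<nu> \<bullet> x - c) *\<^sub>R \<nu>) * indicator {x. \<bar>\<nu> \<bullet> x - c\<bar> \<le> 1 / 2} x \<partial>lborel)"
    by (subst nn_integral_restrict_space) auto
  finally show ?thesis by (simp add: mult.commute)
qed

lemma emeasure_hyperplane_lebesgue:
  fixes \<nu> :: "'a::euclidean_space"
  assumes \<nu>: "norm \<nu> = 1" and [measurable]: "A \<in> sets borel"
  shows "emeasure (hyperplane_lebesgue {x. \<nu> \<bullet> x = c}) A =
     emeasure lborel {x. \<bar>\<nu> \<bullet> x - c\<bar> \<le> 1 / 2 \<and> x - (\<nu> \<bullet> x - c) *\<^sub>R \<nu> \<in> A}"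
proof -
  have "emeasure (hyperplane_lebesgue {x. \<nu> \<bullet> x = c}) A =
      (\<integral>\<^sup>+y. indicator A y \<partial>hyperplane_lebesgue {x. \<nu> \<bullet> x = c})" by simp
  also have "\<dots> = (\<integral>\<^sup>+x. indicator {x. \<bar>\<nu> \<bullet> x - c\<bar> \<le> 1 / 2 \<and> x - (\<nu> \<bullet> x - c) *\<^sub>R \<nu> \<in> A} x \<partial>lborel)"
    unfolding nn_integral_hyperplane_lebesgue[OF \<nu> borel_measurable_indicator[OF assms(2)]]
    by (intro nn_integral_cong) (auto split: split_indicator)
  also have "\<dots> = emeasure lborel {x. \<bar>\<nu> \<bullet> x - c\<bar> \<le> 1 / 2 \<and> x - (\<nu> \<bullet> x - c) *\<^sub>R \<nu> \<in> A}"
    by (subst nn_integral_indicator) auto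
  finally show ?thesis .
qed

lemma nn_integral_lborel_translate:
  fixes f :: "'a::euclidean_space \<Rightarrow> ennreal"
  assumes [measurable]: "f \<in> borel_measurable borel"
  shows "(\<integral>\<^sup>+x. f (x + a) \<partial>lborel) = (\<integral>\<^sup>+x. f x \<partial>lborel)"
proof -
  have "(\<integral>\<^sup>+x. f x \<partial>lborel) = (\<integral>\<^sup>+x. f x \<partial>distr lborel borel ((+) a))"
    by (simp only: lborel_distr_plus)
  then show ?thesis by (simp add: nn_integral_distr add.commute)
qed

text \<open>Fubini in the directions of \<open>H\<close> and \<open>w\<close>. The cylinder in the definition of
  \<open>hyperplane_lebesgue\<close> turns it into an identity between integrals over the whole space,
  which needs only translations.\<close>

lemma nn_integral_lborel_hyperplane:
  fixes \<nu> w :: "'a::euclidean_space"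
  assumes \<nu>: "norm \<nu> = 1" and w: "\<nu> \<bullet> w \<noteq> 0" and [measurable]: "f \<in> borel_measurable borel"
  shows "\<bar>\<nu> \<bullet> w\<bar> * (\<integral>\<^sup>+y. \<integral>\<^sup>+t. f (y + t *\<^sub>R w) \<partial>lborel \<partial>hyperplane_lebesgue {x. \<nu> \<bullet> x = c})
      = (\<integral>\<^sup>+x. f x \<partial>lborel)"
proof -
  define s where "s = (\<lambda>x. \<nu> \<bullet> x - c)"
  define J where "J = {x. \<bar>s x\<bar> \<le> 1 / 2}"
  define a where "a = \<nu> \<bullet> w"
  \<comment> \<open>The tangential part of \<open>w\<close>. Translations along it preserve the
    height \<open>s\<close> and the cylinder \<open>J\<close>, so they remove the shear and leave
    only the displacement \<open>a * t\<close> along the normal.\<close>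
  define v where "v = w - a *\<^sub>R \<nu>"
  have [measurable]: "s \<in> borel_measurable borel" unfolding s_def by measurable
  have [measurable]: "J \<in> sets borel" unfolding J_def by measurable
  have \<nu>1: "\<nu> \<bullet> \<nu> = 1" using \<nu> by (simp add: dot_square_norm)
  have s: "s (x + t *\<^sub>R v) = s x" "s (x + r *\<^sub>R \<nu>) = s x + r" for x t r
    using \<nu>1 by (auto simp: s_def v_def a_def algebra_simps)
  have "(\<integral>\<^sup>+y. \<integral>\<^sup>+t. f (y + t *\<^sub>R w) \<partial>lborel \<partial>hyperplane_lebesgue {x. \<nu> \<bullet> x = c}) =
      (\<integral>\<^sup>+x. indicator J x * (\<integral>\<^sup>+t. f (x - s x *\<^sub>R \<nu> + t *\<^sub>R w) \<partial>lborel) \<partial>lborel)"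
    by (subst nn_integral_hyperplane_lebesgue[OF \<nu>]) (auto simp: J_def s_def)
  also have "\<dots> = (\<integral>\<^sup>+x. \<integral>\<^sup>+t. indicator J x * f (x - s x *\<^sub>R \<nu> + t *\<^sub>R w) \<partial>lborel \<partial>lborel)"
    by (subst nn_integral_cmult) auto
  also have "\<dots> = (\<integral>\<^sup>+t. \<integral>\<^sup>+x. indicator J x * f (x - s x *\<^sub>R \<nu> + t *\<^sub>R w) \<partial>lborel \<partial>lborel)"
    by (rule lborel_pair.Fubini') measurable
  also have "\<dots> = (\<integral>\<^sup>+t. \<integral>\<^sup>+x. indicator J x * f (x + (a * t - s x) *\<^sub>R \<nu>) \<partial>lborel \<partial>lborel)"
  proof (rule nn_integral_cong)
    fix t :: real
    have "(\<integral>\<^sup>+x. indicator J x * f (x - s x *\<^sub>R \<nu> + t *\<^sub>R w) \<partial>lborel) =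
        (\<integral>\<^sup>+x. indicator J (x + t *\<^sub>R v) * f ((x + t *\<^sub>R v) + (a * t - s (x + t *\<^sub>R v)) *\<^sub>R \<nu>) \<partial>lborel)"
    proof (rule nn_integral_cong)
      fix x
      have "x - s x *\<^sub>R \<nu> + t *\<^sub>R w = (x + t *\<^sub>R v) + (a * t - s (x + t *\<^sub>R v)) *\<^sub>R \<nu>"
        unfolding s by (simp add: v_def algebra_simps)
      moreover have "indicator J (x + t *\<^sub>R v) = (indicator J x :: ennreal)"
        by (simp add: J_def indicator_def s)
      ultimately show "indicator J x * f (x - s x *\<^sub>R \<nu> + t *\<^sub>R w) =
          indicator J (x + t *\<^sub>R v) * f ((x + t *\<^sub>R v) + (a * t - s (x + t *\<^sub>R v)) *\<^sub>R \<nu>)" by (simp only:)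
    qed
    also have "\<dots> = (\<integral>\<^sup>+x. indicator J x * f (x + (a * t - s x) *\<^sub>R \<nu>) \<partial>lborel)"
      by (rule nn_integral_lborel_translate[where f = "\<lambda>x. indicator J x * f (x + (a * t - s x) *\<^sub>R \<nu>)"]) measurable
    finally show "(\<integral>\<^sup>+x. indicator J x * f (x - s x *\<^sub>R \<nu> + t *\<^sub>R w) \<partial>lborel) =
        (\<integral>\<^sup>+x. indicator J x * f (x + (a * t - s x) *\<^sub>R \<nu>) \<partial>lborel)" .
  qed
  also have "\<dots> = (\<integral>\<^sup>+x. \<integral>\<^sup>+t. indicator J x * f (x + (a * t - s x) *\<^sub>R \<nu>) \<partial>lborel \<partial>lborel)"
    by (rule lborel_pair.Fubini') measurable
  finally have "\<bar>a\<bar> * (\<integral>\<^sup>+y. \<integral>\<^sup>+t. f (y + t *\<^sub>R w) \<partial>lborel \<partial>hyperplane_lebesgue {x. \<nu> \<bullet> x = c}) =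
      (\<integral>\<^sup>+x. \<bar>a\<bar> * (\<integral>\<^sup>+t. indicator J x * f (x + (a * t - s x) *\<^sub>R \<nu>) \<partial>lborel) \<partial>lborel)"
    by (subst nn_integral_cmult) auto
  \<comment> \<open>Substitution r = a t - s x at fixed x; its Jacobian absorbs the factor
    \<open>\<bar>a\<bar>\<close>.\<close>
  also have "\<dots> = (\<integral>\<^sup>+x. \<integral>\<^sup>+r. indicator J x * f (x + r *\<^sub>R \<nu>) \<partial>lborel \<partial>lborel)"
  proof (rule nn_integral_cong)
    fix x
    show "\<bar>a\<bar> * (\<integral>\<^sup>+t. indicator J x * f (x + (a * t - s x) *\<^sub>R \<nu>) \<partial>lborel) =
        (\<integral>\<^sup>+r. indicator J x * f (x + r *\<^sub>R \<nu>) \<partial>lborel)"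
      using w by (subst (2) nn_integral_real_affine[where c = a and t = "- s x"]) (auto simp: a_def)
  qed
  also have "\<dots> = (\<integral>\<^sup>+r. \<integral>\<^sup>+x. indicator J x * f (x + r *\<^sub>R \<nu>) \<partial>lborel \<partial>lborel)"
    by (rule lborel_pair.Fubini') measurable
  \<comment> \<open>After the translation by \<open>r *\<^sub>R \<nu>\<close>, lying in the cylinder
    means that r is within 1/2 of \<open>s x\<close>. For fixed x this is an interval of length 1,
    the height of the cylinder.\<close>
  also have "\<dots> = (\<integral>\<^sup>+r. \<integral>\<^sup>+x. indicator {s x - 1 / 2..s x + 1 / 2} r * f x \<partial>lborel \<partial>lborel)"
  proof (rule nn_integral_cong)
    fix r :: real
    have "(\<integral>\<^sup>+x. indicator J x * f (x + r *\<^sub>R \<nu>) \<partial>lborel) =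
        (\<integral>\<^sup>+x. indicator {s (x + r *\<^sub>R \<nu>) - 1 / 2..s (x + r *\<^sub>R \<nu>) + 1 / 2} r * f (x + r *\<^sub>R \<nu>) \<partial>lborel)"
      by (intro nn_integral_cong arg_cong2[where f = "(*)"]) (auto simp: s J_def indicator_def abs_le_iff)
    also have "\<dots> = (\<integral>\<^sup>+x. indicator {s x - 1 / 2..s x + 1 / 2} r * f x \<partial>lborel)"
    proof (rule nn_integral_lborel_translate[where f = "\<lambda>x. indicator {s x - 1 / 2..s x + 1 / 2} r * f x"])
      have "(\<lambda>x. indicator {s x - 1 / 2..s x + 1 / 2} r :: ennreal) = indicator {x. s x - 1 / 2 \<le> r \<and> r \<le> s x + 1 / 2}"
        by (auto simp: indicator_def fun_eq_iff)
      then have [measurable]: "(\<lambda>x. indicator {s x - 1 / 2..s x + 1 / 2} r :: ennreal) \<in> borel_measurable borel"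
        by simp
      show "(\<lambda>x. indicator {s x - 1 / 2..s x + 1 / 2} r * f x) \<in> borel_measurable borel" by measurable
    qed
    finally show "(\<integral>\<^sup>+x. indicator J x * f (x + r *\<^sub>R \<nu>) \<partial>lborel) =
        (\<integral>\<^sup>+x. indicator {s x - 1 / 2..s x + 1 / 2} r * f x \<partial>lborel)" .
  qed
  also have "\<dots> = (\<integral>\<^sup>+x. \<integral>\<^sup>+r. indicator {s x - 1 / 2..s x + 1 / 2} r * f x \<partial>lborel \<partial>lborel)"
  proof (rule lborel_pair.Fubini')
    have "(\<lambda>(x, r). indicator {s x - 1 / 2..s x + 1 / 2} r * f x) =
        (\<lambda>p. indicator {p \<in> space (borel \<Otimes>\<^sub>M borel). s (fst p) - 1 / 2 \<le> snd p \<and> snd p \<le> s (fst p) + 1 / 2} p * f (fst p))"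
      by (auto simp: indicator_def fun_eq_iff space_pair_measure)
    then show "(\<lambda>(x, r). indicator {s x - 1 / 2..s x + 1 / 2} r * f x) \<in> borel_measurable (lborel \<Otimes>\<^sub>M lborel)"
      by simp
  qed
  also have "\<dots> = (\<integral>\<^sup>+x. f x \<partial>lborel)"
    by (intro nn_integral_cong) (simp add: nn_integral_multc)
  finally show ?thesis unfolding a_def .
qed

section \<open>Surface measure as a sum over hyperplanes\<close>

text \<open>The measure before completion. Equality of measures and integrals of Borel functions are
  handled on Borel sets and then carried over to \<open>surface_measure\<close>.\<close>

definition surface_borel :: "'a::euclidean_space measure" where
  "surface_borel = measure_of UNIV (sets borel)
     (\<lambda>A. \<integral>\<^sup>+H. emeasure (hyperplane_lebesgue H) A \<partial>count_space hyperplanes)"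

lemma surface_measure_completion: "surface_measure = completion surface_borel"
  by (simp add: surface_measure_def surface_borel_def)

lemma sets_surface_borel [simp, measurable_cong]: "sets surface_borel = sets borel"
  unfolding surface_borel_def by (simp add: sets.sigma_sets_eq[of borel, simplified])

lemma space_surface_borel [simp]: "space surface_borel = UNIV"
  unfolding surface_borel_def by (simp add: space_measure_of_conv)

lemma space_surface_measure [simp]: "space surface_measure = UNIV"
  by (simp add: surface_measure_completion)

lemma sets_surface_measureI: "A \<in> sets borel \<Longrightarrow> A \<in> sets surface_measure"
  unfolding surface_measure_completion by (rule sets_completionI_sets) simp

text \<open>The family of hyperplanes is uncountable, but only a countable sum has to be exchanged
  with the integral over the counting measure, which monotone convergence permits.\<close>

lemma emeasure_surface_borel:
  assumes "A \<in> sets (borel :: 'a::euclidean_space measure)"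
  shows "emeasure surface_borel A = (\<integral>\<^sup>+H. emeasure (hyperplane_lebesgue H) A \<partial>count_space hyperplanes)"
  unfolding surface_borel_def
proof (rule emeasure_measure_of_sigma)
  show "sigma_algebra UNIV (sets (borel :: 'a measure))"
    using sets.sigma_algebra_axioms[of "borel :: 'a measure"] by simp
  show "positive (sets borel) (\<lambda>A. \<integral>\<^sup>+H. emeasure (hyperplane_lebesgue H) A \<partial>count_space (hyperplanes :: 'a set set))"
    by (simp add: positive_def)
  show "countably_additive (sets borel) (\<lambda>A. \<integral>\<^sup>+H. emeasure (hyperplane_lebesgue H) A \<partial>count_space (hyperplanes :: 'a set set))"
    unfolding countably_additive_def
  proof (intro allI impI)
    fix A :: "nat \<Rightarrow> 'a set" assume A: "range A \<subseteq> sets borel" "disjoint_family A"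
    have "(\<Sum>i. \<integral>\<^sup>+H. emeasure (hyperplane_lebesgue H) (A i) \<partial>count_space hyperplanes) =
        (\<integral>\<^sup>+H. (\<Sum>i. emeasure (hyperplane_lebesgue H) (A i)) \<partial>count_space hyperplanes)"
      by (rule nn_integral_suminf[symmetric]) simp
    also have "\<dots> = (\<integral>\<^sup>+H. emeasure (hyperplane_lebesgue H) (\<Union>i. A i) \<partial>count_space hyperplanes)"
      by (intro nn_integral_cong suminf_emeasure) (use A in auto)
    finally show "(\<Sum>i. \<integral>\<^sup>+H. emeasure (hyperplane_lebesgue H) (A i) \<partial>count_space hyperplanes) =
        (\<integral>\<^sup>+H. emeasure (hyperplane_lebesgue H) (\<Union>i. A i) \<partial>count_space hyperplanes)" .
  qed
qed (use assms in auto)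

lemma emeasure_surface_measure:
  assumes "A \<in> sets borel"
  shows "emeasure surface_measure A = (\<integral>\<^sup>+H. emeasure (hyperplane_lebesgue H) A \<partial>count_space hyperplanes)"
  using assms by (simp add: surface_measure_completion emeasure_surface_borel)

lemma negligible_affine:
  fixes S :: "'a::euclidean_space set"
  assumes "affine S" "aff_dim S < int DIM('a)"
  shows "negligible S"
  using assms aff_dim_nonempty_interior[of S] by (auto simp: negligible_convex_interior affine_imp_convex)

text \<open>The cylinder over \<open>A\<close> extends in the single direction \<nu>, hence lies in
  an affine space of dimension at most d - 1 and has no volume.\<close>

lemma hyperplane_lebesgue_lowdim:
  fixes A :: "'a::euclidean_space set"
  assumes H: "H \<in> hyperplanes" and A: "A \<in> sets borel" and dim: "aff_dim A \<le> int DIM('a) - 2"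
  shows "emeasure (hyperplane_lebesgue H) A = 0"
proof (cases "A = {}")
  case False
  then obtain a where a: "a \<in> A" by auto
  obtain \<nu> c where \<nu>: "norm \<nu> = 1" and Hc: "H = {x. \<nu> \<bullet> x = c}" using hyperplanes_cases[OF H] .
  let ?B = "{x. \<bar>\<nu> \<bullet> x - c\<bar> \<le> 1 / 2 \<and> x - (\<nu> \<bullet> x - c) *\<^sub>R \<nu> \<in> A}"
  have "?B \<subseteq> affine hull (insert (a + \<nu>) A)"
  proof
    fix x assume x: "x \<in> ?B"
    define s where "s = \<nu> \<bullet> x - c"
    have m: "a + \<nu> \<in> affine hull (insert (a + \<nu>) A)" "a \<in> affine hull (insert (a + \<nu>) A)"
      "x - s *\<^sub>R \<nu> \<in> affine hull (insert (a + \<nu>) A)"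
      using x a by (auto simp: s_def intro: hull_inc)
    have "(x - s *\<^sub>R \<nu>) + s *\<^sub>R ((a + \<nu>) - a) \<in> affine hull (insert (a + \<nu>) A)"
      by (rule mem_affine_3_minus[OF affine_affine_hull m(3) m(1) m(2)])
    then show "x \<in> affine hull (insert (a + \<nu>) A)" by simp
  qed
  moreover have "negligible (affine hull (insert (a + \<nu>) A))"
    by (rule negligible_affine) (use dim in \<open>simp_all add: aff_dim_insert\<close>)
  ultimately have "negligible ?B" by (rule negligible_subset[rotated])
  moreover have "?B \<in> sets borel" using A by measurable
  ultimately have "emeasure lborel ?B = 0"
    by (simp add: negligible_iff_null_sets null_sets_def)
  then show ?thesis unfolding Hc using emeasure_hyperplane_lebesgue[OF \<nu> A] by simp
qed simp

lemma surface_measure_lowdim: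
  fixes A :: "'a::euclidean_space set"
  assumes "A \<in> sets borel" "aff_dim A \<le> int DIM('a) - 2"
  shows "emeasure surface_measure A = 0"
  unfolding emeasure_surface_measure[OF assms(1)]
  using hyperplane_lebesgue_lowdim[OF _ assms] by (subst nn_integral_0_iff_AE) (auto simp: AE_count_space)

text \<open>If the dimension did not drop, the intersection would equal both hyperplanes. For d = 1
  distinct hyperplanes are distinct points, and the empty intersection has dimension -1, in
  accordance with the bound.\<close>

lemma aff_dim_hyperplanes_Int:
  fixes H H' :: "'a::euclidean_space set"
  assumes "H \<in> hyperplanes" "H' \<in> hyperplanes" "H \<noteq> H'"
  shows "aff_dim (H \<inter> H') \<le> int DIM('a) - 2"
proof -
  have aff: "affine H" "affine H'" "aff_dim H = int DIM('a) - 1" "aff_dim H' = int DIM('a) - 1"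
    using assms by (auto simp: hyperplanes_def)
  have "aff_dim (H \<inter> H') < aff_dim H"
  proof (rule ccontr)
    assume "\<not> ?thesis"
    then have eq: "aff_dim (H \<inter> H') = aff_dim H" by (metis aff_dim_subset inf_le1 order_le_less)
    then have "H \<inter> H' = H \<or> H \<inter> H' = {}"
      using aff by (metis affine_dim_equal affine_Int inf_le1)
    moreover have "H \<inter> H' = H' \<or> H \<inter> H' = {}"
      using aff eq by (metis affine_dim_equal affine_Int inf_le2)
    moreover have "H \<inter> H' \<noteq> {}"
    proof
      assume "H \<inter> H' = {}"
      then have "int DIM('a) = 0" using eq aff by simp
      then show False by simp
    qed
    ultimately show False using assms(3) by auto
  qed
  then show ?thesis using aff by linarith
qed

text \<open>Any other hyperplane measures only the part of \<open>A\<close> inside it, which has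
  codimension at least 2; so a single term of the sum survives.\<close>

lemma emeasure_surface_measure_hyperplane:
  fixes A :: "'a::euclidean_space set"
  assumes H: "H \<in> hyperplanes" and A: "A \<in> sets borel" "A \<subseteq> H"
  shows "emeasure surface_measure A = emeasure (hyperplane_lebesgue H) A"
proof -
  have "emeasure (hyperplane_lebesgue H') A = 0" if "H' \<in> hyperplanes" "H' \<noteq> H" for H'
  proof -
    obtain \<nu> c where \<nu>: "norm \<nu> = 1" and Hc: "H' = {x. \<nu> \<bullet> x = c}" using hyperplanes_cases[OF \<open>H' \<in> hyperplanes\<close>] .
    have clH': "closed H'" unfolding Hc by (rule closed_hyperplane)
    have sub: "A \<inter> H' \<subseteq> H \<inter> H'" using A by auto
    have "emeasure (hyperplane_lebesgue H') A = emeasure (hyperplane_lebesgue H') (A \<inter> H')"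
      unfolding Hc using A(1) \<nu> clH' unfolding Hc
      by (subst (1 2) emeasure_hyperplane_lebesgue[OF \<nu>])
         (auto simp: inner_diff_right dot_square_norm intro!: arg_cong[where f = "emeasure lborel"])
    also have "\<dots> = 0"
      by (rule hyperplane_lebesgue_lowdim[OF that(1)])
         (use A clH' aff_dim_subset[OF sub] aff_dim_hyperplanes_Int[OF H that(1)] that(2) in auto)
    finally show ?thesis .
  qed
  then show ?thesis unfolding emeasure_surface_measure[OF A(1)]
    using H by (subst nn_integral_count_space'[of "{H}"]) auto
qed

text \<open>The two measures agree only on subsets of the hyperplane, so they are compared after
  restriction to \<open>A\<close> by an indicator density.\<close>

lemma nn_integral_surface_measure_hyperplane:
  fixes f :: "'a::euclidean_space \<Rightarrow> ennreal"
  assumes H: "H \<in> hyperplanes" and A: "A \<in> sets borel" "A \<subseteq> H" and f: "f \<in> borel_measurable borel"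
  shows "(\<integral>\<^sup>+x. f x * indicator A x \<partial>surface_measure) = (\<integral>\<^sup>+x. f x * indicator A x \<partial>hyperplane_lebesgue H)"
proof -
  note [measurable] = A(1) f
  have "density surface_borel (indicator A) = density (hyperplane_lebesgue H) (indicator A)"
  proof (rule measure_eqI)
    fix X assume "X \<in> sets (density surface_borel (indicator A))"
    then have [measurable]: "X \<in> sets borel" by simp
    have "emeasure surface_borel (X \<inter> A) = emeasure (hyperplane_lebesgue H) (X \<inter> A)"
      using emeasure_surface_measure_hyperplane[OF H, of "X \<inter> A"] A
      by (auto simp: surface_measure_completion)
    then show "emeasure (density surface_borel (indicator A)) X = emeasure (density (hyperplane_lebesgue H) (indicator A)) X"
      by (simp add: emeasure_density nn_integral_indicator' indicator_inter_arith[symmetric] Int_commute)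
  qed simp
  then have "(\<integral>\<^sup>+x. f x \<partial>density surface_borel (indicator A)) = (\<integral>\<^sup>+x. f x \<partial>density (hyperplane_lebesgue H) (indicator A))"
    by simp
  then show ?thesis
    by (simp add: nn_integral_density surface_measure_completion nn_integral_completion mult.commute)
qed

lemma emeasure_surface_measure_finite:
  fixes A :: "'a::euclidean_space set"
  assumes H: "H \<in> hyperplanes" and A: "A \<in> sets borel" "A \<subseteq> H" "bounded A"
  shows "emeasure surface_measure A < \<infinity>"
proof -
  obtain \<nu> c where \<nu>: "norm \<nu> = 1" and Hc: "H = {x. \<nu> \<bullet> x = c}" using hyperplanes_cases[OF H] .
  obtain b where b: "\<And>x. x \<in> A \<Longrightarrow> norm x \<le> b" using A(3) by (auto simp: bounded_iff)
  have "{x. \<bar>\<nu> \<bullet> x - c\<bar> \<le> 1 / 2 \<and> x - (\<nu> \<bullet> x - c) *\<^sub>R \<nu> \<in> A} \<subseteq> cball 0 (b + 1 / 2)"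
  proof
    fix x assume x: "x \<in> {x. \<bar>\<nu> \<bullet> x - c\<bar> \<le> 1 / 2 \<and> x - (\<nu> \<bullet> x - c) *\<^sub>R \<nu> \<in> A}"
    have "norm x \<le> norm (x - (\<nu> \<bullet> x - c) *\<^sub>R \<nu>) + norm ((\<nu> \<bullet> x - c) *\<^sub>R \<nu>)"
      by (metis diff_add_cancel norm_triangle_ineq)
    also have "\<dots> \<le> b + 1 / 2" using x b \<nu> by (intro add_mono) auto
    finally show "x \<in> cball 0 (b + 1 / 2)" by simp
  qed
  then have "emeasure lborel {x. \<bar>\<nu> \<bullet> x - c\<bar> \<le> 1 / 2 \<and> x - (\<nu> \<bullet> x - c) *\<^sub>R \<nu> \<in> A} \<le> emeasure lborel (cball (0::'a) (b + 1 / 2))"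
    by (rule emeasure_mono) simp
  also have "\<dots> < \<infinity>" using emeasure_lborel_cball_finite by blast
  finally show ?thesis
    unfolding emeasure_surface_measure_hyperplane[OF H A(1,2)] unfolding Hc emeasure_hyperplane_lebesgue[OF \<nu> A(1)] .
qed

text \<open>A relatively interior point is the centre of a ball contained in the cylinder over
  \<open>D\<close>: the projection to the hyperplane is nonexpansive and maps the ball into a
  relative ball inside \<open>D\<close>.\<close>

lemma surface_measure_convex_pos:
  fixes D :: "'a::euclidean_space set"
  assumes D: "convex D" "D \<in> sets borel" and dim: "aff_dim D = int DIM('a) - 1"
  shows "emeasure surface_measure D > 0"
proof -
  have H: "affine hull D \<in> hyperplanes" using dim by (simp add: hyperplanes_def aff_dim_affine_hull)
  obtain \<nu> c where \<nu>: "norm \<nu> = 1" and Hc: "affine hull D = {x. \<nu> \<bullet> x = c}" using hyperplanes_cases[OF H] .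
  have "D \<noteq> {}" using dim by auto
  then obtain p where "p \<in> rel_interior D" using rel_interior_eq_empty[OF D(1)] by auto
  then obtain e where e: "e > 0" "ball p e \<inter> affine hull D \<subseteq> D" and "p \<in> D"
    unfolding mem_rel_interior_ball by auto
  have p: "\<nu> \<bullet> p = c" using \<open>p \<in> D\<close> hull_inc[of p D affine] Hc by auto
  have "ball p (min e (1 / 2)) \<subseteq> {x. \<bar>\<nu> \<bullet> x - c\<bar> \<le> 1 / 2 \<and> x - (\<nu> \<bullet> x - c) *\<^sub>R \<nu> \<in> D}"
  proof
    fix x assume x: "x \<in> ball p (min e (1 / 2))"
    define q where "q = x - (\<nu> \<bullet> x - c) *\<^sub>R \<nu>"
    have "\<bar>\<nu> \<bullet> x - c\<bar> = \<bar>\<nu> \<bullet> (x - p)\<bar>" by (simp add: inner_diff_right p)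
    also have "\<dots> \<le> norm (x - p)" using Cauchy_Schwarz_ineq2[of \<nu> "x - p"] \<nu> by simp
    finally have 1: "\<bar>\<nu> \<bullet> x - c\<bar> \<le> 1 / 2" using x by (simp add: dist_norm norm_minus_commute)
    have q: "\<nu> \<bullet> q = c" using \<nu> by (simp add: q_def inner_diff_right dot_square_norm)
    have "dist (closest_point (affine hull D) x) (closest_point (affine hull D) p) \<le> dist x p"
      by (rule closest_point_lipschitz) (use \<open>D \<noteq> {}\<close> in \<open>auto simp: affine_imp_convex\<close>)
    then have "dist q p \<le> dist x p"
      unfolding Hc closest_point_hyperplane[OF \<nu>] q_def p by simp
    then have "q \<in> ball p e" using x by (simp add: dist_commute)
    then have "q \<in> D" using e(2) q Hc by auto
    with 1 show "x \<in> {x. \<bar>\<nu> \<bullet> x - c\<bar> \<le> 1 / 2 \<and> x - (\<nu> \<bullet> x - c) *\<^sub>R \<nu> \<in> D}" by (simp add: q_def)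
  qed
  then have "emeasure lborel (ball p (min e (1 / 2))) \<le> emeasure lborel {x. \<bar>\<nu> \<bullet> x - c\<bar> \<le> 1 / 2 \<and> x - (\<nu> \<bullet> x - c) *\<^sub>R \<nu> \<in> D}"
    by (rule emeasure_mono) (use D(2) in measurable)
  moreover have "emeasure lborel (ball p (min e (1 / 2))) > 0" 
    using content_ball_pos[of "min e (1 / 2)" p] e(1) by (auto simp: measure_def zero_less_iff_neq_zero)
  ultimately show ?thesis
    unfolding emeasure_surface_measure_hyperplane[OF H D(2) hull_subset]
    unfolding Hc emeasure_hyperplane_lebesgue[OF \<nu> D(2)] by (rule less_le_trans[rotated])
qed


subsection \<open>Convex cells\<close>

text \<open>\<open>D\<close> lies in both closures and therefore in any hyperplane that separates
  the two cells; by its dimension it spans that hyperplane. The point is that the hyperplane depends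
  on \<open>D\<close> alone.\<close>

lemma separating_hyperplane_affine_hull:
  fixes K L D :: "'a::euclidean_space set"
  assumes K: "open K" "convex K" "K \<noteq> {}" and L: "open L" "convex L" "L \<noteq> {}" and "K \<inter> L = {}"
    and D: "D \<subseteq> closure K" "D \<subseteq> closure L" "aff_dim D = int DIM('a) - 1"
  obtains a b where "a \<noteq> 0" "affine hull D = {x. a \<bullet> x = b}" "K \<subseteq> {x. a \<bullet> x < b}" "L \<subseteq> {x. a \<bullet> x > b}"
proof -
  obtain a b where a: "a \<noteq> 0" and ab: "\<forall>x\<in>K. a \<bullet> x \<le> b" "\<forall>x\<in>L. a \<bullet> x \<ge> b"
    using separating_hyperplane_sets[OF K(2) L(2) K(3) L(3) \<open>K \<inter> L = {}\<close>] by blast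
  have "closure K \<subseteq> {x. a \<bullet> x \<le> b}"
    using ab by (intro closure_minimal closed_halfspace_le) auto
  moreover have "closure L \<subseteq> {x. a \<bullet> x \<ge> b}"
    using ab by (intro closure_minimal closed_halfspace_ge) auto
  ultimately have "D \<subseteq> {x. a \<bullet> x = b}" using D by force
  then have sub: "affine hull D \<subseteq> {x. a \<bullet> x = b}" by (intro hull_minimal affine_hyperplane)
  have "affine hull D = {x. a \<bullet> x = b}"
  proof (rule affine_dim_equal)
    show "affine hull D \<noteq> {}" using D(3) by auto
    show "aff_dim (affine hull D) = aff_dim {x. a \<bullet> x = b}"
      using a D(3) by (simp add: aff_dim_affine_hull)
  qed (use sub in \<open>auto simp: affine_hyperplane\<close>)
  moreover have "K \<subseteq> interior {x. a \<bullet> x \<le> b}" "L \<subseteq> interior {x. a \<bullet> x \<ge> b}"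
    by (rule interior_maximal; use ab K(1) L(1) in auto)+
  ultimately show thesis using that a by simp
qed

text \<open>Any two members are strictly separated by the same hyperplane, the affine hull of
  \<open>D\<close>, and a hyperplane has only two sides.\<close>

lemma at_most_two_convex_sides:
  fixes D :: "'a::euclidean_space set"
  assumes F: "\<And>K. K \<in> \<F> \<Longrightarrow> open K \<and> convex K \<and> K \<noteq> {} \<and> D \<subseteq> closure K" and disj: "disjoint \<F>"
    and D: "aff_dim D = int DIM('a) - 1"
    and KLM: "K \<in> \<F>" "L \<in> \<F>" "M \<in> \<F>" "K \<noteq> L" "K \<noteq> M"
  shows "L = M"
proof (rule ccontr)
  assume "L \<noteq> M"
  define H where "H = affine hull D"
  \<comment> \<open>Each separation comes with its own equation of the hyperplane, possibly with the
    opposite orientation. The segment condition states it without an equation; below, one fixed pair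
    (a, b) serves for all three cells.\<close>
  have cross: "x \<notin> H \<and> y \<notin> H \<and> (\<exists>z\<in>closed_segment x y. z \<in> H)"
    if A: "A \<in> \<F>" and B: "B \<in> \<F>" "A \<noteq> B" and xy: "x \<in> A" "y \<in> B" for A B x y
  proof -
    have "A \<inter> B = {}" using A B disj by (auto simp: pairwise_def disjnt_def)
    then obtain a b where ab: "a \<noteq> 0" "H = {x. a \<bullet> x = b}" "A \<subseteq> {x. a \<bullet> x < b}" "B \<subseteq> {x. a \<bullet> x > b}"
      using separating_hyperplane_affine_hull[of A B D] F[OF A] F[OF B(1)] D unfolding H_def by metis
    have "\<exists>z\<in>closed_segment x y. a \<bullet> z = b"
      by (rule connected_ivt_hyperplane[of "closed_segment x y" x y]) (use ab xy in auto)
    then show ?thesis using ab xy by auto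
  qed
  obtain k l m where klm: "k \<in> K" "l \<in> L" "m \<in> M" using F KLM by blast
  have "K \<inter> L = {}" using KLM disj by (auto simp: pairwise_def disjnt_def)
  then obtain a b where ab: "a \<noteq> 0" "H = {x. a \<bullet> x = b}"
    using separating_hyperplane_affine_hull[of K L D] F KLM D unfolding H_def by metis
  have one_side: "\<not> (a \<bullet> x < b \<and> a \<bullet> y < b)" "\<not> (a \<bullet> x > b \<and> a \<bullet> y > b)"
    if "z \<in> closed_segment x y" "z \<in> H" for x y z
  proof -
    have z: "a \<bullet> z = b" using that ab by auto
    show "\<not> (a \<bullet> x < b \<and> a \<bullet> y < b)"
      using closed_segment_subset[of x "{x. a \<bullet> x < b}" y] that(1) z convex_halfspace_lt[of a b] by auto
    show "\<not> (a \<bullet> x > b \<and> a \<bullet> y > b)"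
      using closed_segment_subset[of x "{x. a \<bullet> x > b}" y] that(1) z convex_halfspace_gt[of b a] by auto
  qed
  have sgn: "\<not> (a \<bullet> x < b \<and> a \<bullet> y < b) \<and> \<not> (a \<bullet> x > b \<and> a \<bullet> y > b) \<and> a \<bullet> x \<noteq> b \<and> a \<bullet> y \<noteq> b"
    if "A \<in> \<F>" "B \<in> \<F>" "A \<noteq> B" "x \<in> A" "y \<in> B" for A B x y
    using cross[OF that] one_side[of _ x y] ab(2) by blast
  show False
    using sgn[OF KLM(1,2,4) klm(1,2)] sgn[OF KLM(1,3,5) klm(1,3)] sgn[OF KLM(2,3) \<open>L \<noteq> M\<close> klm(2,3)] by linarith
qed

text \<open>Inside a ball, almost every broken line \<open>p z q\<close> misses sets of codimension at least 2.\<close>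

lemma connected_subset_closed_lowdim:
  fixes \<Omega> U V :: "'a::euclidean_space set"
  assumes C: "open C" "connected C" and UV: "closed U" "closed V" "C \<subseteq> U \<union> V"
    and \<D>: "finite \<D>" "\<And>D. D \<in> \<D> \<Longrightarrow> aff_dim D \<le> int DIM('a) - 2" "C \<inter> U \<inter> V \<subseteq> \<Union>\<D>"
    and ne: "C \<inter> interior U \<noteq> {}"
  shows "C \<subseteq> U"
proof -
  \<comment> \<open>The union of all lines from \<open>p\<close> through a set of codimension at
    least 2 lies in an affine space of dimension at most d - 1. A generic vertex avoids it.\<close>
  have neg_insert: "negligible (\<Union>D\<in>\<D>. affine hull (insert p D))" for p
  proof (rule negligible_Union)
    fix T assume "T \<in> (\<lambda>D. affine hull (insert p D)) ` \<D>"
    then obtain D where D: "D \<in> \<D>" "T = affine hull (insert p D)" by auto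
    have "aff_dim T \<le> aff_dim D + 1" unfolding D(2) by (simp add: aff_dim_insert)
    then show "negligible T" using \<D>(2)[OF D(1)] D(2) by (intro negligible_affine) auto
  qed (use \<D> in auto)
  have core: "ball x r \<subseteq> U" if B: "ball x r \<subseteq> C" and p: "p \<in> ball x r" "p \<in> U" "p \<notin> V" for x r p
  proof (rule ccontr)
    assume "\<not> ball x r \<subseteq> U"
    then obtain q where q: "q \<in> ball x r" "q \<notin> U" by blast
    have "\<not> negligible (ball x r)" using p(1) by (intro open_not_negligible) blast+
    then obtain z where z: "z \<in> ball x r" "z \<notin> (\<Union>D\<in>\<D>. affine hull (insert p D))" "z \<notin> (\<Union>D\<in>\<D>. affine hull (insert q D))"
      using negligible_subset[OF negligible_Un[OF neg_insert[of p] neg_insert[of q]]] by blast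
    have seg: "w \<notin> U \<inter> V" if s: "s \<in> ball x r" "s \<notin> U \<inter> V" and ws: "w \<in> closed_segment s z" and zs: "z \<notin> (\<Union>D\<in>\<D>. affine hull (insert s D))" for s w
    proof
      \<comment> \<open>A crossing point \<open>w\<close> would lie in some D, and z lies on the
        line through s and w, hence in the affine hull excluded by the choice of z.\<close>
      assume w: "w \<in> U \<inter> V"
      have "closed_segment s z \<subseteq> ball x r" using s(1) z(1) by (intro closed_segment_subset) auto
      then obtain D where D: "D \<in> \<D>" "w \<in> D" using w ws B \<D>(3) by blast
      obtain t where t: "w = (1 - t) *\<^sub>R s + t *\<^sub>R z" using ws by (auto simp: in_segment)
      have "t \<noteq> 0" using t w s(2) by auto
      have "s + (1 / t) *\<^sub>R (w - s) \<in> affine hull (insert s D)"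
        using D by (intro mem_affine_3_minus[OF affine_affine_hull]) (auto intro: hull_inc)
      moreover have "s + (1 / t) *\<^sub>R (w - s) = z" using \<open>t \<noteq> 0\<close> unfolding t by (simp add: algebra_simps)
      ultimately show False using zs D by auto
    qed
    define S where "S = closed_segment p z \<union> closed_segment q z"
    have "connected S" unfolding S_def by (rule connected_Un) auto
    moreover have "S \<subseteq> ball x r" unfolding S_def using p q z by (intro Un_least closed_segment_subset) auto
    then have "S \<subseteq> U \<union> V" using B UV by blast
    moreover have "U \<inter> V \<inter> S = {}" using seg[of p] seg[of q] p q z unfolding S_def by blast
    moreover have "U \<inter> S \<noteq> {}" using p by (auto simp: S_def)
    moreover have "q \<in> V" using q B UV(3) by blast
    then have "V \<inter> S \<noteq> {}" by (auto simp: S_def)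
    ultimately show False using UV unfolding connected_closed by blast
  qed
  \<comment> \<open>The interior of \<open>U\<close> is thus relatively clopen in \<open>C\<close>:
    around a point of its closure, a generic nearby point of it avoids the exceptional sets, hence
    \<open>V\<close>, and \<open>core\<close> then fills the whole ball.\<close>
  have "C \<subseteq> interior U \<union> - closure (interior U)"
  proof
    fix x assume x: "x \<in> C"
    show "x \<in> interior U \<union> - closure (interior U)"
    proof (cases "x \<in> closure (interior U)")
      case True
      obtain r where r: "r > 0" "ball x r \<subseteq> C" using C(1) x by (auto simp: open_contains_ball)
      have "ball x r \<inter> interior U \<noteq> {}" 
        using True centre_in_ball[of x r] r(1) open_Int_closure_eq_empty[of "ball x r" "interior U"] by blast
      then have "\<not> negligible (ball x r \<inter> interior U)" by (intro open_not_negligible) auto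
      then obtain p where "p \<in> ball x r \<inter> interior U" "p \<notin> (\<Union>D\<in>\<D>. affine hull (insert x D))"
        using negligible_subset[OF neg_insert[of x]] by blast
      then have p: "p \<in> ball x r" "p \<in> U" "p \<notin> \<Union>\<D>"
        using interior_subset by (auto dest: hull_inc[of _ "insert x _" affine, OF insertI2])
      then have "ball x r \<subseteq> U" using core[OF r(2) p(1,2)] \<D>(3) r(2) by blast
      then show ?thesis using r(1) by (auto simp: mem_interior)
    qed auto
  qed
  moreover have "interior U \<inter> - closure (interior U) \<inter> C = {}" using closure_subset[of "interior U"] by auto
  ultimately have "- closure (interior U) \<inter> C = {}"
    using C(2) ne unfolding connected_def by (metis Int_commute open_interior open_Compl closed_closure)
  then show ?thesis using \<open>C \<subseteq> interior U \<union> - closure (interior U)\<close> interior_subset by blast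
qed


subsection \<open>Admissible meshes\<close>

lemma admissible_meshD:
  assumes "admissible_mesh \<Omega> \<Gamma>D \<Gamma>N \<T>"
  shows "finite (cells \<T>)" "disjoint (cells \<T>)"
    "\<And>K. K \<in> cells \<T> \<Longrightarrow> K \<noteq> {} \<and> open K \<and> convex K \<and> K \<subseteq> \<Omega>"
    "closure (\<Union>(cells \<T>)) = closure \<Omega>" "finite (edges \<T>)"
    "\<And>\<sigma>. \<sigma> \<in> edges \<T> \<Longrightarrow> \<sigma> \<subseteq> closure \<Omega> \<and> (\<exists>H\<in>hyperplanes. \<sigma> \<subseteq> H) \<and>
        emeasure surface_measure \<sigma> > 0 \<and> closure \<sigma> - \<sigma> \<in> null_sets surface_measure"
    "edges \<T> = (\<Union>K\<in>cells \<T>. edges_of \<T> K)"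
    "\<And>K. K \<in> cells \<T> \<Longrightarrow> frontier K = (\<Union>\<sigma>\<in>edges_of \<T> K. closure \<sigma>)"
    "\<And>K L. K \<in> cells \<T> \<Longrightarrow> L \<in> cells \<T> \<Longrightarrow> K \<noteq> L \<Longrightarrow>
        emeasure surface_measure (closure K \<inter> closure L) = 0 \<or> (\<exists>\<sigma>. interface \<T> K L \<sigma>)"
    "\<And>K L \<sigma>. interface \<T> K L \<sigma> \<Longrightarrow> center \<T> K \<noteq> center \<T> L"
    "edges \<T> = int_edges \<T> \<union> ext_edges \<Omega> \<T>"
    "\<And>\<sigma>. \<sigma> \<in> int_edges \<T> \<Longrightarrow> \<sigma> \<inter> frontier \<Omega> \<in> null_sets surface_measure"
    "\<And>\<sigma>. \<sigma> \<in> ext_edges \<Omega> \<T> \<Longrightarrow> \<sigma> \<subseteq> \<Gamma>D \<or> \<sigma> \<subseteq> \<Gamma>N"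
proof -
  note a = assms[unfolded admissible_mesh_def]
  show "finite (cells \<T>)" "disjoint (cells \<T>)" "closure (\<Union>(cells \<T>)) = closure \<Omega>" "finite (edges \<T>)"
    "edges \<T> = (\<Union>K\<in>cells \<T>. edges_of \<T> K)" "edges \<T> = int_edges \<T> \<union> ext_edges \<Omega> \<T>"
    by (insert a, elim conjE, assumption)+
  show "\<And>K. K \<in> cells \<T> \<Longrightarrow> K \<noteq> {} \<and> open K \<and> convex K \<and> K \<subseteq> \<Omega>" using a by (elim conjE) simp
  show "\<And>\<sigma>. \<sigma> \<in> edges \<T> \<Longrightarrow> \<sigma> \<subseteq> closure \<Omega> \<and> (\<exists>H\<in>hyperplanes. \<sigma> \<subseteq> H) \<and>
        emeasure surface_measure \<sigma> > 0 \<and> closure \<sigma> - \<sigma> \<in> null_sets surface_measure"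
    using a by (elim conjE) (drule bspec, assumption)
  show "\<And>K. K \<in> cells \<T> \<Longrightarrow> frontier K = (\<Union>\<sigma>\<in>edges_of \<T> K. closure \<sigma>)"
    by (insert a, elim conjE, drule (1) bspec, assumption)
  show "\<And>K L. K \<in> cells \<T> \<Longrightarrow> L \<in> cells \<T> \<Longrightarrow> K \<noteq> L \<Longrightarrow>
        emeasure surface_measure (closure K \<inter> closure L) = 0 \<or> (\<exists>\<sigma>. interface \<T> K L \<sigma>)"
    by (insert a, elim conjE, drule (1) bspec, drule (1) bspec, drule (1) mp,
        erule disjE, erule disjI1, rule disjI2, erule ex1_implies_ex)
  show "\<And>K L \<sigma>. interface \<T> K L \<sigma> \<Longrightarrow> center \<T> K \<noteq> center \<T> L"
    by (insert a, elim conjE, drule spec, drule spec, drule spec, drule (1) mp, erule conjunct1)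
  show "\<And>\<sigma>. \<sigma> \<in> int_edges \<T> \<Longrightarrow> \<sigma> \<inter> frontier \<Omega> \<in> null_sets surface_measure"
    by (insert a, elim conjE, drule (1) bspec, assumption)
  show "\<And>\<sigma>. \<sigma> \<in> ext_edges \<Omega> \<T> \<Longrightarrow> \<sigma> \<subseteq> \<Gamma>D \<or> \<sigma> \<subseteq> \<Gamma>N"
    by (insert a, elim conjE, drule (1) bspec, assumption)
qed

section \<open>Edges, neighbours and transmissibilities of a mesh\<close>

context
  fixes \<Omega> \<Gamma>D \<Gamma>N :: "'a::euclidean_space set" and \<T> :: "'a mesh"
  assumes mesh: "admissible_mesh \<Omega> \<Gamma>D \<Gamma>N \<T>"
begin

lemma edges_of_subset: "K \<in> cells \<T> \<Longrightarrow> edges_of \<T> K \<subseteq> edges \<T>"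
  using admissible_meshD(7)[OF mesh] by auto

text \<open>An edge differs from its closure by a null set of the completed measure.\<close>

lemma edge_sets: "\<sigma> \<in> edges \<T> \<Longrightarrow> \<sigma> \<in> sets surface_measure"
proof -
  assume "\<sigma> \<in> edges \<T>"
  then have "closure \<sigma> - \<sigma> \<in> sets surface_measure" using admissible_meshD(6)[OF mesh] by blast
  then have "closure \<sigma> - (closure \<sigma> - \<sigma>) \<in> sets surface_measure"
    using sets_surface_measureI[of "closure \<sigma>"] sets.Diff[of "closure \<sigma>" surface_measure "closure \<sigma> - \<sigma>"] by auto
  moreover have "closure \<sigma> - (closure \<sigma> - \<sigma>) = \<sigma>" using closure_subset[of \<sigma>] by auto
  ultimately show ?thesis by simp
qed

lemma edge_hyperplane:
  assumes "\<sigma> \<in> edges \<T>"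
  obtains H where "H \<in> hyperplanes" "closure \<sigma> \<subseteq> H"
proof -
  obtain H where H: "H \<in> hyperplanes" "\<sigma> \<subseteq> H" using admissible_meshD(6)[OF mesh assms] by blast
  moreover have "closed H" using H(1) by (auto simp: hyperplanes_def intro: affine_closed)
  ultimately show thesis using that closure_minimal by blast
qed

text \<open>The hyperplane gives the upper bound; positive surface measure excludes codimension
  2.\<close>

lemma aff_dim_closure_edge:
  assumes "\<sigma> \<in> edges \<T>"
  shows "aff_dim (closure \<sigma>) = int DIM('a) - 1"
proof -
  obtain H where H: "H \<in> hyperplanes" "closure \<sigma> \<subseteq> H" using edge_hyperplane[OF assms] .
  have "aff_dim (closure \<sigma>) \<le> int DIM('a) - 1"
    using aff_dim_subset[OF H(2)] H(1) by (simp add: hyperplanes_def)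
  moreover have "0 < emeasure surface_measure (closure \<sigma>)"
    using admissible_meshD(6)[OF mesh assms] emeasure_mono[OF closure_subset sets_surface_measureI, of \<sigma>]
    by (auto intro: less_le_trans)
  then have "\<not> aff_dim (closure \<sigma>) \<le> int DIM('a) - 2"
    using surface_measure_lowdim[of "closure \<sigma>"] by auto
  ultimately show ?thesis by linarith
qed

lemma emeasure_edge_finite:
  assumes "\<sigma> \<in> edges \<T>" "bounded \<Omega>"
  shows "emeasure surface_measure (closure \<sigma>) < \<infinity>" "emeasure surface_measure \<sigma> < \<infinity>"
proof -
  obtain H where H: "H \<in> hyperplanes" "closure \<sigma> \<subseteq> H" using edge_hyperplane[OF assms(1)] .
  have "bounded (closure \<sigma>)"
    using admissible_meshD(6)[OF mesh assms(1)] assms(2) by (meson bounded_closure bounded_subset)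
  then show 1: "emeasure surface_measure (closure \<sigma>) < \<infinity>"
    using H by (intro emeasure_surface_measure_finite) auto
  show "emeasure surface_measure \<sigma> < \<infinity>"
    using emeasure_mono[OF closure_subset sets_surface_measureI, of \<sigma>] 1 by (auto intro: le_less_trans)
qed

lemma closure_edge_subset: "K \<in> cells \<T> \<Longrightarrow> \<sigma> \<in> edges_of \<T> K \<Longrightarrow> closure \<sigma> \<subseteq> closure K"
  using admissible_meshD(8)[OF mesh, of K] by (auto simp: frontier_def)

lemma interface_sym: "interface \<T> K L \<sigma> \<Longrightarrow> interface \<T> L K \<sigma>"
  by (auto simp: interface_def)

lemma edge_two_sides:
  assumes "\<sigma> \<in> edges \<T>" "K \<in> cells \<T>" "L \<in> cells \<T>" "M \<in> cells \<T>"
    "closure \<sigma> \<subseteq> closure K" "closure \<sigma> \<subseteq> closure L" "closure \<sigma> \<subseteq> closure M" "K \<noteq> L" "K \<noteq> M"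
  shows "L = M"
proof (rule at_most_two_convex_sides)
  show "disjoint {K, L, M}"
    by (rule pairwise_subset[OF admissible_meshD(2)[OF mesh]]) (use assms in auto)
  show "open A \<and> convex A \<and> A \<noteq> {} \<and> closure \<sigma> \<subseteq> closure A" if "A \<in> {K, L, M}" for A
    using admissible_meshD(3)[OF mesh] that assms by auto
qed (use assms aff_dim_closure_edge in auto)

lemma interface_closure:
  assumes "interface \<T> K L \<sigma>"
  shows "K \<in> cells \<T>" "L \<in> cells \<T>" "K \<noteq> L" "\<sigma> \<in> edges \<T>" "closure \<sigma> \<subseteq> closure K" "closure \<sigma> \<subseteq> closure L"
proof -
  have i: "K \<in> cells \<T>" "L \<in> cells \<T>" "K \<noteq> L" "\<sigma> \<in> edges_of \<T> K" "closure K \<inter> closure L = closure \<sigma>"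
    using assms unfolding interface_def by auto
  show "K \<in> cells \<T>" "L \<in> cells \<T>" "K \<noteq> L" by fact+
  show "\<sigma> \<in> edges \<T>" using edges_of_subset[OF i(1)] i(4) by blast
  show "closure \<sigma> \<subseteq> closure K" "closure \<sigma> \<subseteq> closure L" unfolding i(5)[symmetric] by blast+
qed

lemma interface_unique:
  assumes "interface \<T> K L \<sigma>" "interface \<T> K L' \<sigma>"
  shows "L = L'"
proof -
  note a = interface_closure[OF assms(1)] and b = interface_closure[OF assms(2)]
  show ?thesis by (rule edge_two_sides[OF a(4,1,2) b(2) a(5,6) b(6) a(3) b(3)])
qed

lemma neighbour_eqI: "interface \<T> K L \<sigma> \<Longrightarrow> neighbour \<T> K \<sigma> = L"
  unfolding neighbour_def by (rule the_equality, assumption) (rule interface_unique)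

text \<open>An interior edge is witnessed by some pair of cells, which might not contain
  \<open>K\<close>. But a third cell at the same edge is impossible, so \<open>K\<close> belongs to
  the pair.\<close>

lemma interface_neighbour:
  assumes K: "K \<in> cells \<T>" "\<sigma> \<in> edges_of \<T> K" and \<sigma>: "\<sigma> \<in> int_edges \<T>"
  shows "interface \<T> K (neighbour \<T> K \<sigma>) \<sigma>"
proof -
  obtain A B where AB: "interface \<T> A B \<sigma>" using \<sigma> by (auto simp: int_edges_def)
  have "\<exists>L. interface \<T> K L \<sigma>"
  proof (cases "K = A")
    case False
    note a = interface_closure[OF AB]
    have "K = B"
      by (rule edge_two_sides[OF a(4,1) K(1) a(2,5) closure_edge_subset[OF K] a(6) False[symmetric] a(3)])
    then show ?thesis using interface_sym[OF AB] by blast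
  qed (use AB in blast)
  then show ?thesis using neighbour_eqI by auto
qed

lemma edge_dist_nonneg: "0 \<le> edge_dist \<T> K \<sigma>"
  by (simp add: edge_dist_def infdist_nonneg)

lemma mesh_network:
  assumes "bounded \<Omega>"
  shows "network (cells \<T>) (edges_of \<T>) (int_edges \<T>) (neighbour \<T>) (transmissibility \<T>) (measure lebesgue)"
proof
  fix K assume K: "K \<in> cells \<T>"
  show "finite (edges_of \<T> K)"
    using finite_subset[OF edges_of_subset[OF K] admissible_meshD(5)[OF mesh]] .
  have "\<not> negligible K" using admissible_meshD(3)[OF mesh K] by (intro open_not_negligible) auto
  moreover have "K \<in> lmeasurable"
    using admissible_meshD(3)[OF mesh K] bounded_subset[OF assms] by (intro lmeasurable_open) auto
  ultimately show "0 < measure lebesgue K"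
    by (simp add: negligible_iff_measure zero_less_measure_iff)
  fix \<sigma> assume \<sigma>: "\<sigma> \<in> edges_of \<T> K"
  show "0 \<le> transmissibility \<T> K \<sigma>" by (simp add: transmissibility_def edge_dist_nonneg)
  assume i: "\<sigma> \<in> int_edges \<T>"
  have int: "interface \<T> K (neighbour \<T> K \<sigma>) \<sigma>" using interface_neighbour[OF K \<sigma> i] .
  show "neighbour \<T> K \<sigma> \<in> cells \<T>" "\<sigma> \<in> edges_of \<T> (neighbour \<T> K \<sigma>)"
    using int by (auto simp: interface_def)
  show nn: "neighbour \<T> (neighbour \<T> K \<sigma>) \<sigma> = K" using neighbour_eqI[OF interface_sym[OF int]] .
  show "transmissibility \<T> (neighbour \<T> K \<sigma>) \<sigma> = transmissibility \<T> K \<sigma>"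
    using i nn by (simp add: transmissibility_def edge_dist_def dist_commute)
qed (rule admissible_meshD(1)[OF mesh])

text \<open>This is where mesh regularity enters. If the centre of a cell lay on an exterior edge,
  the distance would be 0 and the quotient 0 as well, cutting the connection to the Dirichlet
  data.\<close>

lemma transmissibility_pos:
  assumes reg: "regular_mesh \<T>" and bd: "bounded \<Omega>" and K: "K \<in> cells \<T>" and \<sigma>: "\<sigma> \<in> edges_of \<T> K"
  shows "0 < transmissibility \<T> K \<sigma>"
proof -
  have E: "\<sigma> \<in> edges \<T>" using edges_of_subset[OF K] \<sigma> by auto
  have "0 < measure surface_measure \<sigma>"
    using admissible_meshD(6)[OF mesh E] emeasure_edge_finite(2)[OF E bd]
    by (simp add: measure_def enn2real_positive_iff)
  moreover have "0 < edge_dist \<T> K \<sigma>"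
  proof (cases "\<sigma> \<in> int_edges \<T>")
    case True
    then show ?thesis using admissible_meshD(10)[OF mesh interface_neighbour[OF K \<sigma> True]]
      by (simp add: edge_dist_def)
  next
    case False
    obtain \<xi> where \<xi>: "\<xi> > 0" "infdist (center \<T> K) \<sigma> \<ge> \<xi> * diameter K"
      using reg K \<sigma> unfolding regular_mesh_def by blast
    have Kp: "K \<noteq> {}" "open K" "bounded K"
      using admissible_meshD(3)[OF mesh K] bounded_subset[OF bd] by auto
    then obtain x r where "ball x r \<subseteq> K" "r > 0" unfolding open_contains_ball by blast
    then have "diameter (ball x r) \<le> diameter K" using Kp by (intro diameter_subset) auto
    then have "diameter K > 0" using \<open>r > 0\<close> by (simp add: diameter_ball)
    then show ?thesis using \<xi> False by (auto simp: edge_dist_def intro: less_le_trans[OF mult_pos_pos])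
  qed
  ultimately show ?thesis by (simp add: transmissibility_def)
qed

section \<open>Connection of the cells to the Dirichlet boundary\<close>

text \<open>The common part of two closures is convex. In dimension d - 1 it would have positive
  surface measure and hence come from an edge; in dimension d it would have interior points, but its
  interior is the intersection of the disjoint cells.\<close>

lemma no_interface_lowdim:
  assumes K: "K \<in> cells \<T>" "L \<in> cells \<T>" "K \<noteq> L" and no: "\<not> (\<exists>\<sigma>. interface \<T> K L \<sigma>)"
  shows "aff_dim (closure K \<inter> closure L) \<le> int DIM('a) - 2"
proof (rule ccontr)
  let ?D = "closure K \<inter> closure L"
  assume "\<not> ?thesis"
  then have "aff_dim ?D \<ge> int DIM('a) - 1" by linarith
  moreover have "aff_dim ?D \<le> int DIM('a)" by (rule aff_dim_le_DIM)
  ultimately consider "aff_dim ?D = int DIM('a) - 1" | "aff_dim ?D = int DIM('a)" by linarith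
  then show False
  proof cases
    case 1
    have "convex ?D" using K admissible_meshD(3)[OF mesh] by (intro convex_Int convex_closure) auto
    then have "emeasure surface_measure ?D > 0" by (rule surface_measure_convex_pos) (use 1 in auto)
    then show False using admissible_meshD(9)[OF mesh K] no by auto
  next
    case 2
    have KL: "open K" "convex K" "open L" "convex L" using K admissible_meshD(3)[OF mesh] by auto
    have "interior ?D = K \<inter> L" using KL by (simp add: interior_Int convex_interior_closure interior_open)
    also have "\<dots> = {}" using admissible_meshD(2)[OF mesh] K by (auto simp: pairwise_def disjnt_def)
    finally have "interior ?D = {}" .
    moreover have "convex ?D" using KL by (intro convex_Int convex_closure)
    moreover have "rel_interior ?D = interior ?D" using 2 aff_dim_eq_full[of ?D] by (intro rel_interior_interior) simp
    ultimately have "?D = {}" using rel_interior_eq_empty[of ?D] by simp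
    then show False using 2 by simp
  qed
qed

text \<open>The cells that reach no Dirichlet edge share no edge with the others, so their closures
  meet those of the others in codimension at least 2 and must cover the whole component of
  \<open>K0\<close>. The frontier of this component then lies in the closures of these cells, none
  of which has a Dirichlet edge, and its Dirichlet part is a null set.\<close>

lemma cells_reach_dirichlet:
  assumes bd: "bounded \<Omega>" and op: "open \<Omega>" and fr: "frontier \<Omega> = \<Gamma>D \<union> \<Gamma>N" "\<Gamma>D \<inter> \<Gamma>N = {}"
    and reg: "regular_mesh \<T>" and dir: "dirichlet_on_components \<Omega> \<Gamma>D" and K0: "K0 \<in> cells \<T>"
  shows "\<exists>n. network.reach (edges_of \<T>) (int_edges \<T>) {\<sigma> \<in> ext_edges \<Omega> \<T>. \<sigma> \<subseteq> \<Gamma>D} (neighbour \<T>)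
    (transmissibility \<T>) n K0"
proof (rule ccontr)
  interpret network "cells \<T>" "edges_of \<T>" "int_edges \<T>" "{\<sigma> \<in> ext_edges \<Omega> \<T>. \<sigma> \<subseteq> \<Gamma>D}" "neighbour \<T>"
    "transmissibility \<T>" "measure lebesgue" by (rule mesh_network[OF bd])
  assume "\<not> (\<exists>n. reach n K0)"
  define S where "S = {K \<in> cells \<T>. \<not> (\<exists>n. reach n K)}"
  have S: "S \<subseteq> cells \<T>" "K0 \<in> S" using K0 \<open>\<not> (\<exists>n. reach n K0)\<close> by (auto simp: S_def)
  have finS: "finite S" "finite (cells \<T> - S)" using finite_subset[OF S(1)] finite_C by auto
  have noint: "\<not> (\<exists>\<sigma>. interface \<T> K L \<sigma>)" if K: "K \<in> S" and L: "L \<in> cells \<T> - S" for K L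
  proof
    assume "\<exists>\<sigma>. interface \<T> K L \<sigma>"
    then obtain \<sigma> where \<sigma>: "interface \<T> K L \<sigma>" by blast
    obtain n where n: "reach n L" using L by (auto simp: S_def)
    have "\<sigma> \<in> int_edges \<T>" "\<sigma> \<in> edges_of \<T> K" using \<sigma> interface_closure[OF \<sigma>] by (auto simp: int_edges_def interface_def)
    then have "reach (Suc n) K"
      using n transmissibility_pos[OF reg bd interface_closure(1)[OF \<sigma>]] neighbour_eqI[OF \<sigma>] by auto
    then show False using K unfolding S_def by blast
  qed
  have nodir: "\<not> (\<sigma> \<in> ext_edges \<Omega> \<T> \<and> \<sigma> \<subseteq> \<Gamma>D) \<or> \<sigma> \<in> int_edges \<T>" if "K \<in> S" "\<sigma> \<in> edges_of \<T> K" for K \<sigma>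
  proof (rule ccontr)
    assume "\<not> ?thesis"
    then have "reach 0 K" using that S transmissibility_pos[OF reg bd _ that(2)] by auto
    then show False using that unfolding S_def by blast
  qed
  define U where "U = (\<Union>K\<in>S. closure K)"
  define V where "V = (\<Union>K\<in>cells \<T> - S. closure K)"
  have UV: "closed U" "closed V" using finS by (auto simp: U_def V_def)
  have "\<Union>(cells \<T>) \<subseteq> U \<union> V"
  proof
    fix x assume "x \<in> \<Union>(cells \<T>)"
    then obtain K where K: "K \<in> cells \<T>" "x \<in> K" by blast
    then have "x \<in> closure K" using closure_subset by blast
    with K(1) show "x \<in> U \<union> V" unfolding U_def V_def by (cases "K \<in> S") blast+
  qed
  then have "closure (\<Union>(cells \<T>)) \<subseteq> U \<union> V" using UV by (intro closure_minimal closed_Un)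
  then have cover: "\<Omega> \<subseteq> U \<union> V"
    unfolding admissible_meshD(4)[OF mesh] using closure_subset[of \<Omega>] by (rule order_trans[rotated])
  have K0p: "K0 \<noteq> {}" "open K0" "convex K0" "K0 \<subseteq> \<Omega>" using admissible_meshD(3)[OF mesh K0] by auto
  then obtain x0 where "x0 \<in> K0" by auto
  define C where "C = connected_component_set \<Omega> x0"
  have C: "C \<in> components \<Omega>" using \<open>x0 \<in> K0\<close> K0p by (auto simp: C_def components_def)
  have K0C: "K0 \<subseteq> C" unfolding C_def
    by (rule connected_component_maximal) (use \<open>x0 \<in> K0\<close> K0p in \<open>auto intro: convex_connected\<close>)
  have "K0 \<subseteq> U" using S(2) closure_subset by (auto simp: U_def)
  have "C \<subseteq> U"
  proof (rule connected_subset_closed_lowdim)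
    show "open C" "connected C" using C op by (auto intro: open_components in_components_connected)
    show "C \<subseteq> U \<union> V" using in_components_subset[OF C] cover by auto
    show "C \<inter> interior U \<noteq> {}"
      using interior_maximal[OF \<open>K0 \<subseteq> U\<close> K0p(2)] K0C \<open>x0 \<in> K0\<close> by auto
    show "finite ((\<lambda>(K, L). closure K \<inter> closure L) ` (S \<times> (cells \<T> - S)))" using finS by blast
    show "C \<inter> U \<inter> V \<subseteq> \<Union>((\<lambda>(K, L). closure K \<inter> closure L) ` (S \<times> (cells \<T> - S)))"
      by (auto simp: U_def V_def)
    show "aff_dim D \<le> int DIM('a) - 2" if D: "D \<in> (\<lambda>(K, L). closure K \<inter> closure L) ` (S \<times> (cells \<T> - S))" for D
    proof -
      obtain K L where "K \<in> S" "L \<in> cells \<T> - S" "D = closure K \<inter> closure L" using D by auto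
      then show ?thesis using no_interface_lowdim[of K L] noint[of K L] S by auto
    qed
  qed (use UV in auto)
  then have "closure C \<subseteq> U" using UV by (intro closure_minimal)
  have frC: "frontier C \<subseteq> frontier \<Omega>"
    using frontier_of_components_subset[OF C] .
  have ext: "\<Gamma>D \<inter> closure \<sigma> \<subseteq> (\<sigma> \<inter> frontier \<Omega>) \<union> (closure \<sigma> - \<sigma>)" "\<sigma> \<in> int_edges \<T> \<or> \<Gamma>D \<inter> closure \<sigma> \<subseteq> closure \<sigma> - \<sigma>"
    if "K \<in> S" "\<sigma> \<in> edges_of \<T> K" for K \<sigma>
  proof -
    show "\<Gamma>D \<inter> closure \<sigma> \<subseteq> (\<sigma> \<inter> frontier \<Omega>) \<union> (closure \<sigma> - \<sigma>)" using fr by auto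
    show "\<sigma> \<in> int_edges \<T> \<or> \<Gamma>D \<inter> closure \<sigma> \<subseteq> closure \<sigma> - \<sigma>"
    proof (cases "\<sigma> \<in> int_edges \<T>")
      case ni: False
      have "\<sigma> \<in> edges \<T>" using edges_of_subset that S by blast
      then have "\<sigma> \<in> ext_edges \<Omega> \<T>" using ni admissible_meshD(11)[OF mesh] by auto
      then have "\<sigma> \<subseteq> \<Gamma>N" using nodir[OF that] ni admissible_meshD(13)[OF mesh] by blast
      then show ?thesis using fr(2) by auto
    qed simp
  qed
  \<comment> \<open>Dirichlet points on the boundary of such a cell can only be boundary points of
    \<Omega> on interior edges, or limit points of an edge outside it. A Neumann edge contributes
    only the latter, being disjoint from \<open>\<Gamma>D\<close>.\<close>
  define Z where "Z = (\<Union>K\<in>S. \<Union>\<sigma>\<in>edges_of \<T> K. (if \<sigma> \<in> int_edges \<T> then \<sigma> \<inter> frontier \<Omega> else {}) \<union> (closure \<sigma> - \<sigma>))"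
  have "Z \<in> null_sets surface_measure" unfolding Z_def
  proof (intro null_sets.finite_UN null_sets.Un)
    fix K \<sigma> assume K: "K \<in> S" and \<sigma>: "\<sigma> \<in> edges_of \<T> K"
    then have E: "\<sigma> \<in> edges \<T>" using edges_of_subset S by blast
    show "(if \<sigma> \<in> int_edges \<T> then \<sigma> \<inter> frontier \<Omega> else {}) \<in> null_sets surface_measure"
      using admissible_meshD(12)[OF mesh] by auto
    show "closure \<sigma> - \<sigma> \<in> null_sets surface_measure" using admissible_meshD(6)[OF mesh E] by auto
  qed (use finS finite_E S in auto)
  moreover have "\<Gamma>D \<inter> frontier C \<subseteq> Z"
  proof
    fix x assume x: "x \<in> \<Gamma>D \<inter> frontier C"
    then have "x \<in> U" using \<open>closure C \<subseteq> U\<close> by (auto simp: frontier_def)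
    then obtain K where K: "K \<in> S" "x \<in> closure K" by (auto simp: U_def)
    have "x \<notin> \<Omega>" using x frC op by (auto simp: frontier_def interior_open)
    then have "x \<notin> K" using K S admissible_meshD(3)[OF mesh, of K] by auto
    then have "x \<in> frontier K" using K S admissible_meshD(3)[OF mesh, of K] by (auto simp: frontier_def interior_open)
    then obtain \<sigma> where \<sigma>: "\<sigma> \<in> edges_of \<T> K" "x \<in> closure \<sigma>" using admissible_meshD(8)[OF mesh, of K] K S by auto
    have "x \<in> (if \<sigma> \<in> int_edges \<T> then \<sigma> \<inter> frontier \<Omega> else {}) \<union> (closure \<sigma> - \<sigma>)"
      using ext[OF K(1) \<sigma>(1)] x \<sigma>(2) by (cases "\<sigma> \<in> int_edges \<T>") auto
    then show "x \<in> Z" unfolding Z_def using K(1) \<sigma>(1) by blast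
  qed
  ultimately have "emeasure surface_measure (\<Gamma>D \<inter> frontier C) = 0"
    using emeasure_mono[of "\<Gamma>D \<inter> frontier C" Z surface_measure] by (auto simp: null_sets_def)
  then show False using dir C by (auto simp: dirichlet_on_components_def)
qed

end


subsection \<open>Boundary layers\<close>

lemma smooth_differentiable: "smooth f \<Longrightarrow> f differentiable (at x)"
  unfolding smooth_def by (drule spec[of _ "Suc 0"]) simp

lemma frechet_derivative_grad:
  fixes f :: "'a::euclidean_space \<Rightarrow> real"
  assumes "smooth f"
  shows "frechet_derivative f (at x) = (\<lambda>v. grad f x \<bullet> v)"
proof
  fix v
  interpret linear "frechet_derivative f (at x)"
    using linear_frechet_derivative[OF smooth_differentiable[OF assms]] .
  have "frechet_derivative f (at x) v = frechet_derivative f (at x) (\<Sum>i\<in>Basis. (v \<bullet> i) *\<^sub>R i)"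
    by (simp only: euclidean_representation)
  also have "\<dots> = grad f x \<bullet> v"
    by (simp add: sum scaleR grad_def inner_sum_left inner_commute[of v] mult.commute)
  finally show "frechet_derivative f (at x) v = grad f x \<bullet> v" .
qed

lemma smooth_has_derivative:
  fixes f :: "'a::euclidean_space \<Rightarrow> real"
  assumes "smooth f"
  shows "(f has_derivative (\<lambda>v. grad f x \<bullet> v)) (at x)"
  using smooth_differentiable[OF assms] frechet_derivative_works frechet_derivative_grad[OF assms] by metis

lemma continuous_on_grad:
  fixes f :: "'a::euclidean_space \<Rightarrow> real"
  assumes "smooth f"
  shows "continuous_on UNIV (grad f)"
proof -
  have "Ck (Suc (Suc 0)) f" using assms by (simp add: smooth_def)
  then have "\<And>i x. i \<in> Basis \<Longrightarrow> (\<lambda>x. frechet_derivative f (at x) i) differentiable (at x)" by simp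
  then have "\<And>i. i \<in> Basis \<Longrightarrow> continuous_on UNIV (\<lambda>x. frechet_derivative f (at x) i)"
    by (auto intro!: continuous_at_imp_continuous_on differentiable_imp_continuous_within)
  then show ?thesis unfolding grad_def by (intro continuous_intros) auto
qed

text \<open>Fundamental theorem of calculus on the segment and the Cauchy-Schwarz inequality, whose
  length factor t is enlarged to h. This factor is what makes the gradient error small in a thin
  layer.\<close>

lemma smooth_line_estimate:
  fixes f :: "'a::euclidean_space \<Rightarrow> real"
  assumes f: "smooth f" and t: "0 < t" "t \<le> h"
  shows "ennreal ((f (y + t *\<^sub>R w) - f y)\<^sup>2) \<le>
    ennreal (h * (norm w)\<^sup>2) * (\<integral>\<^sup>+s. ennreal ((norm (grad f (y + s *\<^sub>R w)))\<^sup>2) * indicator {0..h} s \<partial>lborel)"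
proof -
  define \<phi> where "\<phi> = (\<lambda>s. f (y + s *\<^sub>R w))"
  define g where "g = (\<lambda>s. grad f (y + s *\<^sub>R w) \<bullet> w)"
  define \<Delta> where "\<Delta> = \<phi> t - \<phi> 0"
  have "(\<phi> has_vector_derivative g s) (at s within {0..t})" for s
  proof -
    have "((\<lambda>s. y + s *\<^sub>R w) has_derivative (\<lambda>s. s *\<^sub>R w)) (at s within {0..t})"
      by (auto intro!: derivative_eq_intros)
    from has_derivative_compose[OF this smooth_has_derivative[OF f]]
    show ?thesis unfolding \<phi>_def g_def has_vector_derivative_def by (simp add: mult.commute)
  qed
  then have int_g: "(g has_integral \<Delta>) {0..t}"
    unfolding \<Delta>_def using t by (intro fundamental_theorem_of_calculus) auto
  have cont: "continuous_on S (\<lambda>s. grad f (y + s *\<^sub>R w))" for S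
    by (rule continuous_on_compose2[OF continuous_on_grad[OF f]]) (auto intro!: continuous_intros)
  then have cont_g: "continuous_on {0..t} (\<lambda>s. (g s)\<^sup>2)" unfolding g_def by (intro continuous_intros)
  define J where "J = integral {0..t} (\<lambda>s. (g s)\<^sup>2)"
  have int_g2: "((\<lambda>s. (g s)\<^sup>2) has_integral J) {0..t}"
    unfolding J_def using cont_g by (intro integrable_integral integrable_continuous_real)
  \<comment> \<open>Cauchy-Schwarz by completing the square: the integral of the square of
    \<open>g s - a\<close>, with \<open>a\<close> the mean of \<open>g\<close>, is
    nonnegative.\<close>
  define a where "a = \<Delta> / t"
  have "((\<lambda>s. (g s)\<^sup>2 - 2 * a * g s + a\<^sup>2) has_integral (J - 2 * a * \<Delta> + a\<^sup>2 * t)) {0..t}"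
    using t has_integral_const_real[of "a\<^sup>2" 0 t]
    by (intro has_integral_add has_integral_diff int_g2 has_integral_mult_right int_g) (simp add: mult.commute)
  moreover have "(g s)\<^sup>2 - 2 * a * g s + a\<^sup>2 \<ge> 0" for s
    using zero_le_power2[of "g s - a"] by (simp add: power2_diff algebra_simps)
  ultimately have "0 \<le> J - 2 * a * \<Delta> + a\<^sup>2 * t" by (rule has_integral_nonneg)
  moreover have "t * (J - 2 * a * \<Delta> + a\<^sup>2 * t) = t * J - \<Delta>\<^sup>2"
    using t by (simp add: a_def power2_eq_square field_simps)
  ultimately have "0 \<le> t * J - \<Delta>\<^sup>2" using t by (metis less_imp_le mult_nonneg_nonneg)
  then have "\<Delta>\<^sup>2 \<le> t * J" by simp
  also have "\<dots> \<le> h * J"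
    using t has_integral_nonneg[OF int_g2] by (intro mult_right_mono) auto
  finally have "ennreal (\<Delta>\<^sup>2) \<le> ennreal h * ennreal J" using t by (simp add: ennreal_mult'[symmetric] ennreal_leI)
  also have "ennreal J = (\<integral>\<^sup>+s. ennreal ((g s)\<^sup>2) * indicator {0..t} s \<partial>lborel)"
    by (rule nn_integral_has_integral_lebesgue'[OF _ int_g2, symmetric]) simp
  also have "\<dots> \<le> (\<integral>\<^sup>+s. ennreal ((norm w)\<^sup>2) * (ennreal ((norm (grad f (y + s *\<^sub>R w)))\<^sup>2) * indicator {0..h} s) \<partial>lborel)"
  proof (rule nn_integral_mono)
    fix s
    have "(g s)\<^sup>2 \<le> (norm (grad f (y + s *\<^sub>R w)) * norm w)\<^sup>2"
      unfolding g_def using Cauchy_Schwarz_ineq2[of "grad f (y + s *\<^sub>R w)" w] by (simp add: abs_le_square_iff[symmetric])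
    then show "ennreal ((g s)\<^sup>2) * indicator {0..t} s \<le>
        ennreal ((norm w)\<^sup>2) * (ennreal ((norm (grad f (y + s *\<^sub>R w)))\<^sup>2) * indicator {0..h} s)"
      using t by (auto simp: indicator_def ennreal_mult'[symmetric] power_mult_distrib mult.commute)
  qed
  also have "\<dots> = ennreal ((norm w)\<^sup>2) * (\<integral>\<^sup>+s. ennreal ((norm (grad f (y + s *\<^sub>R w)))\<^sup>2) * indicator {0..h} s \<partial>lborel)"
  proof (rule nn_integral_cmult)
    have [measurable]: "(\<lambda>s. grad f (y + s *\<^sub>R w)) \<in> borel_measurable borel"
      by (rule borel_measurable_continuous_onI[OF cont])
    show "(\<lambda>s. ennreal ((norm (grad f (y + s *\<^sub>R w)))\<^sup>2) * indicator {0..h} s) \<in> borel_measurable lborel"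
      by measurable
  qed
  finally show ?thesis
    using t by (simp add: \<Delta>_def \<phi>_def ennreal_mult mult.assoc mult_left_mono)
qed

section \<open>Estimate in a layer next to a face\<close>

text \<open>The distance to the interval [m, M] when m \<le> M. It is Lipschitz with constant 1 and
  vanishes exactly when both bounds hold, so bounds can be passed through convergence in the mean
  square.\<close>

definition dist_Icc :: "real \<Rightarrow> real \<Rightarrow> real \<Rightarrow> real" where
  "dist_Icc m M s = max 0 (max (s - M) (m - s))"

lemma dist_Icc_eq_0_iff: "dist_Icc m M s = 0 \<longleftrightarrow> m \<le> s \<and> s \<le> M"
  by (auto simp: dist_Icc_def)

lemma dist_Icc_square_le: "(dist_Icc m M s)\<^sup>2 \<le> 2 * (dist_Icc m M t)\<^sup>2 + 2 * (s - t)\<^sup>2"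
proof -
  have "(dist_Icc m M s)\<^sup>2 \<le> (dist_Icc m M t + \<bar>s - t\<bar>)\<^sup>2"
    by (intro power_mono) (auto simp: dist_Icc_def)
  also have "\<dots> \<le> 2 * (dist_Icc m M t)\<^sup>2 + 2 * \<bar>s - t\<bar>\<^sup>2"
    using sum_squares_bound[of "dist_Icc m M t" "\<bar>s - t\<bar>"] by (simp add: power2_sum)
  finally show ?thesis by simp
qed

lemma dist_Icc_measurable [measurable]: "dist_Icc m M \<in> borel_measurable borel"
  unfolding dist_Icc_def by measurable

text \<open>Each value on the face is compared with the values at \<open>y + t *\<^sub>R w\<close>
  and averaged over t up to h. The map from (y, t) to that point has Jacobian
  \<open>\<bar>\<nu> \<bullet> w\<bar>\<close> and sends the layer into \<open>K\<close>. The left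
  side carries h and the gradient term its square, so division by h leaves an error of order
  h.\<close>

lemma boundary_layer_estimate:
  fixes f :: "'a::euclidean_space \<Rightarrow> real"
  assumes f: "smooth f" and \<nu>: "norm \<nu> = 1" "\<nu> \<bullet> w \<noteq> 0" and A: "A \<in> sets borel" and K: "open K"
    and AK: "\<And>y t. y \<in> A \<Longrightarrow> 0 < t \<Longrightarrow> t \<le> 1 \<Longrightarrow> y + t *\<^sub>R w \<in> K" and h: "0 < h" "h \<le> 1"
  shows "ennreal (\<bar>\<nu> \<bullet> w\<bar> * h) * (\<integral>\<^sup>+y. ennreal ((dist_Icc m M (f y))\<^sup>2) * indicator A y \<partial>hyperplane_lebesgue {x. \<nu> \<bullet> x = c})
    \<le> 2 * (\<integral>\<^sup>+x. ennreal ((dist_Icc m M (f x))\<^sup>2) * indicator K x \<partial>lborel)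
      + ennreal (2 * h\<^sup>2 * (norm w)\<^sup>2) * (\<integral>\<^sup>+x. ennreal ((norm (grad f x))\<^sup>2) * indicator K x \<partial>lborel)"
proof -
  have [measurable]: "f \<in> borel_measurable borel"
    using smooth_differentiable[OF f] by (intro borel_measurable_continuous_onI)
      (auto intro!: continuous_at_imp_continuous_on differentiable_imp_continuous_within)
  have [measurable]: "grad f \<in> borel_measurable borel"
    by (rule borel_measurable_continuous_onI[OF continuous_on_grad[OF f]])
  note [measurable] = A borel_open[OF K]
  define \<gamma> where "\<gamma> = hyperplane_lebesgue {x. \<nu> \<bullet> x = c}"
  have [measurable_cong]: "sets \<gamma> = sets borel" by (simp add: \<gamma>_def)
  define X where "X = (\<lambda>x. ennreal ((dist_Icc m M (f x))\<^sup>2))"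
  define Y where "Y = (\<lambda>x. ennreal ((norm (grad f x))\<^sup>2))"
  have [measurable]: "X \<in> borel_measurable borel" "Y \<in> borel_measurable borel" unfolding X_def Y_def by measurable
  let ?b = "ennreal (2 * h * (norm w)\<^sup>2)"
  \<comment> \<open>The face itself is not in the open cell, so t = 0 has to be removed before the
    layer can be placed in \<open>K\<close>.\<close>
  have AE_pos: "(\<integral>\<^sup>+s. g s * indicator {0..h} s \<partial>lborel) = (\<integral>\<^sup>+s. g s * indicator {0<..h} s \<partial>lborel)"
    for g :: "real \<Rightarrow> ennreal"
    by (intro nn_integral_cong_AE, rule AE_mp[OF AE_lborel_singleton[of 0]]) (auto simp: indicator_def)
  let ?jX = "\<lambda>y. \<integral>\<^sup>+t. 2 * (X (y + t *\<^sub>R w) * indicator K (y + t *\<^sub>R w)) \<partial>lborel" and ?jY = "\<lambda>y. \<integral>\<^sup>+t. Y (y + t *\<^sub>R w) * indicator K (y + t *\<^sub>R w) \<partial>lborel"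
  let ?IX = "\<integral>\<^sup>+y. \<integral>\<^sup>+t. 2 * (X (y + t *\<^sub>R w) * indicator K (y + t *\<^sub>R w)) \<partial>lborel \<partial>\<gamma>" and ?IY = "\<integral>\<^sup>+y. \<integral>\<^sup>+t. Y (y + t *\<^sub>R w) * indicator K (y + t *\<^sub>R w) \<partial>lborel \<partial>\<gamma>"
  have point: "ennreal h * X y \<le> ?jX y
      + ennreal h * (?b * ?jY y)" if y: "y \<in> A" for y
  proof -
    define G where "G = (\<integral>\<^sup>+s. Y (y + s *\<^sub>R w) * indicator {0<..h} s \<partial>lborel)"
    have XG: "X y \<le> 2 * X (y + t *\<^sub>R w) + ?b * G" if t: "0 < t" "t \<le> h" for t
    proof -
      have "X y \<le> ennreal (2 * (dist_Icc m M (f (y + t *\<^sub>R w)))\<^sup>2 + 2 * (f y - f (y + t *\<^sub>R w))\<^sup>2)"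
        unfolding X_def by (intro ennreal_leI dist_Icc_square_le)
      also have "\<dots> = 2 * X (y + t *\<^sub>R w) + 2 * ennreal ((f (y + t *\<^sub>R w) - f y)\<^sup>2)"
        by (simp add: X_def ennreal_plus ennreal_mult power2_commute[of "f y"])
      also have "ennreal ((f (y + t *\<^sub>R w) - f y)\<^sup>2) \<le> ennreal (h * (norm w)\<^sup>2) * G"
        using smooth_line_estimate[OF f t, of y w] unfolding G_def Y_def AE_pos .
      finally have "X y \<le> 2 * X (y + t *\<^sub>R w) + 2 * (ennreal (h * (norm w)\<^sup>2) * G)"
        by (simp add: add_left_mono mult_left_mono)
      also have "2 * (ennreal (h * (norm w)\<^sup>2) * G) = ?b * G"
        using h by (simp add: ennreal_mult mult.assoc)
      finally show ?thesis .
    qed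
    have ci: "(\<integral>\<^sup>+t. c * indicator {0<..h} t \<partial>lborel) = ennreal h * c" for c
      using h by (simp add: nn_integral_cmult_indicator mult.commute)
    have "ennreal h * X y = (\<integral>\<^sup>+t. X y * indicator {0<..h} t \<partial>lborel)"
      by (rule ci[symmetric])
    also have "\<dots> \<le> (\<integral>\<^sup>+t. 2 * (X (y + t *\<^sub>R w) * indicator K (y + t *\<^sub>R w)) + (?b * G) * indicator {0<..h} t \<partial>lborel)"
    proof (rule nn_integral_mono)
      fix t show "X y * indicator {0<..h} t \<le> 2 * (X (y + t *\<^sub>R w) * indicator K (y + t *\<^sub>R w)) + (?b * G) * indicator {0<..h} t"
        using XG[of t] AK[OF y, of t] h by (auto simp: indicator_def)
    qed
    also have "\<dots> = ?jX y + ennreal h * (?b * G)"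
      by (subst nn_integral_add) (auto simp: ci)
    also have "G \<le> ?jY y"
      unfolding G_def using AK[OF y] h by (intro nn_integral_mono) (auto simp: indicator_def)
    finally show ?thesis by (simp add: add_left_mono mult_left_mono)
  qed
  let ?a = "ennreal \<bar>\<nu> \<bullet> w\<bar>"
  have "ennreal h * (\<integral>\<^sup>+y. X y * indicator A y \<partial>\<gamma>) = (\<integral>\<^sup>+y. ennreal h * X y * indicator A y \<partial>\<gamma>)"
    by (subst nn_integral_cmult[symmetric]) (auto simp: mult.assoc)
  also have "\<dots> \<le> (\<integral>\<^sup>+y. ?jX y
      + ennreal h * (?b * ?jY y) \<partial>\<gamma>)"
    using point by (intro nn_integral_mono) (auto simp: indicator_def)
  also have "\<dots> = ?IX
      + ennreal h * (?b * ?IY)"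
    by (simp add: nn_integral_add nn_integral_cmult)
  finally have main: "ennreal h * (\<integral>\<^sup>+y. X y * indicator A y \<partial>\<gamma>) \<le>
      ?IX
      + ennreal h * (?b * ?IY)" .
  have "?a * (ennreal h * (\<integral>\<^sup>+y. X y * indicator A y \<partial>\<gamma>)) \<le>
      ?a * ?IX
      + ennreal h * (?b * (?a * ?IY))"
    using mult_left_mono[OF main, of ?a] by (simp add: distrib_left mult_ac)
  also have "?a * ?IX = (\<integral>\<^sup>+x. 2 * (X x * indicator K x) \<partial>lborel)"
    unfolding \<gamma>_def by (rule nn_integral_lborel_hyperplane[OF \<nu>, where f = "\<lambda>x. 2 * (X x * indicator K x)"]) measurable
  also have "\<dots> = 2 * (\<integral>\<^sup>+x. X x * indicator K x \<partial>lborel)" by (simp add: nn_integral_cmult)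
  also have "?a * ?IY = (\<integral>\<^sup>+x. Y x * indicator K x \<partial>lborel)"
    unfolding \<gamma>_def by (rule nn_integral_lborel_hyperplane[OF \<nu>, where f = "\<lambda>x. Y x * indicator K x"]) measurable
  also have "ennreal h * (?b * (\<integral>\<^sup>+x. Y x * indicator K x \<partial>lborel)) =
      ennreal (2 * h\<^sup>2 * (norm w)\<^sup>2) * (\<integral>\<^sup>+x. Y x * indicator K x \<partial>lborel)"
  proof -
    have "ennreal h * ?b = ennreal (2 * h\<^sup>2 * (norm w)\<^sup>2)"
      using h by (simp add: ennreal_mult'[symmetric] power2_eq_square mult_ac)
    then show ?thesis by (simp only: mult.assoc[symmetric])
  qed
  finally show ?thesis
    using h by (simp add: X_def Y_def \<gamma>_def ennreal_mult mult.assoc)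
qed


subsection \<open>Bounds for traces and means\<close>

lemma norm_square_le_diff: "(norm (a :: 'a::real_normed_vector))\<^sup>2 \<le> 2 * (norm (a - b))\<^sup>2 + 2 * (norm b)\<^sup>2"
proof -
  have "(norm a)\<^sup>2 \<le> (norm (a - b) + norm b)\<^sup>2"
    using norm_triangle_ineq[of "a - b" b] by (intro power_mono) auto
  also have "\<dots> \<le> 2 * (norm (a - b))\<^sup>2 + 2 * (norm b)\<^sup>2"
    using sum_squares_bound[of "norm (a - b)" "norm b"] by (simp add: power2_sum)
  finally show ?thesis .
qed

lemma nn_integral_lborel_le_lebesgue_on:
  fixes f :: "'a::euclidean_space \<Rightarrow> ennreal"
  assumes "f \<in> borel_measurable borel" "open K" "K \<subseteq> \<Omega>" "open \<Omega>"
  shows "(\<integral>\<^sup>+x. f x * indicator K x \<partial>lborel) \<le> (\<integral>\<^sup>+x. f x \<partial>lebesgue_on \<Omega>)"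
proof -
  have "(\<integral>\<^sup>+x. f x * indicator K x \<partial>lborel) \<le> (\<integral>\<^sup>+x. f x * indicator \<Omega> x \<partial>lborel)"
    using assms(3) by (intro nn_integral_mono) (auto simp: indicator_def)
  also have "\<dots> = (\<integral>\<^sup>+x. f x * indicator \<Omega> x \<partial>lebesgue)"
    by (rule nn_integral_completion[symmetric])
  also have "\<dots> = (\<integral>\<^sup>+x. f x \<partial>lebesgue_on \<Omega>)"
    using assms by (subst nn_integral_restrict_space) auto
  finally show ?thesis .
qed

text \<open>The case h = 1 shows that \<open>I\<close> is finite; only then may h be cancelled and
  sent to 0.\<close>

lemma ennreal_eq_0_if_le_small:
  fixes I :: ennreal
  assumes "\<And>h. 0 < h \<Longrightarrow> h \<le> 1 \<Longrightarrow> ennreal (a * h) * I \<le> ennreal (b * h\<^sup>2)" and "a > 0" "b \<ge> 0"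
  shows "I = 0"
proof -
  have "ennreal a * I \<le> ennreal b" using assms(1)[of 1] by simp
  then have "ennreal a * I < \<infinity>" by (metis ennreal_less_top infinity_ennreal_def le_less_trans)
  then have "I < \<infinity>" using assms(2) by (auto simp: ennreal_mult_less_top)
  then obtain r where r: "I = ennreal r" "r \<ge> 0" by (cases I) auto
  have "a * r \<le> b * h" if "0 < h" "h \<le> 1" for h
  proof -
    have "ennreal (a * h * r) \<le> ennreal (b * h\<^sup>2)" using assms that r by (simp add: ennreal_mult')
    then have "(a * r) * h \<le> (b * h) * h" using that assms by (simp add: power2_eq_square mult_ac)
    then show ?thesis using that by simp
  qed
  note le = this
  have "a * r \<le> 0"
  proof (rule field_le_epsilon)
    fix e :: real assume "e > 0"
    define h where "h = min 1 (e / (b + 1))"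
    have "0 < h" "h \<le> 1" using \<open>e > 0\<close> assms by (auto simp: h_def)
    have "b * h \<le> b * (e / (b + 1))" using assms by (intro mult_left_mono) (auto simp: h_def)
    also have "\<dots> \<le> e" using assms \<open>e > 0\<close> by (simp add: field_simps)
    finally show "a * r \<le> 0 + e" using le[OF \<open>0 < h\<close> \<open>h \<le> 1\<close>] by simp
  qed
  then have "r = 0" using assms(2) r(2) by (simp add: mult_le_0_iff)
  then show ?thesis using r by simp
qed

text \<open>The layer estimate is applied to the smooth approximations. With the width h fixed, the
  limit in k removes the interior distance term, as u takes values in [m, M], and replaces the
  gradients by \<open>G\<close>; only afterwards does h tend to 0. This order matters because the
  approximations themselves may violate the bounds.\<close>

lemma trace_bounds_layer:
  fixes \<Omega> K \<Gamma> A :: "'a::euclidean_space set"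
  assumes \<Omega>: "open \<Omega>" and K: "open K" "K \<subseteq> \<Omega>" and \<Gamma>: "\<Gamma> \<in> sets surface_measure"
    and tr: "is_trace \<Omega> \<Gamma> u g" and u: "AE x in lebesgue_on \<Omega>. m \<le> u x \<and> u x \<le> M"
    and \<nu>: "norm \<nu> = 1" "\<nu> \<bullet> w \<noteq> 0" and A: "A \<in> sets borel" "A \<subseteq> {x. \<nu> \<bullet> x = c}"
    and AK: "\<And>y t. y \<in> A \<Longrightarrow> 0 < t \<Longrightarrow> t \<le> 1 \<Longrightarrow> y + t *\<^sub>R w \<in> K"
  shows "AE y in restrict_space surface_measure \<Gamma>. y \<in> A \<longrightarrow> m \<le> g y \<and> g y \<le> M"
proof -
  define \<mu> where "\<mu> = restrict_space surface_measure \<Gamma>"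
  obtain G \<phi> where G: "H1_with_gradient \<Omega> u G" and \<phi>: "\<And>k::nat. smooth (\<phi> k)"
    and lim: "L2_converges (lebesgue_on \<Omega>) \<phi> u" "L2_converges (lebesgue_on \<Omega>) (\<lambda>k. grad (\<phi> k)) G"
      "L2_converges \<mu> \<phi> g" and g: "in_L2 \<mu> g"
    using tr unfolding is_trace_def \<mu>_def by blast
  have \<phi>_meas [measurable]: "\<phi> k \<in> borel_measurable borel" for k
    using smooth_differentiable[OF \<phi>] by (intro borel_measurable_continuous_onI)
      (auto intro!: continuous_at_imp_continuous_on differentiable_imp_continuous_within)
  have grad_meas [measurable]: "grad (\<phi> k) \<in> borel_measurable borel" for k
    by (rule borel_measurable_continuous_onI[OF continuous_on_grad[OF \<phi>]])
  have g_meas [measurable]: "g \<in> borel_measurable \<mu>" using g by (simp add: in_L2_def)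
  have borel_\<mu>: "f \<in> borel_measurable \<mu>" if "f \<in> borel_measurable borel" for f :: "'a \<Rightarrow> 'b::topological_space"
  proof -
    have "f \<in> borel_measurable surface_measure"
      unfolding surface_measure_completion by (rule measurable_completion) (use that in simp)
    then show ?thesis unfolding \<mu>_def by (rule measurable_restrict_space1)
  qed
  have G_meas [measurable]: "G \<in> borel_measurable (lebesgue_on \<Omega>)" "u \<in> borel_measurable (lebesgue_on \<Omega>)"
    using G by (auto simp: H1_with_gradient_def in_L2_def)
  have borel_\<Omega>: "f \<in> borel_measurable (lebesgue_on \<Omega>)" if "f \<in> borel_measurable borel" for f :: "'a \<Rightarrow> 'b::topological_space"
    using measurable_completion[of f lborel borel] that by (intro measurable_restrict_space1) simp
  note [measurable] = borel_\<Omega>[OF \<phi>_meas] borel_\<Omega>[OF grad_meas] borel_\<mu>[OF \<phi>_meas]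
  define H where "H = {x. \<nu> \<bullet> x = c}"
  have H: "H \<in> hyperplanes"
    using \<nu>(1) aff_dim_hyperplane[of \<nu> c] by (cases "\<nu> = 0") (auto simp: H_def hyperplanes_def affine_hyperplane)
  define I where "I = (\<integral>\<^sup>+y. ennreal ((dist_Icc m M (g y))\<^sup>2) * indicator A y \<partial>\<mu>)"
  define \<epsilon> where "\<epsilon> = (\<lambda>k. \<integral>\<^sup>+x. ennreal ((norm (\<phi> k x - u x))\<^sup>2) \<partial>lebesgue_on \<Omega>)"
  define \<eta> where "\<eta> = (\<lambda>k. \<integral>\<^sup>+x. ennreal ((norm (grad (\<phi> k) x - G x))\<^sup>2) \<partial>lebesgue_on \<Omega>)"
  define \<delta> where "\<delta> = (\<lambda>k. \<integral>\<^sup>+x. ennreal ((norm (\<phi> k x - g x))\<^sup>2) \<partial>\<mu>)"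
  define B where "B = (\<integral>\<^sup>+x. ennreal ((norm (G x))\<^sup>2) \<partial>lebesgue_on \<Omega>)"
  have lims: "\<epsilon> \<longlonglongrightarrow> 0" "\<eta> \<longlonglongrightarrow> 0" "\<delta> \<longlonglongrightarrow> 0"
    using lim unfolding L2_converges_def \<epsilon>_def \<eta>_def \<delta>_def by auto
  have "B < \<infinity>"
  proof -
    have "integrable (lebesgue_on \<Omega>) (\<lambda>x. (norm (G x))\<^sup>2)" using G by (simp add: H1_with_gradient_def in_L2_def)
    then show ?thesis unfolding B_def by (simp add: integrable_iff_bounded)
  qed
  then obtain b where b: "B = ennreal b" "b \<ge> 0" by (cases B) auto
  have E1: "(\<integral>\<^sup>+x. ennreal ((dist_Icc m M (\<phi> k x))\<^sup>2) * indicator K x \<partial>lborel) \<le> 2 * \<epsilon> k" for k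
  proof -
    have "(\<integral>\<^sup>+x. ennreal ((dist_Icc m M (\<phi> k x))\<^sup>2) * indicator K x \<partial>lborel)
        \<le> (\<integral>\<^sup>+x. ennreal ((dist_Icc m M (\<phi> k x))\<^sup>2) \<partial>lebesgue_on \<Omega>)"
      by (rule nn_integral_lborel_le_lebesgue_on) (use K \<Omega> in auto)
    also have "\<dots> \<le> (\<integral>\<^sup>+x. 2 * ennreal ((norm (\<phi> k x - u x))\<^sup>2) \<partial>lebesgue_on \<Omega>)"
    proof (rule nn_integral_mono_AE, rule AE_mp[OF u], rule AE_I2, rule impI)
      fix x assume "m \<le> u x \<and> u x \<le> M"
      then have "dist_Icc m M (u x) = 0" by (simp add: dist_Icc_eq_0_iff)
      then have "(dist_Icc m M (\<phi> k x))\<^sup>2 \<le> 2 * (norm (\<phi> k x - u x))\<^sup>2"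
        using dist_Icc_square_le[of m M "\<phi> k x" "u x"] by simp
      then have "ennreal ((dist_Icc m M (\<phi> k x))\<^sup>2) \<le> ennreal (2 * (norm (\<phi> k x - u x))\<^sup>2)" by (rule ennreal_leI)
      then show "ennreal ((dist_Icc m M (\<phi> k x))\<^sup>2) \<le> 2 * ennreal ((norm (\<phi> k x - u x))\<^sup>2)"
        by (simp add: ennreal_mult)
    qed
    also have "\<dots> = 2 * \<epsilon> k" unfolding \<epsilon>_def by (rule nn_integral_cmult) measurable
    finally show ?thesis .
  qed
  have E2: "(\<integral>\<^sup>+x. ennreal ((norm (grad (\<phi> k) x))\<^sup>2) * indicator K x \<partial>lborel) \<le> 2 * \<eta> k + 2 * ennreal b" for k
  proof -
    have "(\<integral>\<^sup>+x. ennreal ((norm (grad (\<phi> k) x))\<^sup>2) * indicator K x \<partial>lborel)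
        \<le> (\<integral>\<^sup>+x. ennreal ((norm (grad (\<phi> k) x))\<^sup>2) \<partial>lebesgue_on \<Omega>)"
      by (rule nn_integral_lborel_le_lebesgue_on) (use K \<Omega> in auto)
    also have "\<dots> \<le> (\<integral>\<^sup>+x. 2 * ennreal ((norm (grad (\<phi> k) x - G x))\<^sup>2) + 2 * ennreal ((norm (G x))\<^sup>2) \<partial>lebesgue_on \<Omega>)"
    proof (rule nn_integral_mono)
      fix x
      have "ennreal ((norm (grad (\<phi> k) x))\<^sup>2) \<le> ennreal (2 * (norm (grad (\<phi> k) x - G x))\<^sup>2 + 2 * (norm (G x))\<^sup>2)"
        by (intro ennreal_leI norm_square_le_diff)
      then show "ennreal ((norm (grad (\<phi> k) x))\<^sup>2) \<le> 2 * ennreal ((norm (grad (\<phi> k) x - G x))\<^sup>2) + 2 * ennreal ((norm (G x))\<^sup>2)"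
        by (simp add: ennreal_mult)
    qed
    also have "\<dots> = 2 * \<eta> k + 2 * B"
      unfolding \<eta>_def B_def by (subst nn_integral_add) (auto simp: nn_integral_cmult)
    finally show ?thesis using b by simp
  qed
  let ?Q = "\<lambda>k. \<integral>\<^sup>+y. ennreal ((dist_Icc m M (\<phi> k y))\<^sup>2) * indicator A y \<partial>hyperplane_lebesgue H"
  have E3: "I \<le> 2 * ?Q k + 2 * \<delta> k" for k
  proof -
    have ind: "(indicator A :: 'a \<Rightarrow> ennreal) \<in> borel_measurable borel" using A(1) by simp
    note [measurable] = borel_\<mu>[OF ind]
    have "I \<le> (\<integral>\<^sup>+y. 2 * (ennreal ((dist_Icc m M (\<phi> k y))\<^sup>2) * indicator A y) + 2 * ennreal ((norm (\<phi> k y - g y))\<^sup>2) \<partial>\<mu>)"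
      unfolding I_def
    proof (rule nn_integral_mono)
      fix y
      have "ennreal ((dist_Icc m M (g y))\<^sup>2) \<le> ennreal (2 * (dist_Icc m M (\<phi> k y))\<^sup>2 + 2 * (norm (\<phi> k y - g y))\<^sup>2)"
        using dist_Icc_square_le[of m M "g y" "\<phi> k y"] by (intro ennreal_leI) (simp add: power2_commute[of "g y"])
      then show "ennreal ((dist_Icc m M (g y))\<^sup>2) * indicator A y \<le>
          2 * (ennreal ((dist_Icc m M (\<phi> k y))\<^sup>2) * indicator A y) + 2 * ennreal ((norm (\<phi> k y - g y))\<^sup>2)"
        by (auto simp: indicator_def ennreal_mult)
    qed
    also have "\<dots> = 2 * (\<integral>\<^sup>+y. ennreal ((dist_Icc m M (\<phi> k y))\<^sup>2) * indicator A y \<partial>\<mu>) + 2 * \<delta> k"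
      unfolding \<delta>_def by (subst nn_integral_add) (auto simp: nn_integral_cmult)
    also have "(\<integral>\<^sup>+y. ennreal ((dist_Icc m M (\<phi> k y))\<^sup>2) * indicator A y \<partial>\<mu>) \<le>
        (\<integral>\<^sup>+y. ennreal ((dist_Icc m M (\<phi> k y))\<^sup>2) * indicator A y \<partial>surface_measure)"
      unfolding \<mu>_def using \<Gamma> by (subst nn_integral_restrict_space) (auto intro!: nn_integral_mono simp: indicator_def)
    also have "\<dots> = ?Q k"
      by (rule nn_integral_surface_measure_hyperplane[OF H A(1)]) (use A(2) H_def in auto)
    finally show ?thesis by (simp add: add_right_mono mult_left_mono)
  qed
  define a where "a = \<bar>\<nu> \<bullet> w\<bar>"
  have "I = 0"
  \<comment> \<open>The constant 8 collects three factors 2: replacing g by an approximation, the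
    layer estimate, and replacing the gradients of the approximations by \<open>G\<close>.\<close>
  proof (rule ennreal_eq_0_if_le_small[where a = a and b = "8 * (norm w)\<^sup>2 * b"])
    fix h :: real assume h: "0 < h" "h \<le> 1"
    let ?s = "\<lambda>k. 2 * (2 * (2 * \<epsilon> k) + ennreal (2 * h\<^sup>2 * (norm w)\<^sup>2) * (2 * \<eta> k + 2 * ennreal b)) + ennreal (a * h) * (2 * \<delta> k)"
    have "ennreal (a * h) * I \<le> ?s k" for k
    proof -
      have "ennreal (a * h) * I \<le> ennreal (a * h) * (2 * ?Q k + 2 * \<delta> k)"
        by (intro mult_left_mono E3) auto
      also have "\<dots> = 2 * (ennreal (a * h) * ?Q k) + ennreal (a * h) * (2 * \<delta> k)"
        by (simp add: distrib_left mult.left_commute)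
      also have "\<dots> \<le> ?s k"
      proof (intro add_right_mono mult_left_mono)
        have "ennreal (a * h) * ?Q k
          \<le> 2 * (\<integral>\<^sup>+x. ennreal ((dist_Icc m M (\<phi> k x))\<^sup>2) * indicator K x \<partial>lborel)
          + ennreal (2 * h\<^sup>2 * (norm w)\<^sup>2) * (\<integral>\<^sup>+x. ennreal ((norm (grad (\<phi> k) x))\<^sup>2) * indicator K x \<partial>lborel)"
          unfolding a_def H_def by (rule boundary_layer_estimate[OF \<phi> \<nu> A(1) K(1) AK h])
        also have "\<dots> \<le> 2 * (2 * \<epsilon> k) + ennreal (2 * h\<^sup>2 * (norm w)\<^sup>2) * (2 * \<eta> k + 2 * ennreal b)"
          by (intro add_mono mult_left_mono E1 E2) auto
        finally show "ennreal (a * h) * ?Q k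
          \<le> 2 * (2 * \<epsilon> k) + ennreal (2 * h\<^sup>2 * (norm w)\<^sup>2) * (2 * \<eta> k + 2 * ennreal b)" .
      qed auto
      finally show ?thesis .
    qed
    moreover have "?s \<longlonglongrightarrow> 2 * (2 * (2 * 0) + ennreal (2 * h\<^sup>2 * (norm w)\<^sup>2) * (2 * 0 + 2 * ennreal b)) + ennreal (a * h) * (2 * 0)"
      by (intro tendsto_add ennreal_tendsto_cmult tendsto_const lims) auto
    ultimately have "ennreal (a * h) * I \<le> 2 * (2 * (2 * 0) + ennreal (2 * h\<^sup>2 * (norm w)\<^sup>2) * (2 * 0 + 2 * ennreal b)) + ennreal (a * h) * (2 * 0)"
      by (intro LIMSEQ_le_const) auto
    also have "\<dots> = ennreal (8 * (norm w)\<^sup>2 * b * h\<^sup>2)"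
      using b by (simp add: ennreal_mult mult_ac)
    finally show "ennreal (a * h) * I \<le> ennreal (8 * (norm w)\<^sup>2 * b * h\<^sup>2)" .
  qed (use \<nu> b in \<open>auto simp: a_def\<close>)
  moreover have ind: "(indicator A :: 'a \<Rightarrow> ennreal) \<in> borel_measurable borel" using A(1) by simp
  ultimately have "AE y in \<mu>. ennreal ((dist_Icc m M (g y))\<^sup>2) * indicator A y = 0"
    unfolding I_def using borel_\<mu>[OF ind] by (subst (asm) nn_integral_0_iff_AE) auto
  then show ?thesis unfolding \<mu>_def[symmetric]
    by eventually_elim (auto simp: indicator_def dist_Icc_eq_0_iff split: if_splits)
qed

text \<open>Each point of a face moves into the convex cell along some direction from a countable dense set, so
  countably many of the preceding layers suffice.\<close>

lemma trace_bounds_face: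
  fixes \<Omega> K \<Gamma> S :: "'a::euclidean_space set"
  assumes \<Omega>: "open \<Omega>" and K: "open K" "convex K" "K \<noteq> {}" "K \<subseteq> \<Omega>" and \<Gamma>: "\<Gamma> \<in> sets surface_measure"
    and tr: "is_trace \<Omega> \<Gamma> u g" and u: "AE x in lebesgue_on \<Omega>. m \<le> u x \<and> u x \<le> M"
    and S: "closed S" "S \<subseteq> closure K" "S \<subseteq> H" "H \<in> hyperplanes"
  shows "AE y in restrict_space surface_measure \<Gamma>. y \<in> S \<longrightarrow> m \<le> g y \<and> g y \<le> M"
proof -
  obtain \<nu> c where \<nu>: "norm \<nu> = 1" and Hc: "H = {x. \<nu> \<bullet> x = c}" using hyperplanes_cases[OF S(4)] .
  obtain W :: "'a set" where W: "countable W" "\<And>X. open X \<Longrightarrow> X \<noteq> {} \<Longrightarrow> \<exists>w\<in>W. w \<in> X"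
    by (rule countable_dense_setE) blast
  \<comment> \<open>The points of the face that \<open>w\<close> moves into \<open>K\<close>. By
    convexity the whole segment except its starting point then lies in the open cell, as the layer
    estimate demands.\<close>
  define A where "A = (\<lambda>w. S \<inter> {y. y + w \<in> K})"
  have "AE y in restrict_space surface_measure \<Gamma>. \<forall>w\<in>{w\<in>W. \<nu> \<bullet> w \<noteq> 0}. y \<in> A w \<longrightarrow> m \<le> g y \<and> g y \<le> M"
  proof (subst AE_ball_countable)
    show "countable {w \<in> W. \<nu> \<bullet> w \<noteq> 0}" using W(1) by (rule countable_subset[rotated]) auto
    show "\<forall>w\<in>{w \<in> W. \<nu> \<bullet> w \<noteq> 0}. AE y in restrict_space surface_measure \<Gamma>. y \<in> A w \<longrightarrow> m \<le> g y \<and> g y \<le> M"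
    proof
      fix w assume w: "w \<in> {w \<in> W. \<nu> \<bullet> w \<noteq> 0}"
      show "AE y in restrict_space surface_measure \<Gamma>. y \<in> A w \<longrightarrow> m \<le> g y \<and> g y \<le> M"
      proof (rule trace_bounds_layer[where c = c, OF \<Omega> K(1,4) \<Gamma> tr u \<nu>])
        have "open ((\<lambda>y. y + w) -` K)" by (intro open_vimage K continuous_intros)
        then have "open {y. y + w \<in> K}" by (simp add: vimage_def)
        then show "A w \<in> sets borel" using S(1) by (auto simp: A_def)
        show "y + t *\<^sub>R w \<in> K" if "y \<in> A w" "0 < t" "t \<le> 1" for y t
        proof -
          have "y - t *\<^sub>R (y - (y + w)) \<in> interior K"
            by (rule mem_interior_closure_convex_shrink) (use that S K in \<open>auto simp: A_def interior_open\<close>)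
          then show ?thesis using K(1) by (simp add: interior_open)
        qed
      qed (use w S Hc in \<open>auto simp: A_def\<close>)
    qed
  qed
  then show ?thesis
  proof eventually_elim
    case (elim y)
    show ?case
    proof
      assume y: "y \<in> S"
      \<comment> \<open>The directions from y into K that are transversal to the face. A nonempty
        open set is not contained in a hyperplane, so the dense set \<open>W\<close> contains one of
        them.\<close>
      define X where "X = (\<lambda>w. y + w) -` K \<inter> - {w. \<nu> \<bullet> w = 0}"
      have "open ((\<lambda>w. y + w) -` K)" by (intro open_vimage K continuous_intros)
      then have "open X" unfolding X_def by (intro open_Int open_Compl closed_hyperplane)
      moreover have "X \<noteq> {}"
      proof
        assume "X = {}"
        then have "(\<lambda>w. y + w) -` K \<subseteq> interior {w. \<nu> \<bullet> w = 0}"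
          using \<open>open ((\<lambda>w. y + w) -` K)\<close> by (intro interior_maximal) (auto simp: X_def)
        also have "\<dots> = {}" using \<nu> by (intro interior_hyperplane) auto
        finally have "(\<lambda>w. y + w) -` K = {}" by simp
        moreover obtain k where "k \<in> K" using K(3) by auto
        then have "k - y \<in> (\<lambda>w. y + w) -` K" by simp
        ultimately show False by blast
      qed
      ultimately obtain w where "w \<in> W" "w \<in> X" using W(2) by blast
      then show "m \<le> g y \<and> g y \<le> M" using elim y by (auto simp: A_def X_def)
    qed
  qed
qed

section \<open>Means over cells and edges\<close>

lemma set_mean_bounds:
  fixes f :: "'a \<Rightarrow> real"
  assumes A: "A \<in> sets \<mu>" "0 < emeasure \<mu> A" "emeasure \<mu> A < \<infinity>"
    and f: "(\<lambda>x. indicator A x *\<^sub>R f x) \<in> borel_measurable \<mu>"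
    and bd: "AE x in \<mu>. x \<in> A \<longrightarrow> m \<le> f x \<and> f x \<le> M"
  shows "m \<le> set_lebesgue_integral \<mu> A f / measure \<mu> A \<and> set_lebesgue_integral \<mu> A f / measure \<mu> A \<le> M"
proof -
  have pos: "0 < measure \<mu> A" using A(2,3) by (simp add: measure_def enn2real_positive_iff)
  have int: "integrable \<mu> (\<lambda>x. indicator A x *\<^sub>R f x)"
  proof (rule integrableI_bounded_set[where A = A and B = "\<bar>m\<bar> + \<bar>M\<bar>"])
    show "AE x in \<mu>. x \<in> A \<longrightarrow> norm (indicator A x *\<^sub>R f x) \<le> \<bar>m\<bar> + \<bar>M\<bar>"
      using bd by eventually_elim auto
  qed (use A f in auto)
  have ci: "integrable \<mu> (\<lambda>x. indicator A x * c)" "(LINT x|\<mu>. indicator A x * c) = measure \<mu> A * c" for c :: real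
    using A by (auto simp: less_top[symmetric])
  have "measure \<mu> A * m \<le> set_lebesgue_integral \<mu> A f"
    unfolding set_lebesgue_integral_def ci(2)[of m, symmetric]
    by (rule integral_mono_AE[OF ci(1) int]) (use bd in \<open>eventually_elim, auto simp: indicator_def\<close>)
  moreover have "set_lebesgue_integral \<mu> A f \<le> measure \<mu> A * M"
    unfolding set_lebesgue_integral_def ci(2)[of M, symmetric]
    by (rule integral_mono_AE[OF int ci(1)]) (use bd in \<open>eventually_elim, auto simp: indicator_def\<close>)
  ultimately show ?thesis using pos by (simp add: field_simps)
qed


subsection \<open>The scheme\<close>

text \<open>The data are known to be measurable only on \<Omega> or on \<open>\<Gamma>D\<close>,
  while the means integrate over the whole space; extension by zero bridges this.\<close>

lemma borel_measurable_indicator_subset: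
  fixes f :: "'a \<Rightarrow> real"
  assumes "f \<in> borel_measurable (restrict_space \<mu> \<Gamma>)" "\<Gamma> \<in> sets \<mu>" "A \<in> sets \<mu>" "A \<subseteq> \<Gamma>"
  shows "(\<lambda>x. indicator A x *\<^sub>R f x) \<in> borel_measurable \<mu>"
proof -
  have "(\<lambda>x. indicator \<Gamma> x *\<^sub>R f x) \<in> borel_measurable \<mu>"
    using assms(1,2) by (subst (asm) borel_measurable_restrict_space_iff) (auto simp: sets.Int_space_eq2)
  from borel_measurable_scaleR[OF borel_measurable_indicator[OF assms(3)] this]
  have "(\<lambda>x. indicator A x *\<^sub>R (indicator \<Gamma> x *\<^sub>R f x)) \<in> borel_measurable \<mu>" .
  moreover have "(\<lambda>x. indicator A x *\<^sub>R (indicator \<Gamma> x *\<^sub>R f x)) = (\<lambda>x. indicator A x *\<^sub>R f x)"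
    using assms(4) by (auto simp: indicator_def fun_eq_iff)
  ultimately show ?thesis by simp
qed

lemma set_lebesgue_integral_cong_restrict:
  fixes f g :: "'a \<Rightarrow> real"
  assumes "f \<in> borel_measurable (restrict_space \<mu> \<Gamma>)" "g \<in> borel_measurable (restrict_space \<mu> \<Gamma>)"
    and "\<Gamma> \<in> sets \<mu>" "A \<in> sets \<mu>" "A \<subseteq> \<Gamma>" and "AE x in restrict_space \<mu> \<Gamma>. f x - g x = 0"
  shows "set_lebesgue_integral \<mu> A f = set_lebesgue_integral \<mu> A g"
  unfolding set_lebesgue_integral_def
proof (rule integral_cong_AE)
  have "AE x in \<mu>. x \<in> \<Gamma> \<longrightarrow> f x - g x = 0"
    using assms(3,6) by (subst (asm) AE_restrict_space_iff) (auto simp: sets.Int_space_eq2)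
  then show "AE x in \<mu>. indicator A x *\<^sub>R f x = indicator A x *\<^sub>R g x"
    by eventually_elim (use assms(5) in \<open>auto simp: indicator_def\<close>)
qed (use assms borel_measurable_indicator_subset in blast)+

lemma edge_mean_bounds:
  assumes mesh: "admissible_mesh \<Omega> \<Gamma>D \<Gamma>N \<T>" and \<Omega>: "open \<Omega>" "bounded \<Omega>" and \<Gamma>D: "\<Gamma>D \<in> sets surface_measure"
    and tr: "is_trace \<Omega> \<Gamma>D u u" and u: "AE x in lebesgue_on \<Omega>. m \<le> u x \<and> u x \<le> M"
    and K: "K \<in> cells \<T>" "\<sigma> \<in> edges_of \<T> K" "\<sigma> \<subseteq> \<Gamma>D"
  shows "m \<le> edge_mean u \<sigma> \<and> edge_mean u \<sigma> \<le> M"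
  unfolding edge_mean_def
proof (rule set_mean_bounds)
  have E: "\<sigma> \<in> edges \<T>" using edges_of_subset[OF mesh K(1)] K(2) by auto
  show S: "\<sigma> \<in> sets surface_measure" by (rule edge_sets[OF mesh E])
  show "0 < emeasure surface_measure \<sigma>" using admissible_meshD(6)[OF mesh E] by auto
  show "emeasure surface_measure \<sigma> < \<infinity>" by (rule emeasure_edge_finite(2)[OF mesh E \<Omega>(2)])
  have "u \<in> borel_measurable (restrict_space surface_measure \<Gamma>D)"
    using tr by (simp add: is_trace_def in_L2_def)
  then show "(\<lambda>x. indicator \<sigma> x *\<^sub>R u x) \<in> borel_measurable surface_measure"
    using borel_measurable_indicator_subset[OF _ \<Gamma>D S K(3)] by blast
  obtain H where H: "H \<in> hyperplanes" "closure \<sigma> \<subseteq> H" using edge_hyperplane[OF mesh E] .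
  have Kp: "open K" "convex K" "K \<noteq> {}" "K \<subseteq> \<Omega>" using admissible_meshD(3)[OF mesh K(1)] by auto
  \<comment> \<open>Applied to the closure of the edge, which is closed and still lies in the closed
    cell and in the hyperplane.\<close>
  have "AE y in restrict_space surface_measure \<Gamma>D. y \<in> closure \<sigma> \<longrightarrow> m \<le> u y \<and> u y \<le> M"
    by (rule trace_bounds_face[OF \<Omega>(1) Kp \<Gamma>D tr u closed_closure closure_edge_subset[OF mesh K(1,2)] H(2,1)])
  then have "AE y in surface_measure. y \<in> \<Gamma>D \<longrightarrow> y \<in> closure \<sigma> \<longrightarrow> m \<le> u y \<and> u y \<le> M"
    using \<Gamma>D by (subst (asm) AE_restrict_space_iff) auto
  then show "AE y in surface_measure. y \<in> \<sigma> \<longrightarrow> m \<le> u y \<and> u y \<le> M"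
    by eventually_elim (use K(3) closure_subset[of \<sigma>] in auto)
qed

lemma cell_mean_bounds:
  assumes \<Omega>: "open \<Omega>" "bounded \<Omega>" and K: "open K" "K \<noteq> {}" "K \<subseteq> \<Omega>"
    and u: "in_Linfty \<Omega> u" "AE x in lebesgue_on \<Omega>. m \<le> u x \<and> u x \<le> M"
  shows "m \<le> cell_mean u K \<and> cell_mean u K \<le> M"
  unfolding cell_mean_def
proof (rule set_mean_bounds)
  show S: "K \<in> sets lebesgue" using K by simp
  have "\<not> negligible K" using K by (intro open_not_negligible) auto
  then show "0 < emeasure lebesgue K"
    using S by (simp add: negligible_iff_null_sets null_sets_def zero_less_iff_neq_zero)
  show "emeasure lebesgue K < \<infinity>"
    using lmeasurable_open[of K] K bounded_subset[OF \<Omega>(2)] by (auto simp: fmeasurable_def)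
  show "(\<lambda>x. indicator K x *\<^sub>R u x) \<in> borel_measurable lebesgue"
    by (rule borel_measurable_indicator_subset[where \<Gamma> = \<Omega>]) (use u \<Omega> K in \<open>auto simp: in_Linfty_def\<close>)
  have "AE x in lebesgue. x \<in> \<Omega> \<longrightarrow> m \<le> u x \<and> u x \<le> M"
    using u(2) \<Omega>(1) by (subst (asm) AE_restrict_space_iff) auto
  then show "AE x in lebesgue. x \<in> K \<longrightarrow> m \<le> u x \<and> u x \<le> M"
    by eventually_elim (use K in auto)
qed

theorem theorem1p1:
  fixes \<Omega> \<Gamma>D \<Gamma>N :: "'a::euclidean_space set"
    and N0 P0 ND PD PsiD :: "'a \<Rightarrow> real"
    and \<T> :: "'a mesh"
    and m M dt lam :: real
  assumes "hypotheses_H \<Omega> \<Gamma>D \<Gamma>N N0 P0 ND PD PsiD m M"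
    and "admissible_mesh \<Omega> \<Gamma>D \<Gamma>N \<T>"
    and "regular_mesh \<T>"
    and "dt > 0"
    and "lam \<ge> 0"
    and "lam = 0 \<Longrightarrow> (AE x in lebesgue_on \<Omega>. P0 x - N0 x = 0)"
    and "lam = 0 \<Longrightarrow> (AE x in restrict_space surface_measure \<Gamma>D. PD x - ND x = 0)"
    and "lam > 0 \<Longrightarrow> dirichlet_on_components \<Omega> \<Gamma>D"
  shows "(\<exists>N P Psi. scheme_solution \<Omega> \<Gamma>D \<T> lam dt N0 P0 ND PD PsiD N P Psi) \<and>
    (\<forall>N P Psi. scheme_solution \<Omega> \<Gamma>D \<T> lam dt N0 P0 ND PD PsiD N P Psi \<longrightarrow>
      (\<forall>K\<in>cells \<T>. \<forall>n. m \<le> N n K \<and> N n K \<le> M \<and> m \<le> P n K \<and> P n K \<le> M))"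
proof -
  note mesh = assms(2)
  have \<Omega>: "open \<Omega>" "bounded \<Omega>" and fr: "frontier \<Omega> = \<Gamma>D \<union> \<Gamma>N" "\<Gamma>D \<inter> \<Gamma>N = {}"
    and "emeasure surface_measure \<Gamma>D > 0" and m: "m > 0"
    and L: "in_Linfty \<Omega> N0" "in_Linfty \<Omega> P0" and tr: "is_trace \<Omega> \<Gamma>D ND ND" "is_trace \<Omega> \<Gamma>D PD PD"
    and bd: "AE x in lebesgue_on \<Omega>. m \<le> N0 x \<and> N0 x \<le> M \<and> m \<le> P0 x \<and> P0 x \<le> M \<and>
        m \<le> ND x \<and> ND x \<le> M \<and> m \<le> PD x \<and> PD x \<le> M"
    using assms(1) unfolding hypotheses_H_def by blast+
  \<comment> \<open>Nonmeasurable sets have \<open>emeasure\<close> 0, so the positive measure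
    implies measurability.\<close>
  have \<Gamma>D: "\<Gamma>D \<in> sets surface_measure"
    using \<open>emeasure surface_measure \<Gamma>D > 0\<close> by (auto intro: emeasure_neq_0_sets)
  have bds: "AE x in lebesgue_on \<Omega>. m \<le> N0 x \<and> N0 x \<le> M" "AE x in lebesgue_on \<Omega>. m \<le> P0 x \<and> P0 x \<le> M"
    "AE x in lebesgue_on \<Omega>. m \<le> ND x \<and> ND x \<le> M" "AE x in lebesgue_on \<Omega>. m \<le> PD x \<and> PD x \<le> M"
    using bd by (eventually_elim, simp)+
  define D where "D = {\<sigma> \<in> ext_edges \<Omega> \<T>. \<sigma> \<subseteq> \<Gamma>D}"
  have D_iff: "\<sigma> \<in> D \<longleftrightarrow> \<sigma> \<in> ext_edges \<Omega> \<T> \<and> \<sigma> \<subseteq> \<Gamma>D" for \<sigma> by (simp add: D_def)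
  interpret network "cells \<T>" "edges_of \<T>" "int_edges \<T>" D "neighbour \<T>" "transmissibility \<T>" "measure lebesgue"
    by (rule mesh_network[OF mesh \<Omega>(2)])
  have dif: "edge_diff \<Omega> \<Gamma>D \<T> uD u K \<sigma> = dif uD u K \<sigma>"
    and flux: "sg_flux \<Omega> \<Gamma>D \<T> uD u d K \<sigma> = flux uD u d K \<sigma>" for uD u d K \<sigma>
    by (simp_all add: edge_diff_def dif_def edge_value_def ev_def sg_flux_def flux_def D_iff)
  have cellp: "open K" "K \<noteq> {}" "K \<subseteq> \<Omega>" if "K \<in> cells \<T>" for K
    using admissible_meshD(3)[OF mesh that] by auto
  have init: "m \<le> cell_mean N0 K \<and> cell_mean N0 K \<le> M" "m \<le> cell_mean P0 K \<and> cell_mean P0 K \<le> M"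
    if "K \<in> cells \<T>" for K
    using cell_mean_bounds[OF \<Omega> cellp[OF that]] L bds by auto
  have dirN: "m \<le> edge_mean ND \<sigma> \<and> edge_mean ND \<sigma> \<le> M" and dirP: "m \<le> edge_mean PD \<sigma> \<and> edge_mean PD \<sigma> \<le> M"
    if "K \<in> cells \<T>" "\<sigma> \<in> edges_of \<T> K" "\<sigma> \<notin> int_edges \<T>" "\<sigma> \<in> D" for K \<sigma>
    using edge_mean_bounds[OF mesh \<Omega> \<Gamma>D _ _ that(1,2)] tr bds(3,4) that(4) by (auto simp: D_iff)
  have neutral0: "cell_mean P0 K = cell_mean N0 K" if "lam\<^sup>2 = 0" "K \<in> cells \<T>" for K
    unfolding cell_mean_def using L \<Omega> cellp[OF that(2)] assms(6) that(1)
    by (subst set_lebesgue_integral_cong_restrict[where \<Gamma> = \<Omega> and g = N0]) (auto simp: in_Linfty_def)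
  have neutralD: "edge_mean PD \<sigma> = edge_mean ND \<sigma>"
    if "lam\<^sup>2 = 0" "K \<in> cells \<T>" "\<sigma> \<in> edges_of \<T> K" "\<sigma> \<notin> int_edges \<T>" "\<sigma> \<in> D" for K \<sigma>
  proof -
    have "\<sigma> \<in> sets surface_measure" using edges_of_subset[OF mesh that(2)] that(3) by (intro edge_sets[OF mesh]) auto
    then have "set_lebesgue_integral surface_measure \<sigma> PD = set_lebesgue_integral surface_measure \<sigma> ND"
      using tr \<Gamma>D that(5) assms(7) that(1)
      by (intro set_lebesgue_integral_cong_restrict[where \<Gamma> = \<Gamma>D]) (auto simp: is_trace_def in_L2_def D_iff)
    then show ?thesis by (simp add: edge_mean_def)
  qed
  define bounded_state where "bounded_state = (\<lambda>n p. \<forall>K\<in>cells \<T>. m \<le> n K \<and> n K \<le> M \<and> m \<le> p K \<and> p K \<le> M)"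
  define poisson where "poisson = (\<lambda>n p \<psi>. \<forall>K\<in>cells \<T>.
      - lam\<^sup>2 * (\<Sum>\<sigma>\<in>edges_of \<T> K. transmissibility \<T> K \<sigma> * dif (edge_mean PsiD) \<psi> K \<sigma>) = measure lebesgue K * (p K - n K))"
  define step where "step = (\<lambda>n0 p0 n p \<psi>. \<forall>K\<in>cells \<T>.
      measure lebesgue K * (n K - n0 K) / dt
        + (\<Sum>\<sigma>\<in>edges_of \<T> K. flux (edge_mean ND) n (dif (edge_mean PsiD) \<psi> K \<sigma>) K \<sigma>) = 0 \<and>
      measure lebesgue K * (p K - p0 K) / dt
        + (\<Sum>\<sigma>\<in>edges_of \<T> K. flux (edge_mean PD) p (- dif (edge_mean PsiD) \<psi> K \<sigma>) K \<sigma>) = 0)"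
  have solution_iff: "scheme_solution \<Omega> \<Gamma>D \<T> lam dt N0 P0 ND PD PsiD N P Psi \<longleftrightarrow>
      (\<forall>K\<in>cells \<T>. N 0 K = cell_mean N0 K \<and> P 0 K = cell_mean P0 K) \<and>
      (\<forall>n. step (N n) (P n) (N (Suc n)) (P (Suc n)) (Psi (Suc n)) \<and> poisson (N n) (P n) (Psi n))" for N P Psi
    unfolding scheme_solution_def dif flux step_def poisson_def by blast
  \<comment> \<open>For \<lambda> = 0 this Poisson equation is the quasi-neutrality constraint. At
    the old time level it supplies equality of the previous densities, which is why a step below
    starts from a state satisfying \<open>poisson\<close>.\<close>
  have neutral: "p K = n K" if "lam\<^sup>2 = 0" "poisson n p \<psi>" "K \<in> cells \<T>" for n p \<psi> K
    using that vol_pos[OF that(3)] by (force simp: poisson_def)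
  have step_bounds: "bounded_state n p"
    if "bounded_state n0 p0" "poisson n0 p0 \<psi>0" "step n0 p0 n p \<psi>" "poisson n p \<psi>" for n0 p0 \<psi>0 n p \<psi>
    unfolding bounded_state_def
  proof
    fix K assume K: "K \<in> cells \<T>"
    show "m \<le> n K \<and> n K \<le> M \<and> m \<le> p K \<and> p K \<le> M"
      by (rule drift_diffusion_step_bounds[where ?n0.0 = n0 and ?p0.0 = p0 and \<psi> = \<psi> and dt = dt and \<epsilon> = "lam\<^sup>2"
            and nD = "edge_mean ND" and pD = "edge_mean PD" and \<psi>D = "edge_mean PsiD"])
        (use that K assms(4) m dirN dirP neutralD neutral[OF _ that(2)] in \<open>auto simp: step_def poisson_def bounded_state_def\<close>)
  qed
  have reach: "\<exists>n. reach n K" if "lam > 0" "K \<in> cells \<T>" for K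
    unfolding D_def using cells_reach_dirichlet[OF mesh \<Omega>(2,1) fr assms(3) assms(8)[OF that(1)] that(2)] .
  have step_ex: "\<exists>n p \<psi>. step n0 p0 n p \<psi> \<and> poisson n p \<psi>"
    if "bounded_state n0 p0" "poisson n0 p0 \<psi>0" for n0 p0 \<psi>0
  proof (cases "lam = 0")
    case False
    then have l: "lam > 0" using assms(5) by simp
    obtain n p \<psi> where
      "\<And>K. K \<in> cells \<T> \<Longrightarrow> measure lebesgue K * (n K - n0 K) / dt
        + (\<Sum>\<sigma>\<in>edges_of \<T> K. flux (edge_mean ND) n (dif (edge_mean PsiD) \<psi> K \<sigma>) K \<sigma>) = 0"
      "\<And>K. K \<in> cells \<T> \<Longrightarrow> measure lebesgue K * (p K - p0 K) / dt
        + (\<Sum>\<sigma>\<in>edges_of \<T> K. flux (edge_mean PD) p (- dif (edge_mean PsiD) \<psi> K \<sigma>) K \<sigma>) = 0"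
      "\<And>K. K \<in> cells \<T> \<Longrightarrow> - lam\<^sup>2 * (\<Sum>\<sigma>\<in>edges_of \<T> K. transmissibility \<T> K \<sigma> * dif (edge_mean PsiD) \<psi> K \<sigma>) = measure lebesgue K * (p K - n K)"
      by (rule drift_diffusion_step_exists[where ?n0.0 = n0 and ?p0.0 = p0 and dt = dt and \<epsilon> = "lam\<^sup>2" and m = m and M = M
            and nD = "edge_mean ND" and pD = "edge_mean PD" and \<psi>D = "edge_mean PsiD", OF reach[OF l]])
        (use \<open>bounded_state n0 p0\<close> l assms(4) m dirN dirP in \<open>auto simp: bounded_state_def\<close>)
    then have "step n0 p0 n p \<psi> \<and> poisson n p \<psi>" unfolding step_def poisson_def by blast
    then show ?thesis by blast
  next
    case True
    obtain n \<psi> where n: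
      "\<And>K. K \<in> cells \<T> \<Longrightarrow> measure lebesgue K * (n K - n0 K) / dt
        + (\<Sum>\<sigma>\<in>edges_of \<T> K. flux (edge_mean ND) n (dif (edge_mean PsiD) \<psi> K \<sigma>) K \<sigma>) = 0"
      "\<And>K. K \<in> cells \<T> \<Longrightarrow> measure lebesgue K * (n K - n0 K) / dt
        + (\<Sum>\<sigma>\<in>edges_of \<T> K. flux (edge_mean ND) n (- dif (edge_mean PsiD) \<psi> K \<sigma>) K \<sigma>) = 0"
      by (rule quasineutral_step_exists[where ?n0.0 = n0 and dt = dt and m = m and M = M
            and nD = "edge_mean ND" and \<psi>D = "edge_mean PsiD"])
        (use \<open>bounded_state n0 p0\<close> assms(4) m dirN in \<open>auto simp: bounded_state_def\<close>)
    \<comment> \<open>The electron density also serves as the hole density, since the boundary means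
      agree on Dirichlet edges.\<close>
    have "flux (edge_mean PD) n x K \<sigma> = flux (edge_mean ND) n x K \<sigma>" if "K \<in> cells \<T>" "\<sigma> \<in> edges_of \<T> K" for x K \<sigma>
      using that neutralD True by (auto simp: flux_def ev_def)
    then have "step n0 p0 n n \<psi>"
      using n neutral[OF _ \<open>poisson n0 p0 \<psi>0\<close>] True by (simp add: step_def)
    moreover have "poisson n n \<psi>" using True by (simp add: poisson_def)
    ultimately show ?thesis by blast
  qed
  \<comment> \<open>Invariant for the successive choice of states: the bounds make the next step
    solvable, and the Poisson equation keeps the case \<lambda> = 0 neutral. The last clause pins
    the initial densities.\<close>
  define S where "S = (\<lambda>i (n, p, \<psi>). bounded_state n p \<and> poisson n p \<psi> \<and>
      (i = (0::nat) \<longrightarrow> n = cell_mean N0 \<and> p = cell_mean P0))"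
  have "\<exists>s. \<forall>i. S i (s i) \<and> (case s i of (n0, p0, _) \<Rightarrow> case s (Suc i) of (n, p, \<psi>) \<Rightarrow> step n0 p0 n p \<psi>)"
  proof (rule dependent_nat_choice)
    \<comment> \<open>For \<lambda> = 0 every initial potential will do, because both sides of the
      equation vanish.\<close>
    have "\<exists>\<psi>. poisson (cell_mean N0) (cell_mean P0) \<psi>"
    proof (cases "lam = 0")
      case True
      then show ?thesis using neutral0 by (simp add: poisson_def)
    next
      case False
      then have l: "lam > 0" using assms(5) by simp
      obtain \<psi> where "\<And>K. K \<in> cells \<T> \<Longrightarrow> - lam\<^sup>2 * (\<Sum>\<sigma>\<in>edges_of \<T> K. transmissibility \<T> K \<sigma> * dif (edge_mean PsiD) \<psi> K \<sigma>)
          = measure lebesgue K * (cell_mean P0 K - cell_mean N0 K)"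
        by (rule poisson_exists[OF reach[OF l], where \<epsilon> = "lam\<^sup>2" and \<psi>D = "edge_mean PsiD"
              and f = "\<lambda>K. measure lebesgue K * (cell_mean P0 K - cell_mean N0 K)"]) (use l in auto)
      then show ?thesis unfolding poisson_def by blast
    qed
    then show "\<exists>s. S 0 s" using init by (auto simp: S_def bounded_state_def)
  next
    fix s i assume "S i s"
    obtain n0 p0 \<psi>0 where s: "s = (n0, p0, \<psi>0)" by (cases s)
    then have b: "bounded_state n0 p0" "poisson n0 p0 \<psi>0" using \<open>S i s\<close> by (auto simp: S_def)
    obtain n p \<psi> where "step n0 p0 n p \<psi>" "poisson n p \<psi>" using step_ex[OF b] by blast
    then show "\<exists>s'. S (Suc i) s' \<and> (case s of (n0, p0, _) \<Rightarrow> case s' of (n, p, \<psi>) \<Rightarrow> step n0 p0 n p \<psi>)"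
      using step_bounds[OF b] s by (intro exI[of _ "(n, p, \<psi>)"]) (simp add: S_def)
  qed
  then obtain s where s: "\<forall>i. S i (s i) \<and> (case s i of (n0, p0, _) \<Rightarrow> case s (Suc i) of (n, p, \<psi>) \<Rightarrow> step n0 p0 n p \<psi>)" ..
  have "scheme_solution \<Omega> \<Gamma>D \<T> lam dt N0 P0 ND PD PsiD (\<lambda>i. fst (s i)) (\<lambda>i. fst (snd (s i))) (\<lambda>i. snd (snd (s i)))"
    unfolding solution_iff
  proof (intro conjI allI)
    show "\<forall>K\<in>cells \<T>. fst (s 0) K = cell_mean N0 K \<and> fst (snd (s 0)) K = cell_mean P0 K"
      using s[rule_format, of 0] by (simp add: S_def split_beta)
  next
    fix i
    show "step (fst (s i)) (fst (snd (s i))) (fst (s (Suc i))) (fst (snd (s (Suc i)))) (snd (snd (s (Suc i))))"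
      using s[rule_format, of i] by (simp add: split_beta)
    show "poisson (fst (s i)) (fst (snd (s i))) (snd (snd (s i)))"
      using s[rule_format, of i] by (simp add: S_def split_beta)
  qed
  moreover have "bounded_state (N n) (P n)" if "scheme_solution \<Omega> \<Gamma>D \<T> lam dt N0 P0 ND PD PsiD N P Psi" for N P Psi n
  proof (induction n)
    case 0
    then show ?case using that init unfolding solution_iff by (simp add: bounded_state_def)
  next
    case (Suc n)
    then show ?case using step_bounds that unfolding solution_iff by blast
  qed
  ultimately show ?thesis unfolding bounded_state_def by blast
qed

end
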